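(* Let $s\in(0,1]$ be fixed. There exists $a_0>0$ such that for all $a\in(0,a_0)$ there is a unique odd local periodic solution $\varphi$ of $$(-\Delta)^s\varphi-\omega\varphi+\varphi^3=0,$$ given by the expansions $$\varphi(x)=a\sin(x)+\frac{1}{4(3^{2s}-1)}a^3\sin(3x)+\mathcal O(a^5),\qquad \omega=1+\frac34a^2+\mathcal O(a^4).$$ For $s\in\left(\frac14,1\right]$, the pair $(\varphi,\omega)\in H^s_{per,odd}\times(1,+\infty)$ is global in terms of the parameter $\omega>1$: the local family extends to a continuous family $\omega\in(1,+\infty)\mapsto\varphi_\omega\in H^s_{per,odd}$ of solutions of $(-\Delta)^s\varphi_\omega-\omega\varphi_\omega+\varphi_\omega^3=0$.
   Context: All functions are $2\pi$-periodic and real-valued. The fractional Laplacian is $\widehat{(-\Delta)^s V}(\xi)=|\xi|^{2s}\widehat V(\xi)$, $\xi\in\mathbb Z$. $H^s_{per}$ is the periodic Sobolev space with norm $\|f\|_{H^s_{per}}^2=2\pi\sum_{k\in\mathbb Z}(1+k^2)^s|\hat f(k)|^2$, and $H^s_{per,odd}$ is its subspace of odd functions. "Local" refers to the local bifurcation curve $a\in(0,a_0)\mapsto(\varphi_a,\omega_a)\in H^{2s}_{per,odd}\times(0,+\infty)$ of nontrivial solutions emanating from the bifurcation point $(0,1)$ of the trivial branch $\varphi=0$, with $\omega_a\to1$ and $\partial_a\varphi_a\to\sin(x)$ as $a\to0$; "unique local solution" means the solution on this curve corresponding to the parameter $a$. *)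

theory Defs
  imports "HOL-Analysis.Analysis" "HOL-Library.Landau_Symbols"
begin

(* Elements of the function spaces are represented by functions on the real line that are
   periodic (and odd) everywhere; two representatives are identified when they agree almost
   everywhere, so equations between elements are written with AE. *)

definition periodic_2pi :: "(real \<Rightarrow> real) \<Rightarrow> bool" where
  "periodic_2pi f \<longleftrightarrow> (\<forall>x. f (x + 2 * pi) = f x)"

definition fourier_coeff :: "(real \<Rightarrow> real) \<Rightarrow> int \<Rightarrow> complex" where
  "fourier_coeff f k =
     (LINT x:{-pi..pi}|lborel. complex_of_real (f x) * cis (- (real_of_int k * x))) / (2 * pi)"

definition Hper :: "real \<Rightarrow> (real \<Rightarrow> real) set" where
  "Hper s = {f. periodic_2pi f \<and> f \<in> borel_measurable lborel \<and>
     set_integrable lborel {-pi..pi} (\<lambda>x. (f x)\<^sup>2) \<and>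
     (\<lambda>k. (1 + (real_of_int k)\<^sup>2) powr s * (cmod (fourier_coeff f k))\<^sup>2) summable_on UNIV}"

definition Hper_odd :: "real \<Rightarrow> (real \<Rightarrow> real) set" where
  "Hper_odd s = {f \<in> Hper s. \<forall>x. f (- x) = - f x}"

(* Only meaningful on Hper s: infsum is 0 for a divergent family. *)
definition Hper_norm :: "real \<Rightarrow> (real \<Rightarrow> real) \<Rightarrow> real" where
  "Hper_norm s f =
     sqrt (2 * pi * (\<Sum>\<^sub>\<infinity>k. (1 + (real_of_int k)\<^sup>2) powr s * (cmod (fourier_coeff f k))\<^sup>2))"

definition Hper_tendsto ::
    "real \<Rightarrow> (real \<Rightarrow> real \<Rightarrow> real) \<Rightarrow> (real \<Rightarrow> real) \<Rightarrow> real filter \<Rightarrow> bool" where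
  "Hper_tendsto s f l F \<longleftrightarrow> ((\<lambda>t. Hper_norm s (\<lambda>x. f t x - l x)) \<longlongrightarrow> 0) F"

(* W represents the fractional Laplacian of V. It is a relation because W is determined by
   its Fourier coefficients only almost everywhere. *)
definition frac_laplacian :: "real \<Rightarrow> (real \<Rightarrow> real) \<Rightarrow> (real \<Rightarrow> real) \<Rightarrow> bool" where
  "frac_laplacian s V W \<longleftrightarrow> periodic_2pi W \<and> set_integrable lborel {-pi..pi} W \<and>
     (\<forall>k. fourier_coeff W k = complex_of_real (\<bar>real_of_int k\<bar> powr (2 * s)) * fourier_coeff V k)"

(* For phi in Hper (2 s) the fractional Laplacian is square-integrable and this is the strong
   form of the equation; for phi in Hper s with s > 1/4 the cube of phi is integrable and this
   is the distributional form. *)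
definition solves :: "real \<Rightarrow> real \<Rightarrow> (real \<Rightarrow> real) \<Rightarrow> bool" where
  "solves s \<omega> \<phi> \<longleftrightarrow>
     (\<exists>W. frac_laplacian s \<phi> W \<and> (AE x in lborel. W x - \<omega> * \<phi> x + (\<phi> x) ^ 3 = 0))"

(* The amplitude of the fundamental harmonic. *)
definition sin_coeff1 :: "(real \<Rightarrow> real) \<Rightarrow> real" where
  "sin_coeff1 f = (LINT x:{-pi..pi}|lborel. f x * sin x) / pi"

definition bifurcation_curve ::
    "real \<Rightarrow> real \<Rightarrow> (real \<Rightarrow> real \<Rightarrow> real) \<Rightarrow> (real \<Rightarrow> real) \<Rightarrow> bool" where
  "bifurcation_curve s a0 \<phi> \<omega> \<longleftrightarrow>
     (\<forall>a\<in>{0<..<a0}. \<phi> a \<in> Hper_odd (2 * s) \<and> \<omega> a > 0 \<and> solves s (\<omega> a) (\<phi> a) \<and>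
        \<not> (AE x in lborel. \<phi> a x = 0)) \<and>
     continuous_on {0<..<a0} \<omega> \<and>
     Hper_tendsto (2 * s) \<phi> (\<lambda>x. 0) (at_right 0) \<and>
     (\<omega> \<longlongrightarrow> 1) (at_right 0) \<and>
     (\<exists>d\<phi>. (\<forall>a\<in>{0<..<a0}. d\<phi> a \<in> Hper_odd (2 * s) \<and>
               Hper_tendsto (2 * s) (\<lambda>h x. (\<phi> (a + h) x - \<phi> a x) / h) (d\<phi> a) (at 0)) \<and>
           Hper_tendsto (2 * s) d\<phi> sin (at_right 0))"

(* Being local means lying in the \<epsilon>-neighbourhood of the bifurcation point (0, 1). The
   parameter a of a local solution is its Lyapunov-Schmidt coordinate: the remainder
   phi - a sin is L2-orthogonal to the kernel, which is spanned by sin. *)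
definition local_solution ::
    "real \<Rightarrow> real \<Rightarrow> real \<Rightarrow> (real \<Rightarrow> real) \<Rightarrow> real \<Rightarrow> bool" where
  "local_solution s \<epsilon> a \<phi> \<omega> \<longleftrightarrow>
     \<phi> \<in> Hper_odd (2 * s) \<and> \<omega> > 0 \<and> solves s \<omega> \<phi> \<and>
     Hper_norm (2 * s) \<phi> < \<epsilon> \<and> \<bar>\<omega> - 1\<bar> < \<epsilon> \<and> sin_coeff1 \<phi> = a"

end

(*
Everything is expressed through the sine coefficients b_n of odd functions on the half period (0, pi).

Local branch. Dividing by a and writing t = a^2, the equation becomes a recursion for the coefficients of
a power series in t with values in odd trigonometric polynomials; because of the factor t in front of the
nonlinearity, the partial sums of the norms in the Wiener algebra stay bounded by induction. So the branch
is analytic in a, with values in every space controlled by sum n^(2s) |b_n|, for all s > 0.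

Uniqueness. Solutions in H^(2s) are weak solutions (their cubes are square integrable by Riesz-Fischer),
and weak solutions with the same first coefficient are compared in L^2, using the monotonicity of the cube.

Global branch. For w > 1 take the minimizer, positive on (0, pi), of the energy
(1/2) <(-Delta)^s f, f> + (1/4) int (f^2 - w)^2. The Dirichlet Green function of mu^2 - d^2/dx^2 is
positive, and k^(2s) is an average of the symbols k^2 / (k^2 + mu^2); hence the fractional Dirichlet form is
convex as a function of f^2, and the energy is strictly so. This makes minimizing sequences Cauchy and the
minimizer Lipschitz continuous in w, in the sense of f^2 in L^2. Its first coefficient is positive and tends
to 0 as w tends to 1, so by local uniqueness it lies on the branch, and w is strictly increasing along it.
*)
theory Submission
  imports Defs "HOL-Real_Asymp.Real_Asymp"
begin

text \<open>As a function of \<open>f\<close> the energy is not convex, because of the term with -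
  \<omega> f^2, and neither H^s nor H^(2s) embeds into L^4 for every \<open>s\<close> in (0, 1].
  Taking the square as the variable removes both obstacles: the convexity is strong enough to give
  convergence in norm, so that no compactness enters, and the fourth power belongs to the energy.
  The price is that only \<open>f^2 - g^2\<close> is controlled; hence the minimizers are sought
  among functions of one sign on (0, pi). The power series lives in H^(2s), the minimizers in H^s
  with L^4, and weak solutions are the common ground on which they are compared. There the first
  sine coefficient is prescribed, whereas the global family prescribes the frequency; monotonicity
  of the frequency converts one parameter into the other. The power series variable is u = a^2 / T.
  Inverting (-\<Delta>)^s - 1 off its kernel costs a factor at most K = 2^(2s) / (2^(2s) - 1),
  attained at n = 2; keeping the partial sums at most 2 costs 2^3 + 2^4 = 24 such factors, whence
  the condition 24 T K \<le> 1.\<close>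

section \<open>Sine series on the half period\<close>

text \<open>Lebesgue measure on \<open>[0, \<pi>]\<close>, given by a density so that its measurable sets are the Borel sets
  of the line.\<close>

definition MI :: "real measure" where
  "MI = density lborel (\<lambda>x. ennreal (indicator {0..pi} x))"

lemma sets_MI [measurable_cong, simp]: "sets MI = sets borel"
  by (simp add: MI_def)

lemma space_MI [simp]: "space MI = UNIV"
  by (simp add: MI_def)

lemma measurable_MI [simp]: "measurable MI N = measurable borel N"
  by (rule measurable_cong_sets) auto

lemma integrable_MI:
  fixes f :: "real \<Rightarrow> real"
  assumes [measurable]: "f \<in> borel_measurable borel"
  shows "integrable MI f \<longleftrightarrow> set_integrable lborel {0..pi} f"
  unfolding MI_def set_integrable_def by (subst integrable_density) auto

lemma integral_MI:
  fixes f :: "real \<Rightarrow> real"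
  assumes [measurable]: "f \<in> borel_measurable borel"
  shows "integral\<^sup>L MI f = (LINT x:{0..pi}|lborel. f x)"
  unfolding MI_def set_lebesgue_integral_def by (subst integral_density) auto

lemma AE_MI: "(AE x in MI. P x) \<longleftrightarrow> (AE x in lborel. x \<in> {0..pi} \<longrightarrow> P x)"
proof -
  have "(0 < ennreal (indicator {0..pi} x)) = (x \<in> {0..pi})" for x :: real
    by (auto simp: indicator_def)
  then show ?thesis unfolding MI_def by (subst AE_density) auto
qed

lemma AE_MI_open: "AE x in MI. 0 < x \<and> x < pi"
proof -
  have "AE x in lborel. x \<noteq> 0 \<and> x \<noteq> pi"
    using AE_lborel_singleton[of "0::real"] AE_lborel_singleton[of "pi"] by eventually_elim auto
  then show ?thesis unfolding AE_MI by eventually_elim auto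
qed

lemma emeasure_MI: "emeasure MI UNIV = ennreal pi"
  unfolding MI_def by (subst emeasure_density) (auto simp: ennreal_indicator)

interpretation MI: finite_measure MI
  by standard (simp add: emeasure_MI)

lemma measure_MI [simp]: "measure MI UNIV = pi"
  by (simp add: measure_def emeasure_MI)

lemma integral_MI_FTC:
  fixes f F :: "real \<Rightarrow> real"
  assumes "\<And>x. (F has_real_derivative f x) (at x)" "continuous_on UNIV f"
  shows "integrable MI f" "integral\<^sup>L MI f = F pi - F 0"
proof -
  have [measurable]: "f \<in> borel_measurable borel"
    using assms(2) by (rule borel_measurable_continuous_onI)
  show "integrable MI f"
    unfolding integrable_MI[OF \<open>f \<in> _\<close>]
    by (rule borel_integrable_atLeastAtMost') (rule continuous_on_subset[OF assms(2)], simp)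
  have "(LINT x|lborel. f x * indicator {0..pi} x) = F pi - F 0"
    using assms by (intro integral_FTC_Icc_real)
       (auto simp: continuous_on_eq_continuous_at)
  then show "integral\<^sup>L MI f = F pi - F 0"
    by (simp add: integral_MI set_lebesgue_integral_def mult.commute)
qed

lemma integrable_MI_cont:
  fixes f :: "real \<Rightarrow> real"
  assumes "continuous_on UNIV f"
  shows "integrable MI f"
proof -
  have [measurable]: "f \<in> borel_measurable borel"
    using assms by (rule borel_measurable_continuous_onI)
  show "integrable MI f"
    unfolding integrable_MI[OF \<open>f \<in> _\<close>]
    by (rule borel_integrable_atLeastAtMost') (rule continuous_on_subset[OF assms], simp)
qed

lemma integral_cos_MI: "(LINT x|MI. cos (real_of_int k * x)) = (if k = 0 then pi else 0)"
proof (cases "k = 0")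
  case False
  have "(LINT x|MI. cos (real_of_int k * x)) = sin (real_of_int k * pi) / k - sin (real_of_int k * 0) / k"
    using False
    by (intro integral_MI_FTC(2)) (auto intro!: derivative_eq_intros continuous_intros)
  also have "sin (real_of_int k * pi) = 0"
    using sin_zero_iff_int2 by auto
  finally show ?thesis using False by simp
qed simp

lemma integral_sin_sin_MI:
  "(LINT x|MI. sin (real m * x) * sin (real n * x)) = (if m = n \<and> m \<noteq> 0 then pi / 2 else 0)"
proof -
  have "sin (real m * x) * sin (real n * x)
      = (cos (real_of_int (int m - int n) * x) - cos (real_of_int (int m + int n) * x)) / 2" for x
    by (simp add: sin_times_sin algebra_simps)
  then have "(LINT x|MI. sin (real m * x) * sin (real n * x))
      = (LINT x|MI. (cos (real_of_int (int m - int n) * x) - cos (real_of_int (int m + int n) * x)) / 2)"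
    by (metis (no_types, lifting))
  also have "\<dots> = ((LINT x|MI. cos (real_of_int (int m - int n) * x))
      - (LINT x|MI. cos (real_of_int (int m + int n) * x))) / 2"
    by (subst integral_divide_zero, subst Bochner_Integration.integral_diff)
       (auto intro!: integrable_MI_cont continuous_intros)
  also have "\<dots> = (if m = n \<and> m \<noteq> 0 then pi / 2 else 0)"
    unfolding integral_cos_MI by auto
  finally show ?thesis .
qed

text \<open>An odd function \<open>f\<close> has the expansion \<open>\<Sum>n. scf f n * sin (n x)\<close>.\<close>

definition scf :: "(real \<Rightarrow> real) \<Rightarrow> nat \<Rightarrow> real" where
  "scf f n = 2 / pi * (LINT x|MI. f x * sin (real n * x))"

lemma integrable_MI_times_bounded:
  fixes f g :: "real \<Rightarrow> real"
  assumes "integrable MI f" and [measurable]: "g \<in> borel_measurable borel" and "\<And>x. \<bar>g x\<bar> \<le> B"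
  shows "integrable MI (\<lambda>x. f x * g x)"
proof (rule Bochner_Integration.integrable_bound)
  show "integrable MI (\<lambda>x. B * f x)" using assms(1) by simp
  show "(\<lambda>x. f x * g x) \<in> borel_measurable MI"
    using borel_measurable_integrable[OF assms(1)] by simp
  show "AE x in MI. norm (f x * g x) \<le> norm (B * f x)"
  proof (rule AE_I2)
    fix x
    have "\<bar>g x\<bar> \<le> \<bar>B\<bar>" using assms(3)[of x] by linarith
    from mult_left_mono[OF this, of "\<bar>f x\<bar>"] show "norm (f x * g x) \<le> norm (B * f x)"
      by (simp add: abs_mult mult.commute[of "\<bar>B\<bar>"])
  qed
qed

lemma integrable_MI_sin:
  "integrable MI f \<Longrightarrow> integrable MI (\<lambda>x. f x * sin (real n * x))"
  by (rule integrable_MI_times_bounded[where B = 1]) auto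

lemma scf_0 [simp]: "scf f 0 = 0"
  by (simp add: scf_def)

lemma scf_add: "integrable MI f \<Longrightarrow> integrable MI g \<Longrightarrow> scf (\<lambda>x. f x + g x) n = scf f n + scf g n"
  by (simp add: scf_def distrib_right integrable_MI_sin distrib_left)

lemma scf_diff: "integrable MI f \<Longrightarrow> integrable MI g \<Longrightarrow> scf (\<lambda>x. f x - g x) n = scf f n - scf g n"
  by (simp add: scf_def left_diff_distrib integrable_MI_sin right_diff_distrib)

lemma scf_cmult [simp]: "scf (\<lambda>x. c * f x) n = c * scf f n"
  by (simp add: scf_def mult.assoc)

lemma scf_sum:
  "(\<And>i. i \<in> I \<Longrightarrow> integrable MI (f i)) \<Longrightarrow> scf (\<lambda>x. \<Sum>i\<in>I. f i x) n = (\<Sum>i\<in>I. scf (f i) n)"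
  by (simp add: scf_def sum_distrib_right integrable_MI_sin sum_distrib_left)

lemma scf_sin: "scf (\<lambda>x. sin (real m * x)) n = (if m = n \<and> m \<noteq> 0 then 1 else 0)"
  by (simp add: scf_def integral_sin_sin_MI)

lemma scf_cong_AE:
  assumes "AE x in MI. f x = g x" "f \<in> borel_measurable borel" "g \<in> borel_measurable borel"
  shows "scf f n = scf g n"
  unfolding scf_def using assms
  by (intro arg_cong2[where f=times] refl integral_cong_AE) auto

lemma scf_le: "integrable MI f \<Longrightarrow> \<bar>scf f n\<bar> \<le> 2 / pi * (LINT x|MI. \<bar>f x\<bar>)"
proof -
  assume f: "integrable MI f"
  have "\<bar>LINT x|MI. f x * sin (real n * x)\<bar> \<le> (LINT x|MI. \<bar>f x * sin (real n * x)\<bar>)"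
    by (rule integral_abs_bound)
  also have "\<dots> \<le> (LINT x|MI. \<bar>f x\<bar>)"
    using f integrable_MI_sin[OF f]
    by (intro integral_mono integrable_abs) (auto simp: abs_mult intro: mult_left_le)
  finally show ?thesis
    by (simp add: scf_def abs_mult mult_left_mono divide_right_mono)
qed

lemma abs_sin_mult_le:
  fixes x y B :: real
  assumes "\<bar>y\<bar> \<le> B"
  shows "\<bar>sin x * y\<bar> \<le> B"
proof -
  have "\<bar>sin x\<bar> * \<bar>y\<bar> \<le> 1 * B" using assms by (intro mult_mono) auto
  then show ?thesis by (simp add: abs_mult)
qed

text \<open>The products of \<open>sin x\<close> with polynomials in \<open>cos x\<close> are the sine polynomials, and by
  Weierstrass these approximate \<open>sin x * h x\<close> uniformly for continuous \<open>h\<close>.\<close>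

lemma scf_zero_imp_AE_zero:
  assumes f: "integrable MI f" and z: "\<And>n. scf f n = 0"
  shows "AE x in MI. f x = 0"
proof -
  have fm [measurable]: "f \<in> borel_measurable borel"
    using borel_measurable_integrable[OF f] by simp
  have int_b: "integrable MI (\<lambda>x. f x * g x)"
    if "g \<in> borel_measurable borel" "\<And>x. \<bar>g x\<bar> \<le> B" for g B
    using integrable_MI_times_bounded[OF f that] .
  have pow_b: "\<bar>sin (real n * x) * cos x ^ k\<bar> \<le> 1" for n k x
    by (simp add: abs_mult power_abs mult_le_one power_le_one)
  \<comment> \<open>The index \<open>n\<close> stays arbitrary because sin(n x) cos x is the mean of
    the sines of (n + 1) x and (n - 1) x: one factor cos is traded for the neighbouring
    indices.\<close>
  have pow: "(LINT x|MI. f x * (sin (real n * x) * cos x ^ k)) = 0" for n k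
  proof (induction k arbitrary: n)
    case 0
    then show ?case using z[of n] by (simp add: scf_def)
  next
    case (Suc k)
    show ?case
    proof (cases n)
      case (Suc m)
      have "sin (real n * x) * cos x ^ Suc k =
          (sin (real (Suc n) * x) * cos x ^ k + sin (real m * x) * cos x ^ k) / 2" for x
      proof -
        have "sin (real n * x) * cos x = (sin (real (Suc n) * x) + sin (real m * x)) / 2"
          using sin_times_cos[of "real n * x" x] by (simp add: Suc distrib_right)
        then have "(sin (real n * x) * cos x) * cos x ^ k
            = (sin (real (Suc n) * x) + sin (real m * x)) / 2 * cos x ^ k" by (rule arg_cong)
        then show ?thesis by (simp only: power_Suc mult.assoc distrib_right times_divide_eq_left)
      qed
      then have "(LINT x|MI. f x * (sin (real n * x) * cos x ^ Suc k))
        = (LINT x|MI. (f x * (sin (real (Suc n) * x) * cos x ^ k) + f x * (sin (real m * x) * cos x ^ k)) / 2)"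
        by (simp only: times_divide_eq_right distrib_left)
      also have "\<dots> = 0"
        by (subst integral_divide_zero, subst Bochner_Integration.integral_add)
           (use Suc.IH pow_b in \<open>auto intro!: int_b simp del: of_nat_Suc\<close>)
      finally show ?thesis .
    qed simp
  qed
  have poly: "(LINT x|MI. f x * (sin x * p (cos x))) = 0" if "real_polynomial_function p" for p
  proof -
    from that obtain a n where p: "p = (\<lambda>x. \<Sum>i\<le>n. a i * x^i)"
      unfolding real_polynomial_function_iff_sum by auto
    have "(LINT x|MI. f x * (sin x * p (cos x)))
        = (LINT x|MI. (\<Sum>i\<le>n. a i * (f x * (sin x * cos x ^ i))))"
      unfolding p by (intro Bochner_Integration.integral_cong refl)
        (simp add: sum_distrib_left mult_ac)
    also have "\<dots> = (\<Sum>i\<le>n. a i * (LINT x|MI. f x * (sin x * cos x ^ i)))"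
      using pow_b[of 1] by (subst Bochner_Integration.integral_sum) (auto intro!: int_b)
    also have "\<dots> = 0" using pow[of 1] by simp
    finally show ?thesis .
  qed
  have cont: "(LINT x|MI. f x * (sin x * h x)) = 0"
    if h: "continuous_on UNIV h" and hb: "\<And>x. \<bar>h x\<bar> \<le> B" for h :: "real \<Rightarrow> real" and B
  proof -
    have hm [measurable]: "h \<in> borel_measurable borel"
      using h by (rule borel_measurable_continuous_onI)
    have "\<bar>LINT x|MI. f x * (sin x * h x)\<bar> \<le> e * (LINT x|MI. \<bar>f x\<bar>)" if e: "e > 0" for e
    proof -
      \<comment> \<open>With u = cos x a continuous function on [0, pi] becomes a continuous
        function of u in [-1, 1], to which polynomial approximation applies.\<close>
      have "continuous_on {-1..1} (\<lambda>u. h (arccos u))"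
        by (intro continuous_on_compose2[OF h] continuous_on_arccos') auto
      then obtain p where p: "real_polynomial_function p"
        and pe: "\<And>u. u \<in> {-1..1} \<Longrightarrow> \<bar>h (arccos u) - p u\<bar> < e"
        using Stone_Weierstrass_real_polynomial_function[OF compact_Icc _ e] by metis
      have cp: "continuous_on UNIV p"
        using p by (simp add: continuous_real_polymonial_function continuous_on_eq_continuous_at)
      have [measurable]: "p \<in> borel_measurable borel"
        using cp by (rule borel_measurable_continuous_onI)
      have pb: "\<bar>p (cos x)\<bar> \<le> B + e" for x
      proof -
        have "\<bar>h (arccos (cos x)) - p (cos x)\<bar> < e" by (rule pe) auto
        then show ?thesis using hb[of "arccos (cos x)"] by linarith
      qed
      have i1: "integrable MI (\<lambda>x. f x * (sin x * h x))"
        using hb by (intro int_b[where B=B]) (auto intro: abs_sin_mult_le)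
      have i2: "integrable MI (\<lambda>x. f x * (sin x * p (cos x)))"
        using pb by (intro int_b[where B="B+e"]) (auto intro: abs_sin_mult_le)
      have "(LINT x|MI. f x * (sin x * h x)) = (LINT x|MI. f x * (sin x * h x) - f x * (sin x * p (cos x)))"
        using poly[OF p] i1 i2 by simp
      also have "\<bar>\<dots>\<bar> \<le> (LINT x|MI. \<bar>f x * (sin x * h x) - f x * (sin x * p (cos x))\<bar>)"
        by (rule integral_abs_bound)
      also have "\<dots> \<le> (LINT x|MI. e * \<bar>f x\<bar>)"
      proof (rule integral_mono_AE)
        show "integrable MI (\<lambda>x. \<bar>f x * (sin x * h x) - f x * (sin x * p (cos x))\<bar>)"
          using i1 i2 by auto
        show "integrable MI (\<lambda>x. e * \<bar>f x\<bar>)" using f by auto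
        show "AE x in MI. \<bar>f x * (sin x * h x) - f x * (sin x * p (cos x))\<bar> \<le> e * \<bar>f x\<bar>"
          using AE_MI_open
        proof eventually_elim
          case (elim x)
          have "\<bar>h (arccos (cos x)) - p (cos x)\<bar> < e" by (rule pe) auto
          then have "\<bar>h x - p (cos x)\<bar> \<le> e" using elim by (simp add: arccos_cos)
          then have "\<bar>sin x\<bar> * \<bar>h x - p (cos x)\<bar> \<le> 1 * e"
            by (intro mult_mono) auto
          then have "\<bar>f x\<bar> * (\<bar>sin x\<bar> * \<bar>h x - p (cos x)\<bar>) \<le> \<bar>f x\<bar> * e"
            by (intro mult_left_mono) auto
          moreover have "f x * (sin x * h x) - f x * (sin x * p (cos x)) = f x * (sin x * (h x - p (cos x)))"
            by (simp add: algebra_simps)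
          ultimately show ?case by (simp add: abs_mult mult.commute)
        qed
      qed
      finally show ?thesis by simp
    qed
    then have le: "\<forall>e>0. \<bar>LINT x|MI. f x * (sin x * h x)\<bar> \<le> e * (LINT x|MI. \<bar>f x\<bar>)" by blast
    have "\<bar>LINT x|MI. f x * (sin x * h x)\<bar> \<le> 0"
    proof (rule tendsto_lowerbound)
      show "((\<lambda>e. e * (LINT x|MI. \<bar>f x\<bar>)) \<longlongrightarrow> 0) (at_right 0)"
        by (auto intro!: tendsto_eq_intros)
      show "eventually (\<lambda>e. \<bar>LINT x|MI. f x * (sin x * h x)\<bar> \<le> e * (LINT x|MI. \<bar>f x\<bar>)) (at_right 0)"
        using le by (auto simp: eventually_at_right_field intro: exI[of _ 1])
    qed simp
    then show ?thesis by simp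
  qed
  \<comment> \<open>The sign of \<open>f * sin\<close> is the ideal test function, since it turns
    the integrand into its absolute value. It is not continuous, so it is approached almost
    everywhere by continuous functions, clipped to [-1, 1] to be dominated.\<close>
  define k where "k x = sgn (f x * sin x)" for x
  have km [measurable]: "k \<in> borel_measurable borel" unfolding k_def by measurable
  have "k measurable_on UNIV"
    using km by (intro lebesgue_measurable_imp_measurable_on) (auto intro: measurable_completion)
  then obtain N g where N: "negligible N" and g: "\<And>n::nat. continuous_on UNIV (g n)"
    and gk: "\<And>x. x \<notin> N \<Longrightarrow> (\<lambda>n. g n x) \<longlonglongrightarrow> k x"
    unfolding measurable_on_def by auto
  define h where "h n x = max (-1) (min 1 (g n x))" for n x
  have hc: "continuous_on UNIV (h n)" for n unfolding h_def using g by (intro continuous_intros) 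
  have [measurable]: "h n \<in> borel_measurable borel" for n
    using hc by (rule borel_measurable_continuous_onI)
  have hb: "\<bar>h n x\<bar> \<le> 1" for n x by (auto simp: h_def)
  have Nn: "AE x in MI. x \<notin> N"
  proof -
    have "N \<in> null_sets lebesgue" using N by (simp add: negligible_iff_null_sets)
    then have "AE x in lebesgue. x \<notin> N" by (rule AE_not_in)
    then have "AE x in lborel. x \<notin> N" by (simp add: AE_completion_iff)
    then show ?thesis unfolding AE_MI by eventually_elim auto
  qed
  have "(\<lambda>n. LINT x|MI. f x * (sin x * h n x)) \<longlonglongrightarrow> (LINT x|MI. f x * (sin x * k x))"
  proof (rule integral_dominated_convergence[where w="\<lambda>x. \<bar>f x\<bar>"])
    show "AE x in MI. (\<lambda>n. f x * (sin x * h n x)) \<longlonglongrightarrow> f x * (sin x * k x)"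
      using Nn
    proof eventually_elim
      case (elim x)
      have "(\<lambda>n. h n x) \<longlonglongrightarrow> max (-1) (min 1 (k x))"
        unfolding h_def by (intro tendsto_intros gk elim)
      also have "max (-1) (min 1 (k x)) = k x" by (auto simp: k_def sgn_real_def)
      finally show ?case by (intro tendsto_intros)
    qed
    show "AE x in MI. norm (f x * (sin x * h n x)) \<le> \<bar>f x\<bar>" for n
    proof (rule AE_I2)
      fix x
      have "\<bar>sin x\<bar> * \<bar>h n x\<bar> \<le> 1" using hb[of n x] by (intro mult_le_one) auto
      then show "norm (f x * (sin x * h n x)) \<le> \<bar>f x\<bar>"
        by (simp add: abs_mult mult_left_le)
    qed
  qed (use f in auto)
  moreover have "(LINT x|MI. f x * (sin x * h n x)) = 0" for n using cont[OF hc hb] .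
  ultimately have "(\<lambda>n::nat. 0) \<longlonglongrightarrow> (LINT x|MI. f x * (sin x * k x))" by simp
  then have "(LINT x|MI. f x * (sin x * k x)) = 0" by (simp add: LIMSEQ_const_iff)
  moreover have "f x * (sin x * k x) = \<bar>f x * sin x\<bar>" for x
    by (auto simp: k_def sgn_real_def abs_if)
  ultimately have "(LINT x|MI. \<bar>f x * sin x\<bar>) = 0" by simp
  moreover have "integrable MI (\<lambda>x. \<bar>f x * sin x\<bar>)" using int_b[of sin 1] by auto
  ultimately have "AE x in MI. \<bar>f x * sin x\<bar> = 0"
    by (subst (asm) integral_nonneg_eq_0_iff_AE) auto
  then show ?thesis using AE_MI_open
  proof eventually_elim
    case (elim x)
    then show ?case using sin_gt_zero[of x] by auto
  qed
qed

section \<open>Square-integrable functions: Cauchy-Schwarz, completeness, Riesz-Fischer and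
  Parseval\<close>

lemma Cauchy_Schwarz_integral:
  fixes f g :: "'a \<Rightarrow> real"
  assumes f: "integrable M (\<lambda>x. (f x)\<^sup>2)" and g: "integrable M (\<lambda>x. (g x)\<^sup>2)"
    and fg: "integrable M (\<lambda>x. f x * g x)"
  shows "(LINT x|M. f x * g x)\<^sup>2 \<le> (LINT x|M. (f x)\<^sup>2) * (LINT x|M. (g x)\<^sup>2)"
proof -
  define A B C where "A = (LINT x|M. (f x)\<^sup>2)" and "B = (LINT x|M. f x * g x)" and "C = (LINT x|M. (g x)\<^sup>2)"
  have *: "0 \<le> A - 2 * t * B + t\<^sup>2 * C" for t
  proof -
    have "0 \<le> (LINT x|M. (f x - t * g x)\<^sup>2)" by (rule Bochner_Integration.integral_nonneg) simp
    also have "(\<lambda>x. (f x - t * g x)\<^sup>2) = (\<lambda>x. (f x)\<^sup>2 - 2 * t * (f x * g x) + t\<^sup>2 * (g x)\<^sup>2)"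
      by (auto simp: power2_eq_square algebra_simps)
    also have "(LINT x|M. (f x)\<^sup>2 - 2 * t * (f x * g x) + t\<^sup>2 * (g x)\<^sup>2) = A - 2 * t * B + t\<^sup>2 * C"
      using f g fg by (simp add: A_def B_def C_def)
    finally show ?thesis .
  qed
  have C0: "0 \<le> C" unfolding C_def by (rule Bochner_Integration.integral_nonneg) simp
  have "B\<^sup>2 \<le> A * C"
  proof (cases "C = 0")
    case True
    have "B = 0"
    proof (rule ccontr)
      assume "B \<noteq> 0"
      \<comment> \<open>At this \<open>t\<close> the affine function A - 2 t B equals - 1.\<close>
      then show False using *[of "(A + 1) / (2 * B)"] True by simp
    qed
    then show ?thesis using True by simp
  next
    case False
    with C0 have "C > 0" by simp
    then show ?thesis using *[of "B / C"]
      by (simp add: power2_eq_square field_simps)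
  qed
  then show ?thesis by (simp add: A_def B_def C_def)
qed

definition sqint :: "(real \<Rightarrow> real) \<Rightarrow> bool" where
  "sqint f \<longleftrightarrow> f \<in> borel_measurable borel \<and> integrable MI (\<lambda>x. (f x)\<^sup>2)"

lemma sqintD: "sqint f \<Longrightarrow> f \<in> borel_measurable borel" "sqint f \<Longrightarrow> integrable MI (\<lambda>x. (f x)\<^sup>2)"
  by (auto simp: sqint_def)

lemma sqint_prod: 
  assumes "sqint f" "sqint g"
  shows "integrable MI (\<lambda>x. f x * g x)"
proof (rule Bochner_Integration.integrable_bound)
  show "integrable MI (\<lambda>x. (f x)\<^sup>2 + (g x)\<^sup>2)" using assms by (auto simp: sqint_def)
  show "(\<lambda>x. f x * g x) \<in> borel_measurable MI" using assms by (auto simp: sqint_def)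
  have "\<bar>f x * g x\<bar> \<le> (f x)\<^sup>2 + (g x)\<^sup>2" for x
  proof -
    have "0 \<le> (\<bar>f x\<bar> - \<bar>g x\<bar>)\<^sup>2" by simp
    then have "2 * (\<bar>f x\<bar> * \<bar>g x\<bar>) \<le> (f x)\<^sup>2 + (g x)\<^sup>2" by (simp add: power2_diff)
    moreover have "0 \<le> \<bar>f x\<bar> * \<bar>g x\<bar>" by simp
    ultimately show ?thesis unfolding abs_mult by linarith
  qed
  then show "AE x in MI. norm (f x * g x) \<le> norm ((f x)\<^sup>2 + (g x)\<^sup>2)" by auto
qed

lemma sqint_bounded:
  assumes "f \<in> borel_measurable borel" "\<And>x. \<bar>f x\<bar> \<le> B"
  shows "sqint f"
  unfolding sqint_def
proof (intro conjI assms MI.integrable_const_bound[where B="B\<^sup>2"])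
  show "AE x in MI. norm ((f x)\<^sup>2) \<le> B\<^sup>2"
    using assms(2) by (auto simp: abs_le_square_iff intro!: AE_I2 power_mono[of "\<bar>f _\<bar>" B 2, simplified])
qed (use assms in auto)

lemma sqint_sin: "sqint (\<lambda>x. sin (real n * x))"
  by (rule sqint_bounded[where B=1]) auto

lemma sqint_integrable: "sqint f \<Longrightarrow> integrable MI f"
  using sqint_prod[of f "\<lambda>_. 1"] sqint_bounded[of "\<lambda>_. 1" 1] by simp

lemma sqint_cmult: "sqint f \<Longrightarrow> sqint (\<lambda>x. c * f x)"
  by (auto simp: sqint_def power_mult_distrib)

lemma sqint_add: assumes "sqint f" "sqint g" shows "sqint (\<lambda>x. f x + g x)"
proof -
  have "(\<lambda>x. (f x + g x)\<^sup>2) = (\<lambda>x. (f x)\<^sup>2 + (g x)\<^sup>2 + 2 * (f x * g x))"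
    by (auto simp: power2_sum)
  then show ?thesis using assms sqint_prod[OF assms] by (auto simp: sqint_def)
qed

lemma sqint_diff: "sqint f \<Longrightarrow> sqint g \<Longrightarrow> sqint (\<lambda>x. f x - g x)"
  using sqint_add[of f "\<lambda>x. (-1) * g x"] sqint_cmult[of g "-1"] by simp

lemma sqint_abs: "sqint f \<Longrightarrow> sqint (\<lambda>x. \<bar>f x\<bar>)"
  by (auto simp: sqint_def)

lemma sqint_sum: "(\<And>i. i \<in> I \<Longrightarrow> sqint (f i)) \<Longrightarrow> sqint (\<lambda>x. \<Sum>i\<in>I. f i x)"
proof (induction I rule: infinite_finite_induct)
  case (insert a I)
  then show ?case by (simp add: sqint_add)
qed (auto simp: sqint_bounded[where B=0])

lemma CS_MI: "sqint f \<Longrightarrow> sqint g \<Longrightarrow>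
  (LINT x|MI. f x * g x)\<^sup>2 \<le> (LINT x|MI. (f x)\<^sup>2) * (LINT x|MI. (g x)\<^sup>2)"
  by (intro Cauchy_Schwarz_integral sqint_prod) (auto simp: sqint_def)

lemma CS_MI_sqrt: "sqint f \<Longrightarrow> sqint g \<Longrightarrow>
  \<bar>LINT x|MI. f x * g x\<bar> \<le> sqrt (LINT x|MI. (f x)\<^sup>2) * sqrt (LINT x|MI. (g x)\<^sup>2)"
  using CS_MI[of f g] by (metis real_sqrt_abs real_sqrt_le_mono real_sqrt_mult)

lemma L1_le_L2: "sqint f \<Longrightarrow> (LINT x|MI. \<bar>f x\<bar>) \<le> sqrt pi * sqrt (LINT x|MI. (f x)\<^sup>2)"
  using CS_MI_sqrt[of "\<lambda>_. 1" "\<lambda>x. \<bar>f x\<bar>"] sqint_bounded[of "\<lambda>_. 1" 1] sqint_abs[of f]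
  by simp

lemma scf_le_L2:
  assumes "sqint f"
  shows "\<bar>scf f n\<bar> \<le> 2 * sqrt (LINT x|MI. (f x)\<^sup>2)"
proof -
  have "\<bar>scf f n\<bar> \<le> 2 / pi * (sqrt pi * sqrt (LINT x|MI. (f x)\<^sup>2))"
    using scf_le[OF sqint_integrable[OF assms], of n] L1_le_L2[OF assms]
    by (smt (verit) divide_nonneg_nonneg mult_left_mono pi_ge_zero)
  also have "\<dots> \<le> 2 * sqrt (LINT x|MI. (f x)\<^sup>2)"
  proof -
    have "sqrt pi \<le> pi" using pi_ge_two real_sqrt_le_mono[of pi "pi\<^sup>2"]
      by (simp add: power2_eq_square)
    then have "2 / pi * sqrt pi \<le> 2" by (simp add: field_simps)
    then have "(2 / pi * sqrt pi) * sqrt (LINT x|MI. (f x)\<^sup>2) \<le> 2 * sqrt (LINT x|MI. (f x)\<^sup>2)"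
      by (intro mult_right_mono) auto
    then show ?thesis by (simp add: mult.assoc)
  qed
  finally show ?thesis .
qed

text \<open>The limit is defined pointwise everywhere, so that it inherits the symmetries
  of the sequence.\<close>

lemma L2_limit:
  fixes f :: "nat \<Rightarrow> real \<Rightarrow> real"
  assumes f: "\<And>n. sqint (f n)"
    and cauchy: "\<And>e. e > 0 \<Longrightarrow> \<exists>N. \<forall>i\<ge>N. \<forall>j\<ge>N. (LINT x|MI. (f i x - f j x)\<^sup>2) < e"
  obtains r g where "strict_mono r"
    "g = (\<lambda>x. if convergent (\<lambda>i. f (r i) x) then lim (\<lambda>i. f (r i) x) else 0)"
    "AE x in MI. (\<lambda>i. f (r i) x) \<longlonglongrightarrow> g x" "sqint g" "(\<lambda>n. LINT x|MI. (f n x - g x)\<^sup>2) \<longlonglongrightarrow> 0"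
proof -
  have fm [measurable]: "f n \<in> borel_measurable borel" for n using f[of n] by (auto simp: sqint_def)
  \<comment> \<open>On a finite measure space L^2 Cauchy implies L^1 Cauchy, and an L^1 Cauchy
    sequence has a subsequence that is Cauchy almost everywhere.\<close>
  have "\<exists>N. \<forall>i\<ge>N. \<forall>j\<ge>N. (LINT x|MI. norm (f i x - f j x)) < e" if "e > 0" for e
  proof -
    obtain N where N: "\<And>i j. i \<ge> N \<Longrightarrow> j \<ge> N \<Longrightarrow> (LINT x|MI. (f i x - f j x)\<^sup>2) < e\<^sup>2 / pi"
      using cauchy[of "e\<^sup>2 / pi"] \<open>e > 0\<close> by auto
    have "(LINT x|MI. norm (f i x - f j x)) < e" if "i \<ge> N" "j \<ge> N" for i j
    proof -
      have "(LINT x|MI. norm (f i x - f j x)) \<le> sqrt pi * sqrt (LINT x|MI. (f i x - f j x)\<^sup>2)"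
        using L1_le_L2[OF sqint_diff[OF f[of i] f[of j]]] by simp
      also have "\<dots> < sqrt pi * sqrt (e\<^sup>2 / pi)"
        using N[OF that] by (intro mult_strict_left_mono real_sqrt_less_mono) auto
      also have "\<dots> = e" using \<open>e > 0\<close> by (simp add: real_sqrt_mult[symmetric])
      finally show ?thesis .
    qed
    then show ?thesis by blast
  qed
  then obtain r where r: "strict_mono r" and aec: "AE x in MI. Cauchy (\<lambda>i. f (r i) x)"
    using cauchy_L1_AE_cauchy_subseq[of MI f] sqint_integrable[OF f] by metis
  define g where "g = (\<lambda>x. if convergent (\<lambda>i. f (r i) x) then lim (\<lambda>i. f (r i) x) else 0)"
  have [measurable]: "Measurable.pred borel (\<lambda>x. convergent (\<lambda>i. f (r i) x))"
  proof -
    have "(\<lambda>x. convergent (\<lambda>i. f (r i) x)) = (\<lambda>x. Cauchy (\<lambda>i. f (r i) x))"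
      by (simp add: Cauchy_convergent_iff)
    then show ?thesis by simp
  qed
  have gm [measurable]: "g \<in> borel_measurable borel" unfolding g_def by measurable
  have conv: "AE x in MI. (\<lambda>i. f (r i) x) \<longlonglongrightarrow> g x"
    using aec by eventually_elim (simp add: g_def Cauchy_convergent_iff convergent_LIMSEQ_iff)
  \<comment> \<open>Fatou along the subsequence bounds the distance from \<open>f n\<close> to the
    limit by the Cauchy bound. The nonnegative integral is used because square integrability of
    \<open>g\<close> is only deduced from this.\<close>
  have fat: "(\<integral>\<^sup>+x. ennreal ((f n x - g x)\<^sup>2) \<partial>MI) \<le> ennreal e"
    if "\<forall>i\<ge>N. \<forall>j\<ge>N. (LINT x|MI. (f i x - f j x)\<^sup>2) < e" "n \<ge> N" "e > 0" for n N e
  proof -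
    have "(\<integral>\<^sup>+x. ennreal ((f n x - g x)\<^sup>2) \<partial>MI) = (\<integral>\<^sup>+x. liminf (\<lambda>i. ennreal ((f n x - f (r i) x)\<^sup>2)) \<partial>MI)"
    proof (rule nn_integral_cong_AE, use conv in eventually_elim)
      fix x assume "(\<lambda>i. f (r i) x) \<longlonglongrightarrow> g x"
      then have "(\<lambda>i. ennreal ((f n x - f (r i) x)\<^sup>2)) \<longlonglongrightarrow> ennreal ((f n x - g x)\<^sup>2)"
        by (intro tendsto_intros)
      from lim_imp_Liminf[OF trivial_limit_sequentially this]
      show "ennreal ((f n x - g x)\<^sup>2) = liminf (\<lambda>i. ennreal ((f n x - f (r i) x)\<^sup>2))"
        by (rule sym)
    qed
    also have "\<dots> \<le> liminf (\<lambda>i. \<integral>\<^sup>+x. ennreal ((f n x - f (r i) x)\<^sup>2) \<partial>MI)"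
      by (rule nn_integral_liminf) auto
    also have "\<dots> \<le> limsup (\<lambda>i. \<integral>\<^sup>+x. ennreal ((f n x - f (r i) x)\<^sup>2) \<partial>MI)"
      by (rule Liminf_le_Limsup) simp
    also have "\<dots> \<le> ennreal e"
    proof (rule Limsup_bounded)
      show "eventually (\<lambda>i. (\<integral>\<^sup>+x. ennreal ((f n x - f (r i) x)\<^sup>2) \<partial>MI) \<le> ennreal e) sequentially"
        using eventually_ge_at_top[of N]
      proof eventually_elim
        case (elim i)
        then have "r i \<ge> N" using seq_suble[OF r, of i] by linarith
        then have "(LINT x|MI. (f n x - f (r i) x)\<^sup>2) < e" using that by auto
        then show ?case using sqint_diff[OF f[of n] f[of "r i"]]
          by (subst nn_integral_eq_integral) (auto simp: sqint_def intro!: ennreal_leI)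
      qed
    qed
    finally show ?thesis .
  qed
  have sqd: "sqint (\<lambda>x. f n x - g x)" if n: "\<forall>i\<ge>N. \<forall>j\<ge>N. (LINT x|MI. (f i x - f j x)\<^sup>2) < e" "n \<ge> N" "e > 0" for n N e
    unfolding sqint_def using fat[OF n]
    by (auto intro!: integrableI_bounded simp: order.strict_trans1)
  obtain N where N: "\<forall>i\<ge>N. \<forall>j\<ge>N. (LINT x|MI. (f i x - f j x)\<^sup>2) < 1"
    using cauchy[of 1] by auto
  have sg: "sqint g"
    using sqint_diff[OF f[of N] sqd[OF N order_refl zero_less_one]] by simp
  have "(\<lambda>n. LINT x|MI. (f n x - g x)\<^sup>2) \<longlonglongrightarrow> 0"
  proof (rule LIMSEQ_I)
    fix e :: real assume "e > 0"
    obtain N where N: "\<forall>i\<ge>N. \<forall>j\<ge>N. (LINT x|MI. (f i x - f j x)\<^sup>2) < e / 2"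
      using cauchy[of "e/2"] \<open>e > 0\<close> by auto
    have "norm ((LINT x|MI. (f n x - g x)\<^sup>2) - 0) < e" if "n \<ge> N" for n
    proof -
      have "ennreal (LINT x|MI. (f n x - g x)\<^sup>2) \<le> ennreal (e/2)"
        using fat[OF N that] \<open>e > 0\<close> sqint_diff[OF f[of n] sg]
        by (subst nn_integral_eq_integral[symmetric]) (auto simp: sqint_def)
      then have "(LINT x|MI. (f n x - g x)\<^sup>2) \<le> e / 2" using \<open>e > 0\<close> by (simp add: ennreal_le_iff)
      then show ?thesis using \<open>e > 0\<close> by simp
    qed
    then show "\<exists>N. \<forall>n\<ge>N. norm ((LINT x|MI. (f n x - g x)\<^sup>2) - 0) < e" by blast
  qed
  with r g_def conv sg show ?thesis using that by blast
qed

definition sine_sum :: "(nat \<Rightarrow> real) \<Rightarrow> nat \<Rightarrow> real \<Rightarrow> real" where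
  "sine_sum b N x = (\<Sum>n<N. b n * sin (real n * x))"

lemma sqint_sine_sum: "sqint (sine_sum b N)"
  using sqint_sum[of "{..<N}" "\<lambda>n x. b n * sin (real n * x)"] sqint_cmult[OF sqint_sin]
  by (simp add: sine_sum_def[abs_def])

lemma scf_sine_sum: "b 0 = 0 \<Longrightarrow> scf (sine_sum b N) n = (if n < N then b n else 0)"
proof -
  assume b: "b 0 = 0"
  have "scf (sine_sum b N) n = (\<Sum>m<N. b m * scf (\<lambda>x. sin (real m * x)) n)"
    unfolding sine_sum_def[abs_def]
    by (subst scf_sum) (auto intro!: sqint_integrable sqint_cmult sqint_sin)
  also have "\<dots> = (\<Sum>m<N. if m = n then b n else 0)"
    using b by (intro sum.cong) (auto simp: scf_sin)
  finally show ?thesis by simp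
qed

lemma integral_times_sine_sum:
  assumes "integrable MI f"
  shows "(LINT x|MI. f x * sine_sum b N x) = pi / 2 * (\<Sum>n<N. b n * scf f n)"
proof -
  have "(LINT x|MI. f x * sine_sum b N x) = (LINT x|MI. (\<Sum>n<N. b n * (f x * sin (real n * x))))"
    by (intro Bochner_Integration.integral_cong refl) (simp add: sine_sum_def sum_distrib_left mult_ac)
  also have "\<dots> = (\<Sum>n<N. b n * (LINT x|MI. f x * sin (real n * x)))"
    using integrable_MI_sin[OF assms] by (subst Bochner_Integration.integral_sum) auto
  also have "\<dots> = pi / 2 * (\<Sum>n<N. b n * scf f n)"
    by (simp add: scf_def sum_distrib_left mult_ac)
  finally show ?thesis .
qed

lemma integral_sine_sum_sq:
  assumes "b 0 = 0"
  shows "(LINT x|MI. (sine_sum b N x)\<^sup>2) = pi / 2 * (\<Sum>n<N. (b n)\<^sup>2)"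
  using integral_times_sine_sum[OF sqint_integrable[OF sqint_sine_sum[of b N]], of b N] assms
  by (simp add: power2_eq_square scf_sine_sum)

text \<open>The partial sums converge in L^2 to some \<open>g\<close> with the coefficients of
  \<open>f\<close>, and the sines are complete, so \<open>f = g\<close> almost everywhere. The
  integrability of \<open>f\<close> is thereby improved by summability of its squared coefficients,
  which is how cubes of solutions will be shown to be square integrable.\<close>

theorem Riesz_Fischer:
  assumes f: "integrable MI f" and s: "summable (\<lambda>n. (scf f n)\<^sup>2)"
  shows "sqint f" and "(\<lambda>N. LINT x|MI. (sine_sum (scf f) N x - f x)\<^sup>2) \<longlonglongrightarrow> 0"
proof -
  define S where "S = sine_sum (scf f)"
  have fm [measurable]: "f \<in> borel_measurable borel"
    using borel_measurable_integrable[OF f] by simp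
  have Sq: "sqint (S N)" for N unfolding S_def by (rule sqint_sine_sum)
  have diff: "(LINT x|MI. (S i x - S j x)\<^sup>2) = pi / 2 * (\<Sum>n\<in>{i..<j}. (scf f n)\<^sup>2)" if "i \<le> j" for i j
  proof -
    define b where "b n = (if i \<le> n then scf f n else 0)" for n
    have e: "{..<j} = {..<i} \<union> {i..<j}" using that by auto
    have "S j x = S i x + sine_sum b j x" for x
      unfolding S_def sine_sum_def e by (subst (1 2) sum.union_disjoint) (auto simp: b_def)
    then have "(LINT x|MI. (S i x - S j x)\<^sup>2) = (LINT x|MI. (sine_sum b j x)\<^sup>2)" by simp
    also have "\<dots> = pi / 2 * (\<Sum>n<j. (b n)\<^sup>2)" by (rule integral_sine_sum_sq) (simp add: b_def)
    also have "(\<Sum>n<j. (b n)\<^sup>2) = (\<Sum>n\<in>{i..<j}. (scf f n)\<^sup>2)"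
      unfolding e by (subst sum.union_disjoint) (auto simp: b_def)
    finally show ?thesis .
  qed
  have "\<exists>N. \<forall>i\<ge>N. \<forall>j\<ge>N. (LINT x|MI. (S i x - S j x)\<^sup>2) < e" if "e > 0" for e
  proof -
    obtain N where N: "\<And>m n. m \<ge> N \<Longrightarrow> norm (\<Sum>n\<in>{m..<n}. (scf f n)\<^sup>2) < e / (pi / 2)"
      using s unfolding summable_Cauchy using \<open>e > 0\<close> by (metis divide_pos_pos pi_half_gt_zero)
    have *: "(LINT x|MI. (S i x - S j x)\<^sup>2) < e" if "i \<ge> N" "i \<le> j" for i j
    proof -
      have "(\<Sum>n\<in>{i..<j}. (scf f n)\<^sup>2) < e / (pi / 2)" using N[OF that(1), of j] by auto
      then show ?thesis unfolding diff[OF that(2)] by (simp add: field_simps)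
    qed
    have "(LINT x|MI. (S i x - S j x)\<^sup>2) < e" if "i \<ge> N" "j \<ge> N" for i j
      using *[of i j] *[of j i] that by (cases "i \<le> j") (auto simp: power2_commute)
    then show ?thesis by blast
  qed
  note cauchy = this
  obtain g where g: "sqint g" and lim: "(\<lambda>n. LINT x|MI. (S n x - g x)\<^sup>2) \<longlonglongrightarrow> 0"
    by (rule L2_limit[of S, OF Sq]) (erule cauchy, rule that)
  have [measurable]: "g \<in> borel_measurable borel" using g by (simp add: sqint_def)
  have "scf g n = scf f n" for n
  proof -
    have "(\<lambda>N. scf (S N) n - scf g n) \<longlonglongrightarrow> 0"
    proof (rule tendsto_0_le[where K=2])
      show "(\<lambda>N. sqrt (LINT x|MI. (S N x - g x)\<^sup>2)) \<longlonglongrightarrow> 0"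
        using tendsto_real_sqrt[OF lim] by simp
      show "eventually (\<lambda>N. norm (scf (S N) n - scf g n) \<le> norm (sqrt (LINT x|MI. (S N x - g x)\<^sup>2)) * 2) sequentially"
        using scf_le_L2[OF sqint_diff[OF Sq g]] 
        by (simp add: scf_diff[OF sqint_integrable[OF Sq] sqint_integrable[OF g]] mult.commute)
    qed
    moreover have "eventually (\<lambda>N. scf (S N) n - scf g n = scf f n - scf g n) sequentially"
      using eventually_gt_at_top[of n] by eventually_elim (simp add: S_def scf_sine_sum)
    ultimately have "(\<lambda>N::nat. scf f n - scf g n) \<longlonglongrightarrow> 0"
      using tendsto_cong by fast
    then show ?thesis by (simp add: LIMSEQ_const_iff)
  qed
  then have "AE x in MI. f x - g x = 0"
    using f sqint_integrable[OF g] by (intro scf_zero_imp_AE_zero) (auto simp: scf_diff)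
  then have ae: "AE x in MI. f x = g x" by eventually_elim simp
  have "integrable MI (\<lambda>x. (f x)\<^sup>2) \<longleftrightarrow> integrable MI (\<lambda>x. (g x)\<^sup>2)"
    using ae by (intro integrable_cong_AE) auto
  then show "sqint f" using g by (simp add: sqint_def)
  have [measurable]: "S N \<in> borel_measurable borel" for N using Sq[of N] by (simp add: sqint_def)
  have "(LINT x|MI. (S n x - f x)\<^sup>2) = (LINT x|MI. (S n x - g x)\<^sup>2)" for n
    using ae by (intro integral_cong_AE) auto
  then show "(\<lambda>N. LINT x|MI. (sine_sum (scf f) N x - f x)\<^sup>2) \<longlonglongrightarrow> 0"
    using lim by (simp add: S_def)
qed

text \<open>The partial sum is an orthogonal projection. The second part is an identity: the L^2
  error is exactly the missing part of the norm, so convergence of the sine series will upgrade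
  Bessel to Parseval.\<close>

lemma Bessel:
  assumes f: "sqint f"
  shows "pi / 2 * (\<Sum>n<N. (scf f n)\<^sup>2) \<le> (LINT x|MI. (f x)\<^sup>2)"
    and "(LINT x|MI. (sine_sum (scf f) N x - f x)\<^sup>2) = (LINT x|MI. (f x)\<^sup>2) - pi / 2 * (\<Sum>n<N. (scf f n)\<^sup>2)"
proof -
  note S = sqint_sine_sum[of "scf f" N]
  have "(LINT x|MI. (sine_sum (scf f) N x - f x)\<^sup>2)
      = (LINT x|MI. (sine_sum (scf f) N x)\<^sup>2 + (f x)\<^sup>2 - 2 * (f x * sine_sum (scf f) N x))"
    by (intro Bochner_Integration.integral_cong refl) (simp add: power2_diff)
  also have "\<dots> = (LINT x|MI. (sine_sum (scf f) N x)\<^sup>2) + (LINT x|MI. (f x)\<^sup>2) - 2 * (LINT x|MI. f x * sine_sum (scf f) N x)"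
    using sqintD(2)[OF S] sqintD(2)[OF f] sqint_prod[OF f S] by simp
  also have "\<dots> = (LINT x|MI. (f x)\<^sup>2) - pi / 2 * (\<Sum>n<N. (scf f n)\<^sup>2)"
  proof -
    have "(LINT x|MI. f x * sine_sum (scf f) N x) = pi / 2 * (\<Sum>n<N. (scf f n)\<^sup>2)"
      by (simp add: integral_times_sine_sum[OF sqint_integrable[OF f]] power2_eq_square)
    then show ?thesis by (simp add: integral_sine_sum_sq)
  qed
  finally show *: "(LINT x|MI. (sine_sum (scf f) N x - f x)\<^sup>2) = (LINT x|MI. (f x)\<^sup>2) - pi / 2 * (\<Sum>n<N. (scf f n)\<^sup>2)" .
  have "0 \<le> (LINT x|MI. (sine_sum (scf f) N x - f x)\<^sup>2)" by (rule Bochner_Integration.integral_nonneg) simp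
  then show "pi / 2 * (\<Sum>n<N. (scf f n)\<^sup>2) \<le> (LINT x|MI. (f x)\<^sup>2)" using * by simp
qed

theorem Parseval:
  assumes f: "sqint f"
  shows "(\<lambda>n. (scf f n)\<^sup>2) sums (2 / pi * (LINT x|MI. (f x)\<^sup>2))"
proof -
  have s: "summable (\<lambda>n. (scf f n)\<^sup>2)"
  proof (rule summableI_nonneg_bounded)
    show "(\<Sum>i<n. (scf f i)\<^sup>2) \<le> 2 / pi * (LINT x|MI. (f x)\<^sup>2)" for n
      using Bessel(1)[OF f, of n] by (simp add: field_simps)
  qed simp
  have "(\<lambda>N. (LINT x|MI. (f x)\<^sup>2) - pi / 2 * (\<Sum>n<N. (scf f n)\<^sup>2)) \<longlonglongrightarrow> 0"
    using Riesz_Fischer(2)[OF sqint_integrable[OF f] s] by (simp add: Bessel(2)[OF f])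
  then have "(\<lambda>N. 2 / pi * ((LINT x|MI. (f x)\<^sup>2) - ((LINT x|MI. (f x)\<^sup>2) - pi / 2 * (\<Sum>n<N. (scf f n)\<^sup>2))))
     \<longlonglongrightarrow> 2 / pi * ((LINT x|MI. (f x)\<^sup>2) - 0)"
    by (intro tendsto_intros)
  then show ?thesis by (simp add: sums_def)
qed

text \<open>Polarization, with the squares of \<open>f + g\<close> and \<open>f - g\<close>.\<close>

lemma Parseval_bilinear:
  assumes f: "sqint f" and g: "sqint g"
  shows "(\<lambda>n. scf f n * scf g n) sums (2 / pi * (LINT x|MI. f x * g x))"
proof -
  note i = sqint_integrable[OF f] sqint_integrable[OF g]
  have "(\<lambda>n. ((scf (\<lambda>x. f x + g x) n)\<^sup>2 - (scf (\<lambda>x. f x - g x) n)\<^sup>2) / 4)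
     sums ((2 / pi * (LINT x|MI. (f x + g x)\<^sup>2) - 2 / pi * (LINT x|MI. (f x - g x)\<^sup>2)) / 4)"
    by (intro sums_divide sums_diff Parseval sqint_add sqint_diff f g)
  also have "(\<lambda>n. ((scf (\<lambda>x. f x + g x) n)\<^sup>2 - (scf (\<lambda>x. f x - g x) n)\<^sup>2) / 4) = (\<lambda>n. scf f n * scf g n)"
    by (rule ext) (simp add: scf_add[OF i] scf_diff[OF i] power2_eq_square algebra_simps)
  also have "(2 / pi * (LINT x|MI. (f x + g x)\<^sup>2) - 2 / pi * (LINT x|MI. (f x - g x)\<^sup>2)) / 4
      = 2 / pi * (LINT x|MI. ((f x + g x)\<^sup>2 - (f x - g x)\<^sup>2)) / 4"
    using sqintD(2)[OF sqint_add[OF f g]] sqintD(2)[OF sqint_diff[OF f g]]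
    by (subst Bochner_Integration.integral_diff) (auto simp: field_simps)
  also have "(\<lambda>x. (f x + g x)\<^sup>2 - (f x - g x)\<^sup>2) = (\<lambda>x. 4 * (f x * g x))"
    by (auto simp: power2_eq_square algebra_simps)
  finally show ?thesis by simp
qed

section \<open>Convexity of the fractional Dirichlet form\<close>

lemma borel_measurable_sinh [measurable]: "(sinh :: real \<Rightarrow> real) \<in> borel_measurable borel"
  by (intro borel_measurable_continuous_onI continuous_intros)

text \<open>Green's function of \<open>\<mu>\<^sup>2 - d\<^sup>2/dx\<^sup>2\<close> on \<open>(0, \<pi>)\<close> with Dirichlet boundary conditions.\<close>

definition green :: "real \<Rightarrow> real \<Rightarrow> real \<Rightarrow> real" where
  "green \<mu> x y = (if x \<in> {0..pi} \<and> y \<in> {0..pi}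
     then sinh (\<mu> * min x y) * sinh (\<mu> * (pi - max x y)) / (\<mu> * sinh (\<mu> * pi)) else 0)"

lemma measurable_green [measurable]:
  assumes [measurable]: "f \<in> borel_measurable M" "g \<in> borel_measurable M"
  shows "(\<lambda>z. green \<mu> (f z) (g z)) \<in> borel_measurable M"
  unfolding green_def by measurable

lemma green_nonneg:
  assumes "\<mu> > 0" shows "0 \<le> green \<mu> x y"
  using assms unfolding green_def by (auto intro!: divide_nonneg_nonneg mult_nonneg_nonneg)

lemma green_bound:
  assumes "\<mu> > 0" shows "\<bar>green \<mu> x y\<bar> \<le> sinh (\<mu> * pi) / \<mu>"
proof -
  have s: "sinh (\<mu> * pi) > 0" using assms by simp
  have "green \<mu> x y \<le> sinh (\<mu> * pi) * sinh (\<mu> * pi) / (\<mu> * sinh (\<mu> * pi))"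
  proof (cases "x \<in> {0..pi} \<and> y \<in> {0..pi}")
    case True
    have "sinh (\<mu> * min x y) * sinh (\<mu> * (pi - max x y)) \<le> sinh (\<mu> * pi) * sinh (\<mu> * pi)"
      using assms True by (intro mult_mono) (auto intro!: mult_nonneg_nonneg)
    then have "sinh (\<mu> * min x y) * sinh (\<mu> * (pi - max x y)) / (\<mu> * sinh (\<mu> * pi))
        \<le> sinh (\<mu> * pi) * sinh (\<mu> * pi) / (\<mu> * sinh (\<mu> * pi))"
      using assms s by (intro divide_right_mono) auto
    then show ?thesis using True by (simp add: green_def)
  qed (use assms in \<open>auto simp: green_def\<close>)
  also have "\<dots> = sinh (\<mu> * pi) / \<mu>" using s assms by (simp add: field_simps)
  finally show ?thesis using green_nonneg[OF assms] by simp
qed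

lemma sin_of_nat_times_pi [simp]: "sin (real n * pi) = 0"
  using sin_npi by (simp add: mult.commute)

text \<open>Sines vanish at 0 and pi and are eigenfunctions of mu^2 - d^2/dx^2, so the Green
  operator divides them by n^2 + mu^2. This is checked by explicit integration on both sides of the
  kink at \<open>x = y\<close>.\<close>

lemma integral_green_sin:
  assumes \<mu>: "\<mu> > 0" and y: "y \<in> {0..pi}" and n: "n \<noteq> 0"
  shows "(LINT x|MI. green \<mu> x y * sin (real n * x)) = sin (real n * y) / ((real n)\<^sup>2 + \<mu>\<^sup>2)"
proof -
  have s: "sinh (\<mu> * pi) > 0" using \<mu> by simp
  define d where "d = (real n)\<^sup>2 + \<mu>\<^sup>2"
  have d: "d > 0" unfolding d_def using \<mu> by (simp add: add_nonneg_pos)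
  \<comment> \<open>\<open>F\<close> and \<open>H\<close> are antiderivatives of sin(n x) times the
    hyperbolic factors of the kernel below and above \<open>y\<close>. They vanish at 0 and pi
    respectively, and their cosine terms at \<open>y\<close> cancel, leaving the addition theorem
    for sinh.\<close>
  define F where "F x = (\<mu> * cosh (\<mu> * x) * sin (real n * x) - real n * sinh (\<mu> * x) * cos (real n * x)) / d" for x
  define H where "H x = (- \<mu> * cosh (\<mu> * (pi - x)) * sin (real n * x) - real n * sinh (\<mu> * (pi - x)) * cos (real n * x)) / d" for x
  have F: "(F has_real_derivative (sinh (\<mu> * x) * sin (real n * x))) (at x)" for x
  proof -
    have "(F has_real_derivative ((real n)\<^sup>2 + \<mu>\<^sup>2) * (sinh (\<mu> * x) * sin (real n * x)) / d) (at x)"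
      unfolding F_def using d
      by (auto intro!: derivative_eq_intros simp: power2_eq_square field_simps)
    then show ?thesis using \<mu> by (simp add: d_def)
  qed
  have H: "(H has_real_derivative (sinh (\<mu> * (pi - x)) * sin (real n * x))) (at x)" for x
  proof -
    have "(H has_real_derivative ((real n)\<^sup>2 + \<mu>\<^sup>2) * (sinh (\<mu> * (pi - x)) * sin (real n * x)) / d) (at x)"
      unfolding H_def using d
      by (auto intro!: derivative_eq_intros simp: power2_eq_square field_simps)
    then show ?thesis using \<mu> by (simp add: d_def)
  qed
  define c where "c = inverse (\<mu> * sinh (\<mu> * pi))"
  have i1: "((\<lambda>x. green \<mu> x y * sin (real n * x)) has_integral c * sinh (\<mu> * (pi - y)) * (F y - F 0)) {0..y}"
  proof (rule has_integral_eq)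
    show "((\<lambda>x. (c * sinh (\<mu> * (pi - y))) * (sinh (\<mu> * x) * sin (real n * x))) has_integral c * sinh (\<mu> * (pi - y)) * (F y - F 0)) {0..y}"
      using y F by (intro has_integral_mult_right fundamental_theorem_of_calculus)
        (auto simp: has_real_derivative_iff_has_vector_derivative[symmetric] intro: has_field_derivative_at_within)
    show "(c * sinh (\<mu> * (pi - y))) * (sinh (\<mu> * x) * sin (real n * x)) = green \<mu> x y * sin (real n * x)" if "x \<in> {0..y}" for x
      using that y by (simp add: green_def c_def field_simps)
  qed
  have i2: "((\<lambda>x. green \<mu> x y * sin (real n * x)) has_integral c * sinh (\<mu> * y) * (H pi - H y)) {y..pi}"
  proof (rule has_integral_eq)
    show "((\<lambda>x. (c * sinh (\<mu> * y)) * (sinh (\<mu> * (pi - x)) * sin (real n * x))) has_integral c * sinh (\<mu> * y) * (H pi - H y)) {y..pi}"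
      using y H by (intro has_integral_mult_right fundamental_theorem_of_calculus)
        (auto simp: has_real_derivative_iff_has_vector_derivative[symmetric] intro: has_field_derivative_at_within)
    show "(c * sinh (\<mu> * y)) * (sinh (\<mu> * (pi - x)) * sin (real n * x)) = green \<mu> x y * sin (real n * x)" if "x \<in> {y..pi}" for x
      using that y by (simp add: green_def c_def field_simps)
  qed
  have hi: "((\<lambda>x. green \<mu> x y * sin (real n * x)) has_integral
      c * sinh (\<mu> * (pi - y)) * (F y - F 0) + c * sinh (\<mu> * y) * (H pi - H y)) {0..pi}"
    using y by (intro has_integral_combine[OF _ _ i1 i2]) auto
  have int: "integrable MI (\<lambda>x. green \<mu> x y * sin (real n * x))"
    by (rule integrable_MI_sin, rule MI.integrable_const_bound[where B="sinh (\<mu> * pi) / \<mu>"])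
       (use green_bound[OF \<mu>] in auto)
  have "(LINT x|MI. green \<mu> x y * sin (real n * x)) = integral {0..pi} (\<lambda>x. green \<mu> x y * sin (real n * x))"
    using int by (simp add: integral_MI integrable_MI set_borel_integral_eq_integral)
  also have "\<dots> = c * sinh (\<mu> * (pi - y)) * (F y - F 0) + c * sinh (\<mu> * y) * (H pi - H y)"
    using hi by (rule integral_unique)
  also have "\<dots> = c * \<mu> * sin (real n * y) * (sinh (\<mu> * (pi - y)) * cosh (\<mu> * y) + cosh (\<mu> * (pi - y)) * sinh (\<mu> * y)) / d"
    by (simp add: F_def H_def diff_divide_distrib add_divide_distrib algebra_simps)
  also have "sinh (\<mu> * (pi - y)) * cosh (\<mu> * y) + cosh (\<mu> * (pi - y)) * sinh (\<mu> * y) = sinh (\<mu> * pi)"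
    using sinh_add[of "\<mu> * (pi - y)" "\<mu> * y"] by (simp add: right_diff_distrib)
  finally show ?thesis using s \<mu> by (simp add: c_def d_def field_simps)
qed

interpretation MI2: pair_sigma_finite MI MI ..

lemma integrable_MI_pair:
  fixes h :: "real \<Rightarrow> real \<Rightarrow> real"
  assumes hm [measurable]: "(\<lambda>(x,y). h x y) \<in> borel_measurable (borel \<Otimes>\<^sub>M borel)"
    and hb: "\<And>x y. \<bar>h x y\<bar> \<le> B" and f: "integrable MI f" and g: "integrable MI g"
  shows "integrable (MI \<Otimes>\<^sub>M MI) (\<lambda>(x,y). h x y * (f x * g y))"
proof -
  have [measurable]: "f \<in> borel_measurable borel" "g \<in> borel_measurable borel"
    using borel_measurable_integrable[OF f] borel_measurable_integrable[OF g] by auto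
  have B: "0 \<le> B" using hb[of 0 0] by linarith
  have fg: "integrable (MI \<Otimes>\<^sub>M MI) (\<lambda>(x,y). f x * g y)"
    by (rule MI2.Fubini_integrable) (use f g in \<open>auto simp: abs_mult\<close>)
  show ?thesis
  proof (rule Bochner_Integration.integrable_bound)
    show "integrable (MI \<Otimes>\<^sub>M MI) (\<lambda>z. B * (case z of (x,y) \<Rightarrow> f x * g y))"
      using fg by (rule integrable_mult_right)
    show "(\<lambda>(x,y). h x y * (f x * g y)) \<in> borel_measurable (MI \<Otimes>\<^sub>M MI)" by measurable
    show "AE z in MI \<Otimes>\<^sub>M MI. norm (case z of (x,y) \<Rightarrow> h x y * (f x * g y)) \<le> norm (B * (case z of (x,y) \<Rightarrow> f x * g y))"
      using B by (intro AE_I2) (auto simp: abs_mult intro!: mult_right_mono hb)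
  qed
qed

definition green_form :: "real \<Rightarrow> (real \<Rightarrow> real) \<Rightarrow> real" where
  "green_form \<mu> f = (LINT (x,y)|(MI \<Otimes>\<^sub>M MI). green \<mu> x y * (f x * f y))"

lemma green_pair:
  assumes "\<mu> > 0" "integrable MI f" "integrable MI g"
  shows "integrable (MI \<Otimes>\<^sub>M MI) (\<lambda>(x,y). green \<mu> x y * (f x * g y))"
  by (rule integrable_MI_pair[where B="sinh (\<mu> * pi) / \<mu>"]) (use assms green_bound in auto)

text \<open>Fubini moves the sine under the kernel, so the Green potential \<open>g\<close> of
  \<open>f\<close> has the coefficients of \<open>f\<close> divided by n^2 + mu^2; Parseval for the
  pair \<open>g\<close>, \<open>f\<close> then diagonalizes the form.\<close>

lemma green_form_sums:
  assumes f: "sqint f" and \<mu>: "\<mu> > 0"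
  shows "(\<lambda>n. (scf f n)\<^sup>2 / ((real n)\<^sup>2 + \<mu>\<^sup>2)) sums (2 / pi * green_form \<mu> f)"
proof -
  have [measurable]: "f \<in> borel_measurable borel" using f by (rule sqintD)
  note fi = sqint_integrable[OF f]
  define g where "g x = (LINT y|MI. green \<mu> x y * f y)" for x
  have gm [measurable]: "g \<in> borel_measurable borel"
    unfolding g_def by measurable
  define B where "B = sinh (\<mu> * pi) / \<mu>"
  have gb: "\<bar>g x\<bar> \<le> B * (LINT y|MI. \<bar>f y\<bar>)" for x
  proof -
    have i: "integrable MI (\<lambda>y. green \<mu> x y * f y)"
      using integrable_MI_times_bounded[OF fi, of "green \<mu> x" B] green_bound[OF \<mu>]
      by (simp add: mult.commute B_def)
    have "\<bar>g x\<bar> \<le> (LINT y|MI. \<bar>green \<mu> x y * f y\<bar>)" unfolding g_def by (rule integral_abs_bound)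
    also have "\<dots> \<le> (LINT y|MI. B * \<bar>f y\<bar>)"
    proof (rule integral_mono)
      show "\<bar>green \<mu> x y * f y\<bar> \<le> B * \<bar>f y\<bar>" for y
        using green_bound[OF \<mu>, of x y] unfolding abs_mult B_def by (rule mult_right_mono) simp
    qed (use fi integrable_abs[OF i] in auto)
    finally show ?thesis by simp
  qed
  have gs: "sqint g" by (rule sqint_bounded[OF gm gb])
  have sg: "scf g n = scf f n / ((real n)\<^sup>2 + \<mu>\<^sup>2)" for n
  proof (cases "n = 0")
    case False
    have "(LINT x|MI. g x * sin (real n * x)) = (LINT x|MI. (LINT y|MI. green \<mu> x y * (sin (real n * x) * f y)))"
      unfolding g_def by (intro Bochner_Integration.integral_cong refl)
        (simp add: mult_ac flip: integral_mult_right_zero)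
    also have "\<dots> = (LINT y|MI. (LINT x|MI. green \<mu> x y * (sin (real n * x) * f y)))"
      by (rule MI2.Fubini_integral[symmetric]) (rule green_pair[OF \<mu> sqint_integrable[OF sqint_sin] fi])
    also have "\<dots> = (LINT y|MI. f y * (LINT x|MI. green \<mu> x y * sin (real n * x)))"
      by (intro Bochner_Integration.integral_cong refl)
        (simp add: mult_ac flip: integral_mult_right_zero)
    also have "\<dots> = (LINT y|MI. f y * sin (real n * y) / ((real n)\<^sup>2 + \<mu>\<^sup>2))"
    proof (rule integral_cong_AE)
      show "AE y in MI. f y * (LINT x|MI. green \<mu> x y * sin (real n * x)) = f y * sin (real n * y) / ((real n)\<^sup>2 + \<mu>\<^sup>2)"
        using AE_MI_open by eventually_elim (simp add: integral_green_sin \<mu> False)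
    qed measurable
    also have "\<dots> = (LINT y|MI. f y * sin (real n * y)) / ((real n)\<^sup>2 + \<mu>\<^sup>2)" by simp
    finally show ?thesis by (simp add: scf_def)
  qed simp
  have "(LINT x|MI. g x * f x) = (LINT x|MI. (LINT y|MI. green \<mu> x y * (f x * f y)))"
    unfolding g_def by (intro Bochner_Integration.integral_cong refl)
      (simp add: mult_ac flip: integral_mult_right_zero)
  also have "\<dots> = green_form \<mu> f"
    unfolding green_form_def
    using MI2.integral_fst'[OF green_pair[OF \<mu> fi fi]] by simp
  finally have "(LINT x|MI. g x * f x) = green_form \<mu> f" .
  with Parseval_bilinear[OF gs f] show ?thesis
    by (simp add: sg power2_eq_square)
qed

text \<open>The midpoint of \<open>f\<close> and \<open>g\<close> in the variable of the convexity:
  its square is the arithmetic mean of the squares. Convexity is used at midpoints only.\<close>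

definition rms :: "(real \<Rightarrow> real) \<Rightarrow> (real \<Rightarrow> real) \<Rightarrow> real \<Rightarrow> real" where
  "rms f g x = sqrt (((f x)\<^sup>2 + (g x)\<^sup>2) / 2)"

lemma rms_nonneg: "0 \<le> rms f g x"
  by (simp add: rms_def)

lemma rms_sq: "(rms f g x)\<^sup>2 = ((f x)\<^sup>2 + (g x)\<^sup>2) / 2"
  by (simp add: rms_def)

lemma sqint_rms: "sqint f \<Longrightarrow> sqint g \<Longrightarrow> sqint (rms f g)"
  by (auto simp: sqint_def rms_sq rms_def[abs_def])

text \<open>Cauchy-Schwarz in the plane for the vectors (f x, g x) and (f y, g y).\<close>

lemma rms_mult: "(f x * f y + g x * g y) / 2 \<le> rms f g x * rms f g y"
proof -
  have "(f x * f y + g x * g y)\<^sup>2 \<le> ((f x)\<^sup>2 + (g x)\<^sup>2) * ((f y)\<^sup>2 + (g y)\<^sup>2)"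
  proof -
    have "((f x)\<^sup>2 + (g x)\<^sup>2) * ((f y)\<^sup>2 + (g y)\<^sup>2) - (f x * f y + g x * g y)\<^sup>2 = (f x * g y - g x * f y)\<^sup>2"
      by (simp add: power2_eq_square algebra_simps)
    then show ?thesis by (metis diff_ge_0_iff_ge zero_le_power2)
  qed
  then have "((f x * f y + g x * g y) / 2)\<^sup>2 \<le> (rms f g x * rms f g y)\<^sup>2"
    by (simp add: power_mult_distrib rms_sq power_divide)
  then show ?thesis by (meson power2_le_imp_le mult_nonneg_nonneg rms_nonneg)
qed

text \<open>Here positivity of the Green function enters: it allows the pointwise inequality
  \<open>rms_mult\<close> to be integrated. The Green form is thus midpoint concave in the
  square.\<close>

lemma green_form_rms:
  assumes f: "sqint f" and g: "sqint g" and \<mu>: "\<mu> > 0"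
  shows "(green_form \<mu> f + green_form \<mu> g) / 2 \<le> green_form \<mu> (rms f g)"
proof -
  note i = green_pair[OF \<mu> sqint_integrable[OF f] sqint_integrable[OF f]]
    green_pair[OF \<mu> sqint_integrable[OF g] sqint_integrable[OF g]]
    green_pair[OF \<mu> sqint_integrable[OF sqint_rms[OF f g]] sqint_integrable[OF sqint_rms[OF f g]]]
  have "(green_form \<mu> f + green_form \<mu> g) / 2 =
      (LINT z|(MI \<Otimes>\<^sub>M MI). ((case z of (x,y) \<Rightarrow> green \<mu> x y * (f x * f y)) + (case z of (x,y) \<Rightarrow> green \<mu> x y * (g x * g y))) / 2)"
    unfolding green_form_def using i by (subst integral_divide_zero, subst Bochner_Integration.integral_add) auto
  also have "\<dots> \<le> green_form \<mu> (rms f g)"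
    unfolding green_form_def
  proof (rule integral_mono)
    show "integrable (MI \<Otimes>\<^sub>M MI) (\<lambda>z. ((case z of (x,y) \<Rightarrow> green \<mu> x y * (f x * f y)) + (case z of (x,y) \<Rightarrow> green \<mu> x y * (g x * g y))) / 2)"
      using i by (intro integrable_divide_zero Bochner_Integration.integrable_add) auto
    show "((case z of (x,y) \<Rightarrow> green \<mu> x y * (f x * f y)) + (case z of (x,y) \<Rightarrow> green \<mu> x y * (g x * g y))) / 2
      \<le> (case z of (x,y) \<Rightarrow> green \<mu> x y * (rms f g x * rms f g y))" for z
    proof -
      obtain x y where z: "z = (x,y)" by (cases z)
      show ?thesis unfolding z
        using mult_left_mono[OF rms_mult[of f x y g] green_nonneg[OF \<mu>, of x y]]
        by (simp add: algebra_simps)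
    qed
  qed (use i in auto)
  finally show ?thesis .
qed

text \<open>n^2 / (n^2 + L) = 1 - L / (n^2 + L). The constant part is the squared L^2 norm, affine
  in the square of \<open>f\<close>, and the minus sign turns concavity of the Green form into
  convexity.\<close>

lemma resolvent_form_sums:
  assumes f: "sqint f" and l: "L > 0"
  shows "(\<lambda>n. (real n)\<^sup>2 / ((real n)\<^sup>2 + L) * (scf f n)\<^sup>2) sums
    (2 / pi * ((LINT x|MI. (f x)\<^sup>2) - L * green_form (sqrt L) f))"
proof -
  have "(\<lambda>n. (scf f n)\<^sup>2 - L * ((scf f n)\<^sup>2 / ((real n)\<^sup>2 + (sqrt L)\<^sup>2))) sums
     (2 / pi * (LINT x|MI. (f x)\<^sup>2) - L * (2 / pi * green_form (sqrt L) f))"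
    using l by (intro sums_diff sums_mult Parseval f green_form_sums) auto
  also have "(\<lambda>n. (scf f n)\<^sup>2 - L * ((scf f n)\<^sup>2 / ((real n)\<^sup>2 + (sqrt L)\<^sup>2)))
      = (\<lambda>n. (real n)\<^sup>2 / ((real n)\<^sup>2 + L) * (scf f n)\<^sup>2)"
  proof
    fix n
    have "(real n)\<^sup>2 + L > 0" using l by (simp add: add_nonneg_pos)
    then show "(scf f n)\<^sup>2 - L * ((scf f n)\<^sup>2 / ((real n)\<^sup>2 + (sqrt L)\<^sup>2)) = (real n)\<^sup>2 / ((real n)\<^sup>2 + L) * (scf f n)\<^sup>2"
      using l by (simp add: field_simps)
  qed
  finally show ?thesis by (simp add: algebra_simps)
qed

text \<open>Partial sums stand on the left because the series of the quadratic mean with weight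
  n^(2s), to which this bound is to be transferred, is not yet known to converge.\<close>

lemma resolvent_form_rms:
  assumes f: "sqint f" and g: "sqint g" and l: "L > 0"
  shows "(\<Sum>n<N. (real n)\<^sup>2 / ((real n)\<^sup>2 + L) * (scf (rms f g) n)\<^sup>2)
    \<le> (\<Sum>n. (real n)\<^sup>2 / ((real n)\<^sup>2 + L) * (((scf f n)\<^sup>2 + (scf g n)\<^sup>2) / 2))"
proof -
  let ?q = "sqrt L"
  note m = resolvent_form_sums[OF sqint_rms[OF f g] l]
  have "(\<Sum>n<N. (real n)\<^sup>2 / ((real n)\<^sup>2 + L) * (scf (rms f g) n)\<^sup>2)
    \<le> (\<Sum>n. (real n)\<^sup>2 / ((real n)\<^sup>2 + L) * (scf (rms f g) n)\<^sup>2)"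
    using l by (intro sum_le_suminf sums_summable[OF m]) auto
  also have "\<dots> = 2 / pi * ((LINT x|MI. (rms f g x)\<^sup>2) - L * green_form ?q (rms f g))"
    using m by (simp add: sums_iff)
  also have "(LINT x|MI. (rms f g x)\<^sup>2) = ((LINT x|MI. (f x)\<^sup>2) + (LINT x|MI. (g x)\<^sup>2)) / 2"
    using sqintD(2)[OF f] sqintD(2)[OF g] by (simp add: rms_sq)
  also have "2 / pi * (((LINT x|MI. (f x)\<^sup>2) + (LINT x|MI. (g x)\<^sup>2)) / 2 - L * green_form ?q (rms f g))
     \<le> 2 / pi * (((LINT x|MI. (f x)\<^sup>2) + (LINT x|MI. (g x)\<^sup>2)) / 2 - L * ((green_form ?q f + green_form ?q g) / 2))"
    using green_form_rms[OF f g, of ?q] l by (intro mult_left_mono diff_left_mono) auto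
  also have "\<dots> = (2 / pi * ((LINT x|MI. (f x)\<^sup>2) - L * green_form ?q f)
      + 2 / pi * ((LINT x|MI. (g x)\<^sup>2) - L * green_form ?q g)) / 2"
    by (simp add: field_simps)
  also have "\<dots> = (\<Sum>n. (real n)\<^sup>2 / ((real n)\<^sup>2 + L) * (((scf f n)\<^sup>2 + (scf g n)\<^sup>2) / 2))"
  proof -
    have A: "(\<lambda>n. ((real n)\<^sup>2 / ((real n)\<^sup>2 + L) * (scf f n)\<^sup>2 + (real n)\<^sup>2 / ((real n)\<^sup>2 + L) * (scf g n)\<^sup>2) / 2)
      sums ((2 / pi * ((LINT x|MI. (f x)\<^sup>2) - L * green_form ?q f)
      + 2 / pi * ((LINT x|MI. (g x)\<^sup>2) - L * green_form ?q g)) / 2)"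
      by (intro sums_divide sums_add resolvent_form_sums f g l)
    have e: "(\<lambda>n. ((real n)\<^sup>2 / ((real n)\<^sup>2 + L) * (scf f n)\<^sup>2 + (real n)\<^sup>2 / ((real n)\<^sup>2 + L) * (scf g n)\<^sup>2) / 2)
      = (\<lambda>n. (real n)\<^sup>2 / ((real n)\<^sup>2 + L) * (((scf f n)\<^sup>2 + (scf g n)\<^sup>2) / 2))"
    proof -
      have "(c * a + c * b) / 2 = c * ((a + b) / 2)" for a b c :: real by (simp add: field_simps)
      then show ?thesis by (simp only:)
    qed
    show ?thesis using A unfolding e by (rule sums_unique)
  qed
  finally show ?thesis .
qed

section \<open>Fractional powers as averages of the resolvent symbols\<close>

lemma powr_div_one_plus_nn_integral:
  assumes s: "0 < s" "s < (1::real)"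
  defines "C \<equiv> (\<integral>\<^sup>+t. ennreal (t powr (s - 1) / (1 + t)) * indicator {0<..} t \<partial>lborel)"
  shows "C \<noteq> 0" "C \<noteq> top"
proof -
  \<comment> \<open>The integrand is at most t^(s-1) on (0, 1] and at most t^(s-2) beyond, both
    integrable for 0 < s < 1. The value would be pi / sin(pi s); what counts is that it lies
    strictly between 0 and infinity.\<close>
  have "(\<integral>\<^sup>+t. ennreal (t powr (s - 1)) * indicator {0..1} t \<partial>lborel) = ennreal (1 powr (s - 1 + 1) / (s - 1 + 1))"
    using s by (intro nn_integral_has_integral_lebesgue' has_integral_powr_from_0) auto
  moreover have "(\<integral>\<^sup>+t. ennreal (t powr (s - 2)) * indicator {1..} t \<partial>lborel) = ennreal (-(1 powr (s - 2 + 1)) / (s - 2 + 1))"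
    using s by (intro nn_integral_has_integral_lebesgue' has_integral_powr_to_inf) auto
  moreover have "C \<le> (\<integral>\<^sup>+t. ennreal (t powr (s - 1)) * indicator {0..1} t + ennreal (t powr (s - 2)) * indicator {1..} t \<partial>lborel)"
    unfolding C_def
  proof (rule nn_integral_mono)
    fix t :: real
    show "ennreal (t powr (s - 1) / (1 + t)) * indicator {0<..} t
      \<le> ennreal (t powr (s - 1)) * indicator {0..1} t + ennreal (t powr (s - 2)) * indicator {1..} t"
    proof (cases "0 < t \<and> t \<le> 1")
      case True
      then have "t powr (s - 1) / (1 + t) \<le> t powr (s - 1)" by (simp add: divide_le_eq mult_le_cancel_left1)
      then have "ennreal (t powr (s - 1) / (1 + t)) \<le> ennreal (t powr (s - 1))" by (rule ennreal_leI)
      then show ?thesis using True by (simp add: indicator_def add_increasing2)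
    next
      case False
      show ?thesis
      proof (cases "t > 0")
        case t: True
        with False have "t > 1" by simp
        have "t powr (s - 1) / (1 + t) \<le> t powr (s - 1) / t" using \<open>t > 1\<close> by (intro divide_left_mono) auto
        also have "\<dots> = t powr (s - 2)"
          using t powr_diff[of t "s - 1" 1] by simp
        finally have "ennreal (t powr (s - 1) / (1 + t)) \<le> ennreal (t powr (s - 2))" by (rule ennreal_leI)
        then show ?thesis using \<open>t > 1\<close> by (simp add: indicator_def)
      qed simp
    qed
  qed
  moreover have "\<dots> = (\<integral>\<^sup>+t. ennreal (t powr (s - 1)) * indicator {0..1} t \<partial>lborel)
      + (\<integral>\<^sup>+t. ennreal (t powr (s - 2)) * indicator {1..} t \<partial>lborel)"
    by (rule nn_integral_add) auto
  ultimately have "C \<le> ennreal (1 powr (s - 1 + 1) / (s - 1 + 1)) + ennreal (-(1 powr (s - 2 + 1)) / (s - 2 + 1))"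
    by (simp only:)
  then show "C \<noteq> top" by (rule neq_top_trans[rotated]) simp
  show "C \<noteq> 0"
  proof
    assume "C = 0"
    then have "AE t in lborel. ennreal (t powr (s - 1) / (1 + t)) * indicator {0<..} t = 0"
      unfolding C_def by (subst (asm) nn_integral_0_iff_AE) auto
    then have "AE t in lborel. t \<notin> {0<..(1::real)}"
      by eventually_elim (auto simp: indicator_def split: if_splits)
    then have "{0<..(1::real)} \<in> null_sets lborel" by (subst (asm) AE_iff_null_sets[symmetric]) auto
    then show False by (simp add: null_sets_def)
  qed
qed

text \<open>Substituting n^2 t for t pulls out n^(2s) and leaves an integral free of
  \<open>n\<close>: up to that constant, n^(2s) is the integral of n^2 / (n^2 + t) against
  t^(s-1).\<close>

lemma powr_resolvent_nn_integral:
  assumes s: "0 < s" "s < (1::real)" and n: "n > (0::nat)"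
  shows "(\<integral>\<^sup>+t. ennreal ((real n)\<^sup>2 / ((real n)\<^sup>2 + t) * t powr (s - 1)) * indicator {0<..} t \<partial>lborel)
    = ennreal (real n powr (2 * s)) * (\<integral>\<^sup>+t. ennreal (t powr (s - 1) / (1 + t)) * indicator {0<..} t \<partial>lborel)"
proof -
  define c where "c = (real n)\<^sup>2"
  have c: "c > 0" using n by (simp add: c_def)
  have cp: "c powr s = real n powr (2 * s)"
    using n powr_powr[of "real n" 2 s] by (simp add: c_def powr_numeral)
  have "(\<integral>\<^sup>+t. ennreal (c / (c + t) * t powr (s - 1)) * indicator {0<..} t \<partial>lborel)
    = ennreal \<bar>c\<bar> * (\<integral>\<^sup>+t. ennreal (c / (c + (0 + c * t)) * (0 + c * t) powr (s - 1)) * indicator {0<..} (0 + c * t) \<partial>lborel)"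
    using c by (intro nn_integral_real_affine) auto
  also have "\<dots> = (\<integral>\<^sup>+t. ennreal \<bar>c\<bar> * (ennreal (c / (c + (0 + c * t)) * (0 + c * t) powr (s - 1)) * indicator {0<..} (0 + c * t)) \<partial>lborel)"
    by (rule nn_integral_cmult[symmetric]) measurable
  also have "\<dots> = (\<integral>\<^sup>+t. ennreal (c powr s) * (ennreal (t powr (s - 1) / (1 + t)) * indicator {0<..} t) \<partial>lborel)"
  proof (rule nn_integral_cong)
    fix t :: real
    show "ennreal \<bar>c\<bar> * (ennreal (c / (c + (0 + c * t)) * (0 + c * t) powr (s - 1)) * indicator {0<..} (0 + c * t))
      = ennreal (c powr s) * (ennreal (t powr (s - 1) / (1 + t)) * indicator {0<..} t)"
    proof (cases "t > 0")
      case True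
      have "c * (c / (c + c * t) * (c * t) powr (s - 1)) = c powr s * (t powr (s - 1) / (1 + t))"
      proof -
        have "c / (c + c * t) = 1 / (1 + t)"
        proof -
          have "c + c * t = c * (1 + t)" by (simp add: algebra_simps)
          then show ?thesis using c by simp
        qed
        moreover have "(c * t) powr (s - 1) = c powr (s - 1) * t powr (s - 1)"
          using c True by (simp add: powr_mult)
        moreover have "c * c powr (s - 1) = c powr s"
          using c by (simp add: powr_mult_base)
        ultimately show ?thesis by (simp add: field_simps)
      qed
      then show ?thesis using True c by (simp add: indicator_def ennreal_mult'[symmetric])
    next
      case False
      then have "\<not> (0 < c * t)" using c by (simp add: zero_less_mult_iff)
      then show ?thesis using False by (simp add: indicator_def)
    qed
  qed
  also have "\<dots> = ennreal (c powr s) * (\<integral>\<^sup>+t. ennreal (t powr (s - 1) / (1 + t)) * indicator {0<..} t \<partial>lborel)"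
    by (rule nn_integral_cmult) measurable
  finally show ?thesis unfolding cp unfolding c_def .
qed

text \<open>For \<open>s < 1\<close> this integrates the hypothesis against \<open>t powr (s - 1)\<close>, for \<open>s = 1\<close>
  it multiplies it by \<open>t\<close> and lets \<open>t\<close> tend to infinity.\<close>

lemma powr_sum_le_of_resolvent:
  fixes p q :: "nat \<Rightarrow> real"
  assumes s: "0 < s" "s \<le> 1" and p: "\<And>n. 0 \<le> p n" and q: "\<And>n. 0 \<le> q n" and sq: "summable q"
    and sqs: "summable (\<lambda>n. real n powr (2 * s) * q n)"
    and le: "\<And>t N. t > 0 \<Longrightarrow> (\<Sum>n<N. (real n)\<^sup>2 / ((real n)\<^sup>2 + t) * p n) \<le> (\<Sum>n. (real n)\<^sup>2 / ((real n)\<^sup>2 + t) * q n)"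
  shows "(\<Sum>n<N. real n powr (2 * s) * p n) \<le> (\<Sum>n. real n powr (2 * s) * q n)"
proof -
  have sqt: "summable (\<lambda>n. (real n)\<^sup>2 / ((real n)\<^sup>2 + t) * q n)" if "t > 0" for t
  proof (rule summable_comparison_test'[OF sq])
    fix n
    have "(real n)\<^sup>2 + t > 0" using that by (simp add: add_nonneg_pos)
    then have "(real n)\<^sup>2 / ((real n)\<^sup>2 + t) \<le> 1" using that by simp
    from mult_right_mono[OF this q[of n]]
    show "norm ((real n)\<^sup>2 / ((real n)\<^sup>2 + t) * q n) \<le> q n"
      using q[of n] that by simp
  qed
  show ?thesis
  proof (cases "s = 1")
    case True
    have pw: "real n powr (2 * s) = (real n)\<^sup>2" for n
      using True by (cases "n = 0") (auto simp: powr_numeral)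
    have "(\<Sum>n<N. t * ((real n)\<^sup>2 / ((real n)\<^sup>2 + t)) * p n) \<le> (\<Sum>n. (real n)\<^sup>2 * q n)" if "t > 0" for t
    proof -
      have "(\<Sum>n<N. t * ((real n)\<^sup>2 / ((real n)\<^sup>2 + t)) * p n) = t * (\<Sum>n<N. (real n)\<^sup>2 / ((real n)\<^sup>2 + t) * p n)"
        by (simp add: sum_distrib_left mult.assoc)
      also have "\<dots> \<le> t * (\<Sum>n. (real n)\<^sup>2 / ((real n)\<^sup>2 + t) * q n)"
        using le[OF that] that by (intro mult_left_mono) auto
      also have "\<dots> = (\<Sum>n. t * ((real n)\<^sup>2 / ((real n)\<^sup>2 + t) * q n))"
        by (rule suminf_mult[symmetric, OF sqt[OF that]])
      also have "\<dots> \<le> (\<Sum>n. (real n)\<^sup>2 * q n)"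
      proof (rule suminf_le)
        fix n
        have "(real n)\<^sup>2 + t > 0" using that by (simp add: add_nonneg_pos)
        then have "t / ((real n)\<^sup>2 + t) \<le> 1" by simp
        then have "t / ((real n)\<^sup>2 + t) * ((real n)\<^sup>2 * q n) \<le> 1 * ((real n)\<^sup>2 * q n)"
          using q[of n] by (intro mult_right_mono) auto
        then show "t * ((real n)\<^sup>2 / ((real n)\<^sup>2 + t) * q n) \<le> (real n)\<^sup>2 * q n" by (simp add: mult_ac)
      qed (use sqs pw summable_mult[OF sqt[OF that]] in auto)
      finally show ?thesis .
    qed
    note bound = this
    have ev: "eventually (\<lambda>t. (\<Sum>n<N. t * ((real n)\<^sup>2 / ((real n)\<^sup>2 + t)) * p n) \<le> (\<Sum>n. (real n)\<^sup>2 * q n)) at_top"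
      by (rule eventually_mono[OF eventually_gt_at_top[of 0]]) (rule bound)
    have "((\<lambda>t. \<Sum>n<N. t * ((real n)\<^sup>2 / ((real n)\<^sup>2 + t)) * p n) \<longlongrightarrow> (\<Sum>n<N. (real n)\<^sup>2 * p n)) at_top"
    proof (intro tendsto_sum tendsto_mult_right)
      fix n
      show "((\<lambda>t. t * ((real n)\<^sup>2 / ((real n)\<^sup>2 + t))) \<longlongrightarrow> (real n)\<^sup>2) at_top"
        by real_asymp
    qed
    then show ?thesis
      unfolding pw by (rule tendsto_upperbound[OF _ ev]) simp
  next
    case False
    with s have s1: "s < 1" by simp
    define C where "C = (\<integral>\<^sup>+t. ennreal (t powr (s - 1) / (1 + t)) * indicator {0<..} t \<partial>lborel)"
    note C = powr_div_one_plus_nn_integral[OF s(1) s1, folded C_def]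
    define K where "K n t = ennreal ((real n)\<^sup>2 / ((real n)\<^sup>2 + t) * t powr (s - 1)) * indicator {0<..} t" for n t
    have [measurable]: "K n \<in> borel_measurable borel" for n unfolding K_def by measurable
    have K: "(\<integral>\<^sup>+t. K n t \<partial>lborel) = ennreal (real n powr (2 * s)) * C" for n
    proof (cases "n = 0")
      case False
      then show ?thesis using powr_resolvent_nn_integral[OF s(1) s1, of n] by (simp add: K_def C_def)
    qed (simp add: K_def)
    have Kc: "(\<integral>\<^sup>+t. K n t * ennreal a \<partial>lborel) = ennreal (real n powr (2 * s) * a) * C" if "a \<ge> 0" for n a
      using that by (subst nn_integral_multc) (auto simp: K ennreal_mult mult_ac)
    \<comment> \<open>In the extended nonnegative reals sums and integrals are exchanged freely, and
      the common factor \<open>C\<close>, nonzero and finite, is cancelled at the end.\<close>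
    have "ennreal (\<Sum>n<N. real n powr (2 * s) * p n) * C = (\<Sum>n<N. ennreal (real n powr (2 * s) * p n) * C)"
      by (simp add: sum_distrib_right[symmetric] p)
    also have "\<dots> = (\<integral>\<^sup>+t. (\<Sum>n<N. K n t * ennreal (p n)) \<partial>lborel)"
      using p by (subst nn_integral_sum) (auto simp: Kc)
    also have "\<dots> \<le> (\<integral>\<^sup>+t. (\<Sum>n. K n t * ennreal (q n)) \<partial>lborel)"
    proof (rule nn_integral_mono)
      fix t :: real
      show "(\<Sum>n<N. K n t * ennreal (p n)) \<le> (\<Sum>n. K n t * ennreal (q n))"
      proof (cases "t > 0")
        case True
        have e: "K n t * ennreal a = ennreal (t powr (s - 1) * ((real n)\<^sup>2 / ((real n)\<^sup>2 + t) * a))" if "a \<ge> 0" for n a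
          using that True by (simp add: K_def ennreal_mult'[symmetric] mult_ac)
        have "(\<Sum>n<N. K n t * ennreal (p n)) = ennreal (t powr (s - 1) * (\<Sum>n<N. (real n)\<^sup>2 / ((real n)\<^sup>2 + t) * p n))"
          using p True by (simp add: e sum_distrib_left sum_ennreal)
        also have "\<dots> \<le> ennreal (t powr (s - 1) * (\<Sum>n. (real n)\<^sup>2 / ((real n)\<^sup>2 + t) * q n))"
          using le[OF True, of N] by (intro ennreal_leI mult_left_mono) auto
        also have "\<dots> = ennreal (\<Sum>n. t powr (s - 1) * ((real n)\<^sup>2 / ((real n)\<^sup>2 + t) * q n))"
          using suminf_mult[OF sqt[OF True]] by simp
        also have "\<dots> = (\<Sum>n. ennreal (t powr (s - 1) * ((real n)\<^sup>2 / ((real n)\<^sup>2 + t) * q n)))"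
          using q True by (intro suminf_ennreal2[symmetric] summable_mult sqt) auto
        also have "\<dots> = (\<Sum>n. K n t * ennreal (q n))" using q by (simp add: e)
        finally show ?thesis .
      qed (simp add: K_def)
    qed
    also have "\<dots> = (\<Sum>n. ennreal (real n powr (2 * s) * q n) * C)"
      using q by (subst nn_integral_suminf) (auto simp: Kc)
    also have "\<dots> = ennreal (\<Sum>n. real n powr (2 * s) * q n) * C"
      using q by (simp add: suminf_ennreal2[OF _ sqs])
    finally have "ennreal (\<Sum>n<N. real n powr (2 * s) * p n) \<le> ennreal (\<Sum>n. real n powr (2 * s) * q n)"
      using C by (simp add: mult.commute[of _ C] ennreal_mult_le_mult_iff)
    then show ?thesis
      by (subst (asm) ennreal_le_iff) (use q in \<open>auto intro!: suminf_nonneg sqs\<close>)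
  qed
qed

text \<open>\<open>form s f g\<close> is the integral of \<open>f * (-\<Delta>)\<^sup>s g\<close> over \<open>[0, \<pi>]\<close>.\<close>

definition fin_form :: "real \<Rightarrow> (real \<Rightarrow> real) \<Rightarrow> bool" where
  "fin_form s f \<longleftrightarrow> summable (\<lambda>n. real n powr (2 * s) * (scf f n)\<^sup>2)"

definition form :: "real \<Rightarrow> (real \<Rightarrow> real) \<Rightarrow> (real \<Rightarrow> real) \<Rightarrow> real" where
  "form s f g = pi / 2 * (\<Sum>n. real n powr (2 * s) * (scf f n * scf g n))"

text \<open>Transfer of the resolvent inequality, with \<open>p\<close> the squared coefficients of
  the quadratic mean and \<open>q\<close> the mean of the squared coefficients. Since it bounds
  every partial sum, it also shows that the quadratic mean has a finite form.\<close>

theorem form_rms: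
  assumes s: "0 < s" "s \<le> 1" and f: "sqint f" "fin_form s f" and g: "sqint g" "fin_form s g"
  shows "fin_form s (rms f g)" "form s (rms f g) (rms f g) \<le> (form s f f + form s g g) / 2"
proof -
  define q where "q n = ((scf f n)\<^sup>2 + (scf g n)\<^sup>2) / 2" for n
  have q: "q n \<ge> 0" for n by (simp add: q_def)
  have sq: "summable q" unfolding q_def
    by (intro summable_divide summable_add sums_summable[OF Parseval] f g)
  have qs: "(\<lambda>n. real n powr (2 * s) * q n) = (\<lambda>n. (real n powr (2 * s) * (scf f n)\<^sup>2 + real n powr (2 * s) * (scf g n)\<^sup>2) / 2)"
    by (simp add: q_def algebra_simps)
  have sqs: "summable (\<lambda>n. real n powr (2 * s) * q n)"
    unfolding qs using f g by (intro summable_divide summable_add) (auto simp: fin_form_def)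
  have le: "(\<Sum>n<N. real n powr (2 * s) * (scf (rms f g) n)\<^sup>2) \<le> (\<Sum>n. real n powr (2 * s) * q n)" for N
    by (rule powr_sum_le_of_resolvent[OF s _ q sq sqs]) (use resolvent_form_rms[OF f(1) g(1)] in \<open>auto simp: q_def\<close>)
  show ff: "fin_form s (rms f g)" unfolding fin_form_def
    by (rule summableI_nonneg_bounded) (use le in auto)
  have "(\<Sum>n. real n powr (2 * s) * (scf (rms f g) n)\<^sup>2) \<le> (\<Sum>n. real n powr (2 * s) * q n)"
    using le by (intro suminf_le_const) (use ff in \<open>auto simp: fin_form_def\<close>)
  also have "\<dots> = ((\<Sum>n. real n powr (2 * s) * (scf f n)\<^sup>2) + (\<Sum>n. real n powr (2 * s) * (scf g n)\<^sup>2)) / 2"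
    unfolding qs using f g by (subst suminf_divide) (auto simp: fin_form_def suminf_add intro: summable_add)
  finally have "pi / 2 * (\<Sum>n. real n powr (2 * s) * (scf (rms f g) n)\<^sup>2)
      \<le> pi / 2 * (((\<Sum>n. real n powr (2 * s) * (scf f n)\<^sup>2) + (\<Sum>n. real n powr (2 * s) * (scf g n)\<^sup>2)) / 2)"
    by (intro mult_left_mono) auto
  then show "form s (rms f g) (rms f g) \<le> (form s f f + form s g g) / 2"
    by (simp add: form_def power2_eq_square algebra_simps add_divide_distrib)
qed

section \<open>Global minimizers\<close>

definition L4 :: "(real \<Rightarrow> real) \<Rightarrow> bool" where
  "L4 f \<longleftrightarrow> f \<in> borel_measurable borel \<and> integrable MI (\<lambda>x. f x ^ 4)"

lemma L4_measurable: "L4 f \<Longrightarrow> f \<in> borel_measurable borel"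
  by (simp add: L4_def)

lemma L4_sq: "L4 f \<Longrightarrow> sqint (\<lambda>x. (f x)\<^sup>2)"
  by (auto simp: L4_def sqint_def simp flip: power_mult)

lemma sqint_bound:
  assumes [measurable]: "f \<in> borel_measurable borel" and g: "integrable MI g" and "\<And>x. (f x)\<^sup>2 \<le> g x"
  shows "sqint f"
proof -
  have "integrable MI (\<lambda>x. (f x)\<^sup>2)"
    by (rule Bochner_Integration.integrable_bound[OF g])
       (use assms(3) in \<open>auto intro!: AE_I2 order_trans[OF _ abs_ge_self]\<close>)
  then show ?thesis by (simp add: sqint_def)
qed

lemma L4_mult: assumes "L4 f" "L4 g" shows "sqint (\<lambda>x. f x * g x)"
proof (rule sqint_bound)
  show "integrable MI (\<lambda>x. f x ^ 4 + g x ^ 4)" using assms by (auto simp: L4_def)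
  show "(f x * g x)\<^sup>2 \<le> f x ^ 4 + g x ^ 4" for x
  proof -
    have "0 \<le> ((f x)\<^sup>2 - (g x)\<^sup>2)\<^sup>2" by simp
    then have "2 * (f x * g x)\<^sup>2 \<le> f x ^ 4 + g x ^ 4"
      by (simp add: power2_diff power_mult_distrib flip: power_mult)
    then show ?thesis by (smt (verit) zero_le_power2)
  qed
qed (use assms in \<open>auto simp: L4_def\<close>)

lemma L4_sqint: assumes "L4 f" shows "sqint f"
proof (rule sqint_bound)
  show "integrable MI (\<lambda>x. 1 + f x ^ 4)" using assms by (auto simp: L4_def)
  show "(f x)\<^sup>2 \<le> 1 + f x ^ 4" for x
  proof -
    have "0 \<le> ((f x)\<^sup>2 - 1)\<^sup>2" by simp
    then have "2 * (f x)\<^sup>2 \<le> 1 + f x ^ 4" by (simp add: power2_diff flip: power_mult)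
    then show ?thesis by (smt (verit) zero_le_power2)
  qed
qed (use assms in \<open>auto simp: L4_def\<close>)

lemma L4_sqintI:
  assumes [measurable]: "f \<in> borel_measurable borel" and "sqint (\<lambda>x. (f x)\<^sup>2)"
  shows "L4 f"
  using assms(2) by (simp add: L4_def sqint_def flip: power_mult)

lemma L4_cmult: "L4 f \<Longrightarrow> L4 (\<lambda>x. c * f x)"
  by (auto simp: L4_def power_mult_distrib)

lemma L4_add: assumes "L4 f" "L4 g" shows "L4 (\<lambda>x. f x + g x)"
proof (rule L4_sqintI)
  have "sqint (\<lambda>x. ((f x)\<^sup>2 + (g x)\<^sup>2) + 2 * (f x * g x))"
    by (intro sqint_add sqint_cmult L4_sq L4_mult assms)
  then show "sqint (\<lambda>x. (f x + g x)\<^sup>2)" by (simp add: power2_sum mult.assoc)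
qed (use assms in \<open>auto simp: L4_def\<close>)

lemma L4_bounded: "f \<in> borel_measurable borel \<Longrightarrow> (\<And>x. \<bar>f x\<bar> \<le> B) \<Longrightarrow> L4 f"
  using power_mono[of "\<bar>f _\<bar>" B 2]
  by (intro L4_sqintI sqint_bounded[where B="B\<^sup>2"]) auto

lemma sqint_const [simp]: "sqint (\<lambda>x. c)"
  by (rule sqint_bounded[where B="\<bar>c\<bar>"]) auto

text \<open>H^s intersected with L^4. The fourth power is demanded separately, since a finite form
  controls it only for \<open>s\<close> at least 1/4.\<close>

definition energy_space :: "real \<Rightarrow> (real \<Rightarrow> real) \<Rightarrow> bool" where
  "energy_space s f \<longleftrightarrow> L4 f \<and> fin_form s f"

lemma energy_spaceD: "energy_space s f \<Longrightarrow> L4 f" "energy_space s f \<Longrightarrow> sqint f" "energy_space s f \<Longrightarrow> integrable MI f"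
    "energy_space s f \<Longrightarrow> fin_form s f" "energy_space s f \<Longrightarrow> f \<in> borel_measurable borel"
  by (auto simp: energy_space_def L4_sqint sqint_integrable L4_measurable)

lemma form_summable:
  assumes "fin_form s f" "fin_form s g"
  shows "summable (\<lambda>n. real n powr (2 * s) * (scf f n * scf g n))"
proof (rule summable_comparison_test')
  show "summable (\<lambda>n. real n powr (2 * s) * (scf f n)\<^sup>2 + real n powr (2 * s) * (scf g n)\<^sup>2)"
    using assms by (auto simp: fin_form_def intro: summable_add)
  fix n
  have "\<bar>scf f n * scf g n\<bar> \<le> (scf f n)\<^sup>2 + (scf g n)\<^sup>2"
  proof -
    have "0 \<le> (\<bar>scf f n\<bar> - \<bar>scf g n\<bar>)\<^sup>2" by simp
    then have "2 * (\<bar>scf f n\<bar> * \<bar>scf g n\<bar>) \<le> (scf f n)\<^sup>2 + (scf g n)\<^sup>2" by (simp add: power2_diff)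
    moreover have "0 \<le> \<bar>scf f n\<bar> * \<bar>scf g n\<bar>" by simp
    ultimately show ?thesis unfolding abs_mult by linarith
  qed
  then have "real n powr (2 * s) * \<bar>scf f n * scf g n\<bar> \<le> real n powr (2 * s) * ((scf f n)\<^sup>2 + (scf g n)\<^sup>2)"
    by (rule mult_left_mono) simp
  then show "norm (real n powr (2 * s) * (scf f n * scf g n))
    \<le> real n powr (2 * s) * (scf f n)\<^sup>2 + real n powr (2 * s) * (scf g n)\<^sup>2"
    by (simp add: abs_mult distrib_left)
qed

lemma form_commute: "form s f g = form s g f"
  by (simp add: form_def mult.commute)

lemma form_nonneg: "fin_form s f \<Longrightarrow> 0 \<le> form s f f"
  using suminf_nonneg[OF form_summable[of s f f]] by (simp add: form_def)

lemma fin_form_cmult: "fin_form s f \<Longrightarrow> fin_form s (\<lambda>x. c * f x)"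
proof -
  assume "fin_form s f"
  then have "summable (\<lambda>n. c\<^sup>2 * (real n powr (2 * s) * (scf f n)\<^sup>2))"
    unfolding fin_form_def by (rule summable_mult)
  then show ?thesis by (simp add: fin_form_def power_mult_distrib mult_ac)
qed

lemma energy_space_cmult: "energy_space s f \<Longrightarrow> energy_space s (\<lambda>x. c * f x)"
  by (auto simp: energy_space_def L4_cmult fin_form_cmult)

lemma energy_space_add: assumes f: "energy_space s f" and g: "energy_space s g" shows "energy_space s (\<lambda>x. f x + g x)"
proof -
  have "(\<lambda>n. real n powr (2 * s) * (scf (\<lambda>x. f x + g x) n)\<^sup>2) =
     (\<lambda>n. (real n powr (2 * s) * (scf f n)\<^sup>2 + real n powr (2 * s) * (scf g n)\<^sup>2) + 2 * (real n powr (2 * s) * (scf f n * scf g n)))"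
    by (rule ext) (simp add: scf_add energy_spaceD(3)[OF f] energy_spaceD(3)[OF g] power2_sum algebra_simps)
  moreover have "summable \<dots>"
    using energy_spaceD(4)[OF f] energy_spaceD(4)[OF g]
    by (intro summable_add summable_mult form_summable) (auto simp: fin_form_def)
  ultimately show ?thesis using f g by (auto simp: energy_space_def L4_add fin_form_def)
qed

lemma energy_space_diff: "energy_space s f \<Longrightarrow> energy_space s g \<Longrightarrow> energy_space s (\<lambda>x. f x - g x)"
  using energy_space_add[of s f "\<lambda>x. (-1) * g x"] energy_space_cmult[of s g "-1"] by simp

lemma form_add_left:
  assumes f: "energy_space s f" and g: "energy_space s g" and h: "energy_space s h"
  shows "form s (\<lambda>x. f x + g x) h = form s f h + form s g h"
proof -
  have "(\<Sum>n. real n powr (2 * s) * (scf (\<lambda>x. f x + g x) n * scf h n))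
     = (\<Sum>n. real n powr (2 * s) * (scf f n * scf h n) + real n powr (2 * s) * (scf g n * scf h n))"
    by (simp add: scf_add energy_spaceD(3)[OF f] energy_spaceD(3)[OF g] algebra_simps)
  also have "\<dots> = (\<Sum>n. real n powr (2 * s) * (scf f n * scf h n)) + (\<Sum>n. real n powr (2 * s) * (scf g n * scf h n))"
    by (intro suminf_add[symmetric] form_summable energy_spaceD[OF f] energy_spaceD[OF g] energy_spaceD[OF h])
  finally show ?thesis by (simp add: form_def distrib_left)
qed

lemma form_cmult_left:
  assumes f: "energy_space s f" and h: "energy_space s h"
  shows "form s (\<lambda>x. c * f x) h = c * form s f h"
  unfolding form_def using suminf_mult[OF form_summable[OF energy_spaceD(4)[OF f] energy_spaceD(4)[OF h]], of c]
  by (simp add: mult_ac)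

lemma form_diff_left:
  assumes f: "energy_space s f" and g: "energy_space s g" and h: "energy_space s h"
  shows "form s (\<lambda>x. f x - g x) h = form s f h - form s g h"
  using form_add_left[OF f energy_space_cmult[OF g, of "-1"] h] form_cmult_left[OF g h, of "-1"] by simp

text \<open>Spectral gap on functions without modes below \<open>m\<close>: the Poincare inequality
  for m = 1, and for m = 2 the gap above the kernel of the linearization at the bifurcation
  point.\<close>

lemma form_ge:
  assumes f: "energy_space s f" and s: "0 \<le> s" and m: "m > 0" "\<And>n. n < m \<Longrightarrow> scf f n = 0"
  shows "real m powr (2 * s) * (LINT x|MI. (f x)\<^sup>2) \<le> form s f f"
proof -
  have "real m powr (2 * s) * (2 / pi * (LINT x|MI. (f x)\<^sup>2)) = (\<Sum>n. real m powr (2 * s) * (scf f n)\<^sup>2)"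
    using suminf_mult[OF sums_summable[OF Parseval[OF energy_spaceD(2)[OF f]]]] sums_unique[OF Parseval[OF energy_spaceD(2)[OF f]]]
    by metis
  also have "\<dots> \<le> (\<Sum>n. real n powr (2 * s) * (scf f n)\<^sup>2)"
  proof (rule suminf_le)
    show "real m powr (2 * s) * (scf f n)\<^sup>2 \<le> real n powr (2 * s) * (scf f n)\<^sup>2" for n
    proof (cases "n < m")
      case False
      then show ?thesis using s m by (intro mult_right_mono powr_mono2) auto
    qed (use m in simp)
  qed (use energy_spaceD(4)[OF f] summable_mult[OF sums_summable[OF Parseval[OF energy_spaceD(2)[OF f]]]] in \<open>auto simp: fin_form_def\<close>)
  finally show ?thesis by (simp add: form_def power2_eq_square field_simps)
qed

definition oddper :: "(real \<Rightarrow> real) \<Rightarrow> bool" where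
  "oddper f \<longleftrightarrow> periodic_2pi f \<and> (\<forall>x. f (- x) = - f x)"

lemma oddper_add: "oddper f \<Longrightarrow> oddper g \<Longrightarrow> oddper (\<lambda>x. f x + g x)"
  and oddper_diff: "oddper f \<Longrightarrow> oddper g \<Longrightarrow> oddper (\<lambda>x. f x - g x)"
  and oddper_cmult: "oddper f \<Longrightarrow> oddper (\<lambda>x. c * f x)"
  by (auto simp: oddper_def periodic_2pi_def)

lemma oddper_sin: "oddper (\<lambda>x. sin (real n * x))"
proof -
  have "sin (real n * (x + 2 * pi)) = sin (real n * x)" for x
  proof -
    have "\<exists>k::int. real n * (x + 2 * pi) = real n * x + 2 * pi * k"
      by (rule exI[of _ "int n"]) (simp add: algebra_simps)
    then show ?thesis using sin_cos_eq_iff by blast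
  qed
  then show ?thesis by (auto simp: oddper_def periodic_2pi_def)
qed

lemma energy_space_sin: "energy_space s (\<lambda>x. sin (real n * x))"
proof -
  have "summable (\<lambda>m. real m powr (2 * s) * (scf (\<lambda>x. sin (real n * x)) m)\<^sup>2)"
    by (rule summable_finite[of "{n}"]) (auto simp: scf_sin)
  moreover have "L4 (\<lambda>x. sin (real n * x))"
    by (rule L4_bounded[where B=1]) auto
  ultimately show ?thesis by (simp add: energy_space_def fin_form_def)
qed

lemma form_sin:
  shows "form s f (\<lambda>x. sin (real n * x)) = pi / 2 * (real n powr (2 * s) * scf f n)"
proof -
  have "(\<Sum>m. real m powr (2 * s) * (scf f m * scf (\<lambda>x. sin (real n * x)) m))
     = (\<Sum>m\<in>{n}. real m powr (2 * s) * (scf f m * scf (\<lambda>x. sin (real n * x)) m))"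
    by (rule suminf_finite) (auto simp: scf_sin)
  also have "\<dots> = real n powr (2 * s) * scf f n"
    by (simp add: scf_sin)
  finally show ?thesis by (simp add: form_def)
qed

text \<open>Completing the square in the potential adds the constant pi \<omega>^2 / 4 to the usual
  energy; it makes the energy nonnegative and its strict convexity in \<open>f^2\<close>
  visible.\<close>

definition energy :: "real \<Rightarrow> real \<Rightarrow> (real \<Rightarrow> real) \<Rightarrow> real" where
  "energy s \<omega> f = form s f f / 2 + 1 / 4 * (LINT x|MI. ((f x)\<^sup>2 - \<omega>)\<^sup>2)"

lemma sqint_sq_minus: "L4 f \<Longrightarrow> sqint (\<lambda>x. (f x)\<^sup>2 - \<omega>)"
  by (intro sqint_diff L4_sq sqint_const)

lemma energy_nonneg: "energy_space s f \<Longrightarrow> 0 \<le> energy s \<omega> f"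
  unfolding energy_def using form_nonneg[OF energy_spaceD(4)]
  by (intro add_nonneg_nonneg divide_nonneg_nonneg mult_nonneg_nonneg Bochner_Integration.integral_nonneg) auto

lemma L4_rms: assumes "L4 f" "L4 g" shows "L4 (rms f g)"
proof (rule L4_sqintI)
  have "sqint (\<lambda>x. (1/2) * ((f x)\<^sup>2 + (g x)\<^sup>2))" by (intro sqint_cmult sqint_add L4_sq assms)
  then show "sqint (\<lambda>x. (rms f g x)\<^sup>2)" by (simp add: rms_sq)
  show "rms f g \<in> borel_measurable borel" using assms by (auto simp: L4_def rms_def[abs_def])
qed

lemma energy_space_rms: "0 < s \<Longrightarrow> s \<le> 1 \<Longrightarrow> energy_space s f \<Longrightarrow> energy_space s g \<Longrightarrow> energy_space s (rms f g)"
  using form_rms(1)[of s f g] by (auto simp: energy_space_def L4_rms L4_sqint)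

text \<open>Hidden convexity: the energy is strictly convex in the square of its argument.\<close>

lemma energy_rms:
  assumes s: "0 < s" "s \<le> 1" and f: "energy_space s f" and g: "energy_space s g"
  shows "energy s \<omega> (rms f g) \<le> (energy s \<omega> f + energy s \<omega> g) / 2 - 1 / 16 * (LINT x|MI. ((f x)\<^sup>2 - (g x)\<^sup>2)\<^sup>2)"
proof -
  have i: "integrable MI (\<lambda>x. ((f x)\<^sup>2 - \<omega>)\<^sup>2)" "integrable MI (\<lambda>x. ((g x)\<^sup>2 - \<omega>)\<^sup>2)"
    "integrable MI (\<lambda>x. ((f x)\<^sup>2 - (g x)\<^sup>2)\<^sup>2)"
    using sqint_sq_minus[OF energy_spaceD(1)[OF f]] sqint_sq_minus[OF energy_spaceD(1)[OF g]]
      sqint_diff[OF L4_sq[OF energy_spaceD(1)[OF f]] L4_sq[OF energy_spaceD(1)[OF g]]] by (auto simp: sqint_def)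
  \<comment> \<open>The parallelogram identity for \<open>f^2 - \<omega>\<close> and
    \<open>g^2 - \<omega>\<close>; its defect term is the gain in the conclusion.\<close>
  have "(LINT x|MI. ((rms f g x)\<^sup>2 - \<omega>)\<^sup>2)
     = (LINT x|MI. (((f x)\<^sup>2 - \<omega>)\<^sup>2 + ((g x)\<^sup>2 - \<omega>)\<^sup>2) / 2 - ((f x)\<^sup>2 - (g x)\<^sup>2)\<^sup>2 / 4)"
    by (intro Bochner_Integration.integral_cong refl)
      (simp only: rms_sq, simp add: power2_eq_square field_simps)
  also have "\<dots> = ((LINT x|MI. ((f x)\<^sup>2 - \<omega>)\<^sup>2) + (LINT x|MI. ((g x)\<^sup>2 - \<omega>)\<^sup>2)) / 2
     - (LINT x|MI. ((f x)\<^sup>2 - (g x)\<^sup>2)\<^sup>2) / 4"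
    using i by simp
  finally show ?thesis
    using form_rms(2)[OF s energy_spaceD(2)[OF f] energy_spaceD(4)[OF f] energy_spaceD(2)[OF g] energy_spaceD(4)[OF g]]
    by (simp add: energy_def field_simps)
qed

lemma scf_cong_MI:
  assumes "AE x in MI. f x = g x" "f \<in> borel_measurable borel" "g \<in> borel_measurable borel"
  shows "scf f = scf g"
  using scf_cong_AE[OF assms] by (rule ext)

lemma energy_space_cong:
  assumes "AE x in MI. f x = g x" "f \<in> borel_measurable borel" "g \<in> borel_measurable borel"
  shows "energy_space s f \<longleftrightarrow> energy_space s g"
proof -
  have "integrable MI (\<lambda>x. f x ^ 4) \<longleftrightarrow> integrable MI (\<lambda>x. g x ^ 4)"
    using assms by (intro integrable_cong_AE) auto
  then show ?thesis using assms by (simp add: energy_space_def L4_def fin_form_def scf_cong_MI[OF assms])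
qed

lemma energy_cong:
  assumes "AE x in MI. f x = g x" "f \<in> borel_measurable borel" "g \<in> borel_measurable borel"
  shows "energy s \<omega> f = energy s \<omega> g"
proof -
  have "(LINT x|MI. ((f x)\<^sup>2 - \<omega>)\<^sup>2) = (LINT x|MI. ((g x)\<^sup>2 - \<omega>)\<^sup>2)"
    using assms by (intro integral_cong_AE) auto
  then show ?thesis by (simp add: energy_def form_def scf_cong_MI[OF assms])
qed

section \<open>Functions of one sign on the half period\<close>

definition half_pos :: "(real \<Rightarrow> real) \<Rightarrow> bool" where
  "half_pos f \<longleftrightarrow> oddper f \<and> (\<forall>x. 0 \<le> f x * sin x)"

text \<open>The quadratic mean of odd functions is even; the factor sgn (sin x) reflects its values
  on (0, pi) oddly. With \<open>g = f\<close> it is |f| on (0, pi), so the same operation also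
  replaces a function by one positive on (0, pi).\<close>

definition odd_rms :: "(real \<Rightarrow> real) \<Rightarrow> (real \<Rightarrow> real) \<Rightarrow> real \<Rightarrow> real" where
  "odd_rms f g x = sgn (sin x) * rms f g x"

lemma half_pos_odd_rms:
  assumes "oddper f" "oddper g"
  shows "half_pos (odd_rms f g)"
proof -
  have "0 \<le> sgn (sin x) * sin x" for x :: real by (simp add: sgn_real_def)
  then have "0 \<le> odd_rms f g x * sin x" for x
    using mult_nonneg_nonneg[OF _ rms_nonneg[of f g x], of "sgn (sin x) * sin x"]
    by (simp add: odd_rms_def mult_ac)
  then show ?thesis
    using assms by (auto simp: half_pos_def oddper_def periodic_2pi_def odd_rms_def rms_def sgn_minus)
qed

lemma odd_rms_AE: "AE x in MI. rms f g x = odd_rms f g x"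
  using AE_MI_open by eventually_elim (simp add: odd_rms_def sin_gt_zero)

lemma odd_rms_measurable:
  "f \<in> borel_measurable borel \<Longrightarrow> g \<in> borel_measurable borel \<Longrightarrow> odd_rms f g \<in> borel_measurable borel"
  "f \<in> borel_measurable borel \<Longrightarrow> g \<in> borel_measurable borel \<Longrightarrow> rms f g \<in> borel_measurable borel"
  unfolding odd_rms_def[abs_def] rms_def[abs_def] by auto

lemma Fatou_MI:
  fixes f :: "nat \<Rightarrow> real \<Rightarrow> real"
  assumes f [measurable]: "\<And>i. f i \<in> borel_measurable borel" and g [measurable]: "g \<in> borel_measurable borel"
    and fn: "\<And>i x. 0 \<le> f i x" and gn: "\<And>x. 0 \<le> g x" and i: "\<And>i. integrable MI (f i)"
    and lim: "AE x in MI. (\<lambda>i. f i x) \<longlonglongrightarrow> g x" and le: "\<And>i. (LINT x|MI. f i x) \<le> c i" and c: "c \<longlonglongrightarrow> L"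
  shows "integrable MI g" "(LINT x|MI. g x) \<le> L"
proof -
  have "(\<integral>\<^sup>+x. ennreal (g x) \<partial>MI) = (\<integral>\<^sup>+x. liminf (\<lambda>i. ennreal (f i x)) \<partial>MI)"
  proof (rule nn_integral_cong_AE, use lim in eventually_elim)
    fix x assume "(\<lambda>i. f i x) \<longlonglongrightarrow> g x"
    then have "(\<lambda>i. ennreal (f i x)) \<longlonglongrightarrow> ennreal (g x)" by (intro tendsto_intros)
    from lim_imp_Liminf[OF trivial_limit_sequentially this]
    show "ennreal (g x) = liminf (\<lambda>i. ennreal (f i x))" by (rule sym)
  qed
  also have "\<dots> \<le> liminf (\<lambda>i. \<integral>\<^sup>+x. ennreal (f i x) \<partial>MI)"
    by (rule nn_integral_liminf) auto
  also have "\<dots> \<le> liminf (\<lambda>i. ennreal (c i))"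
    using fn le i by (intro Liminf_mono always_eventually allI) (auto simp: nn_integral_eq_integral intro: ennreal_leI)
  also have "\<dots> = ennreal L"
    using c by (intro lim_imp_Liminf tendsto_intros) auto
  finally have *: "(\<integral>\<^sup>+x. ennreal (g x) \<partial>MI) \<le> ennreal L" .
  then show "integrable MI g"
    using gn by (intro integrableI_bounded) (auto simp: le_less_trans)
  then have "ennreal (LINT x|MI. g x) \<le> ennreal L"
    using * gn by (simp add: nn_integral_eq_integral)
  moreover have "0 \<le> L"
  proof (rule LIMSEQ_le_const[OF c])
    have "0 \<le> c i" for i
      using le[of i] Bochner_Integration.integral_nonneg[of MI "f i"] fn by (meson order_trans)
    then show "\<exists>N. \<forall>n\<ge>N. 0 \<le> c n" by blast
  qed
  ultimately show "(LINT x|MI. g x) \<le> L" by (simp add: ennreal_le_iff)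
qed

lemma sq_diff_le_diff_sq:
  fixes a b :: real
  assumes "0 \<le> a" "0 \<le> b"
  shows "(a - b)\<^sup>2 \<le> \<bar>a\<^sup>2 - b\<^sup>2\<bar>"
proof -
  have "\<bar>a - b\<bar> * \<bar>a - b\<bar> \<le> \<bar>a - b\<bar> * \<bar>a + b\<bar>" using assms by (intro mult_left_mono) auto
  then show ?thesis by (simp add: power2_eq_square abs_mult[symmetric] algebra_simps)
qed

text \<open>For nonnegative numbers (a - b)^2 \<le> |a^2 - b^2|. Convexity only controls differences
  of squares; the common sign on (0, pi) turns this into control of the functions
  themselves.\<close>

lemma half_pos_L2_dist:
  assumes f: "L4 f" "half_pos f" and g: "L4 g" "half_pos g"
  shows "(LINT x|MI. (f x - g x)\<^sup>2) \<le> sqrt pi * sqrt (LINT x|MI. ((f x)\<^sup>2 - (g x)\<^sup>2)\<^sup>2)"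
proof -
  note d = sqint_diff[OF L4_sq[OF f(1)] L4_sq[OF g(1)]]
  have "(LINT x|MI. (f x - g x)\<^sup>2) \<le> (LINT x|MI. \<bar>(f x)\<^sup>2 - (g x)\<^sup>2\<bar>)"
  proof (rule integral_mono_AE)
    show "integrable MI (\<lambda>x. (f x - g x)\<^sup>2)"
      by (rule sqintD) (intro sqint_diff L4_sqint f g)
    show "integrable MI (\<lambda>x. \<bar>(f x)\<^sup>2 - (g x)\<^sup>2\<bar>)"
      using sqint_integrable[OF d] by (rule integrable_abs)
    show "AE x in MI. (f x - g x)\<^sup>2 \<le> \<bar>(f x)\<^sup>2 - (g x)\<^sup>2\<bar>"
      using AE_MI_open
    proof eventually_elim
      case (elim x)
      then have "sin x > 0" by (simp add: sin_gt_zero)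
      then have "0 \<le> f x" "0 \<le> g x" using f(2) g(2) unfolding half_pos_def
        by (metis mult_less_0_iff not_less)+
      then show ?case by (rule sq_diff_le_diff_sq)
    qed
  qed
  also have "\<dots> \<le> sqrt pi * sqrt (LINT x|MI. ((f x)\<^sup>2 - (g x)\<^sup>2)\<^sup>2)"
    by (rule L1_le_L2[OF d])
  finally show ?thesis .
qed

text \<open>Competitors are all odd functions of the energy space, not only those positive on (0,
  pi), so that variations in arbitrary odd directions are admissible.\<close>

definition minimizer :: "real \<Rightarrow> real \<Rightarrow> (real \<Rightarrow> real) \<Rightarrow> bool" where
  "minimizer s \<omega> f \<longleftrightarrow> energy_space s f \<and> half_pos f \<and> (\<forall>g. energy_space s g \<longrightarrow> oddper g \<longrightarrow> energy s \<omega> f \<le> energy s \<omega> g)"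

lemma odd_rms_competitor:
  assumes s: "0 < s" "s \<le> 1" and f: "energy_space s f" "oddper f" and g: "energy_space s g" "oddper g"
  shows "energy_space s (odd_rms f g)" "half_pos (odd_rms f g)"
    "energy s \<omega> (odd_rms f g) \<le> (energy s \<omega> f + energy s \<omega> g) / 2 - 1 / 16 * (LINT x|MI. ((f x)\<^sup>2 - (g x)\<^sup>2)\<^sup>2)"
proof -
  note m = odd_rms_measurable[OF energy_spaceD(5)[OF f(1)] energy_spaceD(5)[OF g(1)]]
  show "energy_space s (odd_rms f g)"
    using energy_space_rms[OF s f(1) g(1)] energy_space_cong[OF odd_rms_AE m(2,1)] by simp
  show "half_pos (odd_rms f g)" by (rule half_pos_odd_rms[OF f(2) g(2)])
  show "energy s \<omega> (odd_rms f g) \<le> (energy s \<omega> f + energy s \<omega> g) / 2 - 1 / 16 * (LINT x|MI. ((f x)\<^sup>2 - (g x)\<^sup>2)\<^sup>2)"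
    using energy_rms[OF s f(1) g(1)] energy_cong[OF odd_rms_AE m(2,1)] by simp
qed

text \<open>The quadratic mean of two almost minimizers has energy at least \<open>m\<close>, so the
  convexity gain bounds the distance of their squares. Lower semicontinuity is obtained separately
  for the two parts of the energy: Fatou for the potential, truncation to finitely many modes for
  the form.\<close>

theorem minimizer_exists:
  assumes s: "0 < s" "s \<le> 1"
  shows "\<exists>f. minimizer s \<omega> f"
proof -
  define A where "A = {energy s \<omega> g |g. energy_space s g \<and> oddper g}"
  define m where "m = Inf A"
  have bdd: "bdd_below A" unfolding A_def by (rule bdd_belowI[of _ 0]) (auto simp: energy_nonneg)
  have "A \<noteq> {}" unfolding A_def using energy_space_sin[of s 1] oddper_sin[of 1] by blast
  have m_le: "m \<le> energy s \<omega> g" if "energy_space s g" "oddper g" for g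
    unfolding m_def using that by (intro cInf_lower bdd) (auto simp: A_def)
  have "\<exists>f. energy_space s f \<and> half_pos f \<and> energy s \<omega> f < m + e" if "e > 0" for e
  proof -
    have "Inf A < m + e" using that by (simp add: m_def)
    then obtain g where g: "energy_space s g" "oddper g" "energy s \<omega> g < m + e"
      using cInf_lessD[OF \<open>A \<noteq> {}\<close>] unfolding A_def by blast
    then show ?thesis
      \<comment> \<open>The quadratic mean of \<open>g\<close> with itself is positive on (0, pi)
        and has no larger energy.\<close>
      using odd_rms_competitor[OF s g(1,2) g(1,2)] by (intro exI[of _ "odd_rms g g"]) (force intro: le_less_trans)
  qed
  then have "\<forall>n::nat. \<exists>f. energy_space s f \<and> half_pos f \<and> energy s \<omega> f < m + inverse (Suc n)" by simp
  then obtain f where f: "\<And>n. energy_space s (f n)" "\<And>n. half_pos (f n)"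
    and Jf: "\<And>n::nat. energy s \<omega> (f n) < m + inverse (Suc n)"
    by metis
  have fo: "oddper (f n)" for n using f(2)[of n] by (simp add: half_pos_def)
  have [measurable]: "f n \<in> borel_measurable borel" for n using energy_spaceD(5)[OF f(1)] .
  have Q: "(LINT x|MI. ((f i x)\<^sup>2 - (f j x)\<^sup>2)\<^sup>2) \<le> 16 * e" if "energy s \<omega> (f i) \<le> m + e" "energy s \<omega> (f j) \<le> m + e" for i j e
  proof -
    note c = odd_rms_competitor[OF s f(1)[of i] fo[of i] f(1)[of j] fo[of j]]
    have "m \<le> energy s \<omega> (odd_rms (f i) (f j))"
      using c(2) by (intro m_le c) (simp add: half_pos_def)
    moreover have "q \<le> 16 * e" if "h \<le> (a + b) / 2 - 1 / 16 * q" "a \<le> m + e" "b \<le> m + e" "m \<le> h" for a b h q :: real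
      using that by (simp add: field_simps)
    ultimately show ?thesis using c(3)[of \<omega>] that by blast
  qed
  have cauchy: "\<exists>N. \<forall>i\<ge>N. \<forall>j\<ge>N. (LINT x|MI. (f i x - f j x)\<^sup>2) < e" if "e > 0" for e
  proof -
    \<comment> \<open>Chosen so that sqrt pi times sqrt (16 d) is e / 2.\<close>
    define d where "d = (e / 2)\<^sup>2 / (16 * pi)"
    have d: "d > 0" using that by (simp add: d_def)
    then obtain N where N: "inverse (real (Suc N)) < d" using reals_Archimedean by blast
    have energy: "energy s \<omega> (f i) \<le> m + d" if "i \<ge> N" for i
    proof -
      have "inverse (real (Suc i)) \<le> inverse (real (Suc N))" using that by (intro le_imp_inverse_le) auto
      then show ?thesis using Jf[of i] N by linarith
    qed
    have "(LINT x|MI. (f i x - f j x)\<^sup>2) < e" if "i \<ge> N" "j \<ge> N" for i j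
    proof -
      have "(LINT x|MI. (f i x - f j x)\<^sup>2) \<le> sqrt pi * sqrt (LINT x|MI. ((f i x)\<^sup>2 - (f j x)\<^sup>2)\<^sup>2)"
        by (rule half_pos_L2_dist[OF energy_spaceD(1)[OF f(1)] f(2) energy_spaceD(1)[OF f(1)] f(2)])
      also have "\<dots> \<le> sqrt pi * sqrt (16 * d)"
        using Q[OF energy energy] that by (intro mult_left_mono real_sqrt_le_mono) auto
      also have "\<dots> = e / 2" using \<open>e > 0\<close> by (simp add: d_def real_sqrt_mult[symmetric])
      finally show ?thesis using \<open>e > 0\<close> by simp
    qed
    then show ?thesis by blast
  qed
  obtain r g where r: "strict_mono r"
    and g: "g = (\<lambda>x. if convergent (\<lambda>i. f (r i) x) then lim (\<lambda>i. f (r i) x) else 0)"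
    and ae: "AE x in MI. (\<lambda>i. f (r i) x) \<longlonglongrightarrow> g x" and sg: "sqint g"
    and L2: "(\<lambda>n. LINT x|MI. (f n x - g x)\<^sup>2) \<longlonglongrightarrow> 0"
    by (rule L2_limit[of f, OF energy_spaceD(2)[OF f(1)]]) (erule cauchy, rule that)
  have gm [measurable]: "g \<in> borel_measurable borel" using sg by (rule sqintD)
  \<comment> \<open>Symmetries and sign hold at every point, not just almost everywhere: the set of
    convergence is invariant under reflection and translation by 2 pi, and outside it the value is
    0.\<close>
  have hp: "half_pos g"
    unfolding half_pos_def oddper_def periodic_2pi_def
  proof (intro conjI allI)
    fix x
    have "f (r i) (x + 2 * pi) = f (r i) x" for i using fo by (simp add: oddper_def periodic_2pi_def)
    then show "g (x + 2 * pi) = g x" by (simp add: g)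
    have n: "f (r i) (- x) = - f (r i) x" for i using fo by (simp add: oddper_def)
    show "g (- x) = - g x"
    proof (cases "convergent (\<lambda>i. f (r i) x)")
      case True
      then have "(\<lambda>i. f (r i) x) \<longlonglongrightarrow> g x" by (simp add: g convergent_LIMSEQ_iff)
      then have "(\<lambda>i. f (r i) (-x)) \<longlonglongrightarrow> - g x" unfolding n by (rule tendsto_minus)
      then show ?thesis using limI convergentI unfolding g by metis
    next
      case False
      then have "\<not> convergent (\<lambda>i. f (r i) (-x))" unfolding n using convergent_minus_iff by blast
      then show ?thesis using False by (simp add: g)
    qed
    show "0 \<le> g x * sin x"
    proof (cases "convergent (\<lambda>i. f (r i) x)")
      case True
      then have "(\<lambda>i. f (r i) x) \<longlonglongrightarrow> g x" by (simp add: g convergent_LIMSEQ_iff)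
      then have "(\<lambda>i. f (r i) x * sin x) \<longlonglongrightarrow> g x * sin x" by (intro tendsto_intros)
      then show ?thesis by (rule LIMSEQ_le_const) (use f(2) in \<open>auto simp: half_pos_def\<close>)
    qed (simp add: g)
  qed
  have scf_lim: "(\<lambda>i. scf (f (r i)) n) \<longlonglongrightarrow> scf g n" for n
  proof -
    have "(\<lambda>i. scf (f i) n - scf g n) \<longlonglongrightarrow> 0"
    proof (rule tendsto_0_le[where K=2])
      show "(\<lambda>N. sqrt (LINT x|MI. (f N x - g x)\<^sup>2)) \<longlonglongrightarrow> 0"
        using tendsto_real_sqrt[OF L2] by simp
      show "eventually (\<lambda>N. norm (scf (f N) n - scf g n) \<le> norm (sqrt (LINT x|MI. (f N x - g x)\<^sup>2)) * 2) sequentially"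
        using scf_le_L2[OF sqint_diff[OF energy_spaceD(2)[OF f(1)] sg]] 
        by (simp add: scf_diff[OF energy_spaceD(3)[OF f(1)] sqint_integrable[OF sg]] mult.commute)
    qed
    then have "(\<lambda>i. scf (f i) n) \<longlonglongrightarrow> scf g n" by (simp add: LIM_zero_iff)
    then show ?thesis using r LIMSEQ_subseq_LIMSEQ unfolding o_def by blast
  qed
  \<comment> \<open>Half of the form, cut off after \<open>N\<close> modes (pi / 4 is half of pi /
    2). It passes to the limit because each coefficient does; \<open>N\<close> is sent to infinity
    only after Fatou has been applied.\<close>
  define a where "a N h = pi / 4 * (\<Sum>n<N. real n powr (2 * s) * (scf h n)\<^sup>2)" for N h
  have a_lim: "(\<lambda>i. a N (f (r i))) \<longlonglongrightarrow> a N g" for N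
    unfolding a_def by (intro tendsto_intros scf_lim)
  have a_le: "a N h + 1 / 4 * (LINT x|MI. ((h x)\<^sup>2 - \<omega>)\<^sup>2) \<le> energy s \<omega> h" if "energy_space s h" for N h
  proof -
    have "(\<Sum>n<N. real n powr (2 * s) * (scf h n)\<^sup>2) \<le> (\<Sum>n. real n powr (2 * s) * (scf h n)\<^sup>2)"
      using energy_spaceD(4)[OF that] by (intro sum_le_suminf) (auto simp: fin_form_def)
    then show ?thesis by (simp add: a_def energy_def form_def power2_eq_square)
  qed
  have F: "integrable MI (\<lambda>x. ((g x)\<^sup>2 - \<omega>)\<^sup>2)" "(LINT x|MI. ((g x)\<^sup>2 - \<omega>)\<^sup>2) \<le> 4 * (m - a N g)" for N
  proof -
    define c where "c i = 4 * (m + inverse (real (Suc (r i))) - a N (f (r i)))" for i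
    have c: "c \<longlonglongrightarrow> 4 * (m + 0 - a N g)"
      unfolding c_def
      using LIMSEQ_subseq_LIMSEQ[OF LIMSEQ_inverse_real_of_nat r]
      by (intro tendsto_intros a_lim) (simp add: o_def)
    have i: "integrable MI (\<lambda>x. ((f (r i) x)\<^sup>2 - \<omega>)\<^sup>2)" for i
      using sqint_sq_minus[OF energy_spaceD(1)[OF f(1)]] by (rule sqintD)
    have l: "AE x in MI. (\<lambda>i. ((f (r i) x)\<^sup>2 - \<omega>)\<^sup>2) \<longlonglongrightarrow> ((g x)\<^sup>2 - \<omega>)\<^sup>2"
      using ae by eventually_elim (intro tendsto_intros)
    have le: "(LINT x|MI. ((f (r i) x)\<^sup>2 - \<omega>)\<^sup>2) \<le> c i" for i
    proof -
      have "q \<le> 4 * (m + e - a)" if "a + 1 / 4 * q \<le> h" "h < m + e" for a q h e :: real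
        using that by (simp add: field_simps)
      then show ?thesis
        using a_le[OF f(1)[of "r i"], of N] Jf[of "r i"] unfolding c_def by blast
    qed
    show "integrable MI (\<lambda>x. ((g x)\<^sup>2 - \<omega>)\<^sup>2)"
      by (rule Fatou_MI(1)[OF _ _ _ _ i l le c]) auto
    show "(LINT x|MI. ((g x)\<^sup>2 - \<omega>)\<^sup>2) \<le> 4 * (m - a N g)"
      using Fatou_MI(2)[OF _ _ _ _ i l le c] by auto
  qed
  have "sqint (\<lambda>x. (g x)\<^sup>2 - \<omega>)" using F(1) by (simp add: sqint_def)
  from sqint_add[OF this sqint_const[of \<omega>]] have "L4 g" by (intro L4_sqintI) auto
  have aN: "(\<Sum>n<N. real n powr (2 * s) * (scf g n)\<^sup>2) \<le> (m - 1 / 4 * (LINT x|MI. ((g x)\<^sup>2 - \<omega>)\<^sup>2)) / (pi / 4)" for N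
    using F(2)[of N] by (simp add: a_def field_simps)
  then have ff: "fin_form s g" unfolding fin_form_def by (intro summableI_nonneg_bounded) auto
  then have "(\<Sum>n. real n powr (2 * s) * (scf g n)\<^sup>2) \<le> (m - 1 / 4 * (LINT x|MI. ((g x)\<^sup>2 - \<omega>)\<^sup>2)) / (pi / 4)"
    using aN by (intro suminf_le_const) (auto simp: fin_form_def)
  then have "energy s \<omega> g \<le> m" by (simp add: energy_def form_def power2_eq_square field_simps)
  then have "minimizer s \<omega> g"
    unfolding minimizer_def using hp ff \<open>L4 g\<close> m_le by (auto simp: energy_space_def intro: order_trans)
  then show ?thesis by blast
qed

text \<open>The polynomial has a minimum at 0, where its derivative is \<open>c1\<close>.\<close>

lemma quartic_min_coeff:
  fixes c1 c2 c3 c4 :: real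
  assumes "\<And>t. 0 \<le> t * c1 + t\<^sup>2 * c2 + t ^ 3 * c3 + t ^ 4 * c4"
  shows "c1 = 0"
proof -
  define p where "p t = t * c1 + t\<^sup>2 * c2 + t ^ 3 * c3 + t ^ 4 * c4" for t
  have "(p has_real_derivative c1) (at 0)"
    unfolding p_def by (auto intro!: derivative_eq_intros)
  moreover have "\<forall>y. \<bar>0 - y\<bar> < 1 \<longrightarrow> p 0 \<le> p y" using assms by (auto simp: p_def)
  ultimately show ?thesis using DERIV_local_min[of p c1 0 1] by auto
qed

text \<open>The Euler-Lagrange equation of the energy. The cubic term is grouped as a product of the
  square-integrable functions \<open>f^2 - \<omega>\<close> and \<open>f * \<eta>\<close>, so it is
  integrable for every test function of the energy space.\<close>

definition weak_solution :: "real \<Rightarrow> real \<Rightarrow> (real \<Rightarrow> real) \<Rightarrow> bool" where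
  "weak_solution s \<omega> f \<longleftrightarrow> energy_space s f \<and>
    (\<forall>\<eta>. energy_space s \<eta> \<longrightarrow> oddper \<eta> \<longrightarrow> form s f \<eta> + (LINT x|MI. ((f x)\<^sup>2 - \<omega>) * (f x * \<eta> x)) = 0)"

text \<open>Along \<open>f + t \<eta>\<close> the energy is a polynomial of degree 4 in
  \<open>t\<close>, so the first variation is its linear coefficient and no limit under the integral
  occurs.\<close>

theorem minimizer_weak_solution:
  assumes f: "minimizer s \<omega> f"
  shows "weak_solution s \<omega> f"
  unfolding weak_solution_def
proof (intro conjI allI impI)
  show fE: "energy_space s f" using f by (simp add: minimizer_def)
  have fo: "oddper f" using f by (simp add: minimizer_def half_pos_def)
  fix \<eta> assume \<eta>: "energy_space s \<eta>" "oddper \<eta>"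
  let ?A = "\<lambda>x. (f x)\<^sup>2 - \<omega>"
  have sq: "sqint ?A" "sqint (\<lambda>x. f x * \<eta> x)" "sqint (\<lambda>x. (\<eta> x)\<^sup>2)"
    using energy_spaceD(1)[OF fE] energy_spaceD(1)[OF \<eta>(1)] by (simp_all add: sqint_sq_minus L4_mult L4_sq)
  let ?I = "\<lambda>u v. LINT x|MI. u x * v x"
  let ?c1 = "form s f \<eta> + ?I ?A (\<lambda>x. f x * \<eta> x)"
  let ?c2 = "form s \<eta> \<eta> / 2 + ?I (\<lambda>x. f x * \<eta> x) (\<lambda>x. f x * \<eta> x) + 1 / 2 * ?I ?A (\<lambda>x. (\<eta> x)\<^sup>2)"
  let ?c3 = "?I (\<lambda>x. f x * \<eta> x) (\<lambda>x. (\<eta> x)\<^sup>2)"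
  let ?c4 = "1 / 4 * ?I (\<lambda>x. (\<eta> x)\<^sup>2) (\<lambda>x. (\<eta> x)\<^sup>2)"
  have "energy s \<omega> (\<lambda>x. f x + t * \<eta> x) = energy s \<omega> f + (t * ?c1 + t\<^sup>2 * ?c2 + t ^ 3 * ?c3 + t ^ 4 * ?c4)" for t
  proof -
    have t\<eta>: "energy_space s (\<lambda>x. t * \<eta> x)" by (rule energy_space_cmult[OF \<eta>(1)])
    have sum: "energy_space s (\<lambda>x. f x + t * \<eta> x)" by (rule energy_space_add[OF fE t\<eta>])
    have "form s (\<lambda>x. f x + t * \<eta> x) (\<lambda>x. f x + t * \<eta> x)
      = form s f (\<lambda>x. f x + t * \<eta> x) + t * form s \<eta> (\<lambda>x. f x + t * \<eta> x)"
      using form_add_left[OF fE t\<eta> sum] form_cmult_left[OF \<eta>(1) sum] by simp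
    also have "form s f (\<lambda>x. f x + t * \<eta> x) = form s f f + t * form s f \<eta>"
      using form_add_left[OF fE t\<eta> fE] form_cmult_left[OF \<eta>(1) fE] by (simp add: form_commute[of s f "\<lambda>x. f x + t * \<eta> x"] form_commute[of s f \<eta>])
    also have "form s \<eta> (\<lambda>x. f x + t * \<eta> x) = form s f \<eta> + t * form s \<eta> \<eta>"
      using form_add_left[OF fE t\<eta> \<eta>(1)] form_cmult_left[OF \<eta>(1) \<eta>(1)] by (simp add: form_commute[of s \<eta> "\<lambda>x. f x + t * \<eta> x"])
    finally have 1: "form s (\<lambda>x. f x + t * \<eta> x) (\<lambda>x. f x + t * \<eta> x)
      = form s f f + 2 * t * form s f \<eta> + t\<^sup>2 * form s \<eta> \<eta>"
      by (simp add: power2_eq_square algebra_simps)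
    have "(LINT x|MI. ((f x + t * \<eta> x)\<^sup>2 - \<omega>)\<^sup>2) =
      (LINT x|MI. ?A x * ?A x + 4 * t * (?A x * (f x * \<eta> x)) + 4 * t\<^sup>2 * ((f x * \<eta> x) * (f x * \<eta> x))
         + 2 * t\<^sup>2 * (?A x * (\<eta> x)\<^sup>2) + 4 * t ^ 3 * ((f x * \<eta> x) * (\<eta> x)\<^sup>2) + t ^ 4 * ((\<eta> x)\<^sup>2 * (\<eta> x)\<^sup>2))"
      by (intro Bochner_Integration.integral_cong refl)
        (simp add: power2_eq_square power3_eq_cube power4_eq_xxxx algebra_simps)
    also have "\<dots> = ?I ?A ?A + 4 * t * ?I ?A (\<lambda>x. f x * \<eta> x) + 4 * t\<^sup>2 * ?I (\<lambda>x. f x * \<eta> x) (\<lambda>x. f x * \<eta> x)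
         + 2 * t\<^sup>2 * ?I ?A (\<lambda>x. (\<eta> x)\<^sup>2) + 4 * t ^ 3 * ?c3 + t ^ 4 * ?I (\<lambda>x. (\<eta> x)\<^sup>2) (\<lambda>x. (\<eta> x)\<^sup>2)"
      using sqint_prod[OF sq(1) sq(1)] sqint_prod[OF sq(1) sq(2)] sqint_prod[OF sq(2) sq(2)]
        sqint_prod[OF sq(1) sq(3)] sqint_prod[OF sq(2) sq(3)] sqint_prod[OF sq(3) sq(3)]
      by (simp only: Bochner_Integration.integral_add integral_mult_right_zero
          Bochner_Integration.integrable_add integrable_mult_right)
    finally show ?thesis
      unfolding energy_def 1 power2_eq_square[of "(f _)\<^sup>2 - \<omega>"] by (simp add: field_simps)
  qed
  moreover have "energy s \<omega> f \<le> energy s \<omega> (\<lambda>x. f x + t * \<eta> x)" for t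
    using f energy_space_add[OF fE energy_space_cmult[OF \<eta>(1)], of t] oddper_add[OF fo oddper_cmult[OF \<eta>(2)], of t]
    by (simp add: minimizer_def)
  ultimately show "?c1 = 0" by (intro quartic_min_coeff[of ?c1 ?c2 ?c3 ?c4]) (simp only: le_add_same_cancel1)
qed

section \<open>Distance and uniqueness of weak solutions\<close>

lemma weak_solution_test:
  assumes f: "weak_solution s \<omega> f" and \<eta>: "energy_space s \<eta>" "oddper \<eta>"
  shows "form s f \<eta> = \<omega> * (LINT x|MI. f x * \<eta> x) - (LINT x|MI. (f x)\<^sup>2 * (f x * \<eta> x))"
proof -
  have fE: "energy_space s f" using f by (simp add: weak_solution_def)
  have "(LINT x|MI. ((f x)\<^sup>2 - \<omega>) * (f x * \<eta> x)) = (LINT x|MI. (f x)\<^sup>2 * (f x * \<eta> x) - \<omega> * (f x * \<eta> x))"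
    by (simp add: left_diff_distrib)
  also have "\<dots> = (LINT x|MI. (f x)\<^sup>2 * (f x * \<eta> x)) - \<omega> * (LINT x|MI. f x * \<eta> x)"
    using sqint_prod[OF L4_sq[OF energy_spaceD(1)[OF fE]] L4_mult[OF energy_spaceD(1)[OF fE] energy_spaceD(1)[OF \<eta>(1)]]]
      sqint_prod[OF energy_spaceD(2)[OF fE] energy_spaceD(2)[OF \<eta>(1)]] by simp
  finally show ?thesis using f \<eta> by (auto simp: weak_solution_def)
qed

text \<open>\<open>P\<close> is the quotient (f^3 - g^3) / (f - g), and \<omega> f - \<nu> g =
  \<omega> w + (\<omega> - \<nu>) g; the difference of the two equations is tested with
  \<open>w\<close> itself.\<close>

lemma weak_solution_diff:
  assumes f: "weak_solution s \<omega> f" "oddper f" and g: "weak_solution s \<nu> g" "oddper g"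
  defines "w \<equiv> \<lambda>x. f x - g x" and "P \<equiv> \<lambda>x. (f x)\<^sup>2 + f x * g x + (g x)\<^sup>2"
  shows "integrable MI (\<lambda>x. P x * (w x)\<^sup>2)"
    "form s w w = \<omega> * (LINT x|MI. (w x)\<^sup>2) + (\<omega> - \<nu>) * (LINT x|MI. g x * w x) - (LINT x|MI. P x * (w x)\<^sup>2)"
proof -
  have E: "energy_space s f" "energy_space s g" using f g by (auto simp: weak_solution_def)
  have wE: "energy_space s w" "oddper w" unfolding w_def using E f g by (auto intro: energy_space_diff oddper_diff)
  have i: "integrable MI (\<lambda>x. (f x)\<^sup>2 * (f x * w x))" "integrable MI (\<lambda>x. (g x)\<^sup>2 * (g x * w x))"
    "integrable MI (\<lambda>x. f x * w x)" "integrable MI (\<lambda>x. g x * w x)"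
    by (auto intro!: sqint_prod L4_sq L4_mult energy_spaceD(1)[OF E(1)] energy_spaceD(1)[OF E(2)] energy_spaceD(1)[OF wE(1)]
        energy_spaceD(2)[OF E(1)] energy_spaceD(2)[OF E(2)] energy_spaceD(2)[OF wE(1)])
  have e: "(\<lambda>x. P x * (w x)\<^sup>2) = (\<lambda>x. (f x)\<^sup>2 * (f x * w x) - (g x)\<^sup>2 * (g x * w x))"
    by (auto simp: P_def w_def power2_eq_square algebra_simps)
  show "integrable MI (\<lambda>x. P x * (w x)\<^sup>2)" unfolding e using i by simp
  have Q: "(LINT x|MI. P x * (w x)\<^sup>2) = (LINT x|MI. (f x)\<^sup>2 * (f x * w x)) - (LINT x|MI. (g x)\<^sup>2 * (g x * w x))"
    unfolding e using i by simp
  have "(LINT x|MI. (w x)\<^sup>2) = (LINT x|MI. f x * w x - g x * w x)"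
    by (simp add: w_def power2_eq_square left_diff_distrib)
  then have W: "(LINT x|MI. (w x)\<^sup>2) = (LINT x|MI. f x * w x) - (LINT x|MI. g x * w x)"
    using i by simp
  have "form s w w = form s f w - form s g w"
    unfolding w_def by (rule form_diff_left[OF E]) (use wE in \<open>simp add: w_def\<close>)
  then show "form s w w = \<omega> * (LINT x|MI. (w x)\<^sup>2) + (\<omega> - \<nu>) * (LINT x|MI. g x * w x) - (LINT x|MI. P x * (w x)\<^sup>2)"
    unfolding weak_solution_test[OF f(1) wE] weak_solution_test[OF g(1) wE] Q W
    by (simp add: algebra_simps)
qed

lemma sum_products_nonneg: "0 \<le> (a::real)\<^sup>2 + a * b + b\<^sup>2"
proof -
  have "a\<^sup>2 + a * b + b\<^sup>2 = (a + b / 2)\<^sup>2 + 3 / 4 * b\<^sup>2" by (simp add: power2_eq_square field_simps)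
  then show ?thesis by simp
qed

lemma integral_abs_mult_le:
  assumes "sqint f" "sqint g"
  shows "\<bar>LINT x|MI. f x * g x\<bar> \<le> (LINT x|MI. (f x)\<^sup>2) + (LINT x|MI. (g x)\<^sup>2)"
proof -
  let ?F = "LINT x|MI. (f x)\<^sup>2" and ?G = "LINT x|MI. (g x)\<^sup>2"
  have n: "0 \<le> ?F" "0 \<le> ?G" by (auto intro: Bochner_Integration.integral_nonneg)
  have "(LINT x|MI. f x * g x)\<^sup>2 \<le> ?F * ?G" by (rule CS_MI[OF assms])
  also have "\<dots> \<le> (?F + ?G)\<^sup>2" using n by (simp add: power2_sum)
  finally show ?thesis using n by (simp add: abs_le_square_iff[symmetric])
qed

lemma energy_expand:
  assumes "L4 f"
  shows "energy s \<omega> f = form s f f / 2 + 1 / 4 * (LINT x|MI. (f x) ^ 4) - \<omega> / 2 * (LINT x|MI. (f x)\<^sup>2) + pi * \<omega>\<^sup>2 / 4"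
proof -
  have "(LINT x|MI. ((f x)\<^sup>2 - \<omega>)\<^sup>2) = (LINT x|MI. f x ^ 4 - 2 * \<omega> * (f x)\<^sup>2 + \<omega>\<^sup>2)"
    by (intro Bochner_Integration.integral_cong refl) (simp add: power2_diff flip: power_mult)
  also have "\<dots> = (LINT x|MI. f x ^ 4) - 2 * \<omega> * (LINT x|MI. (f x)\<^sup>2) + pi * \<omega>\<^sup>2"
    using assms sqintD(2)[OF L4_sqint[OF assms]] by (simp add: L4_def)
  finally show ?thesis by (simp add: energy_def field_simps)
qed

text \<open>Both minimizers are compared with their quadratic mean, each at its own frequency. In
  the sum everything cancels but the mixed term, which gives
  \<open>Q \<le> 2 (\<omega> - \<nu>) D\<close>, and Cauchy-Schwarz bounds D^2 by pi Q. For \<omega>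
  = \<nu> this is uniqueness up to null sets.\<close>

lemma minimizer_sq_dist:
  assumes s: "0 < s" "s \<le> 1" and f: "minimizer s \<omega> f" and g: "minimizer s \<nu> g"
  shows "(LINT x|MI. ((f x)\<^sup>2 - (g x)\<^sup>2)\<^sup>2) \<le> 4 * pi * (\<omega> - \<nu>)\<^sup>2"
proof -
  define Q where "Q = (LINT x|MI. ((f x)\<^sup>2 - (g x)\<^sup>2)\<^sup>2)"
  define D where "D = (LINT x|MI. (f x)\<^sup>2 - (g x)\<^sup>2)"
  have E: "energy_space s f" "energy_space s g" "oddper f" "oddper g" using f g by (auto simp: minimizer_def half_pos_def)
  have c: "energy_space s (odd_rms f g)" "oddper (odd_rms f g)" using odd_rms_competitor(1,2)[OF s E(1,3) E(2,4)]
    by (auto simp: half_pos_def)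
  note c3 = odd_rms_competitor(3)[OF s E(1,3) E(2,4), folded Q_def]
  have 1: "energy s \<omega> f \<le> (energy s \<omega> f + energy s \<omega> g) / 2 - 1 / 16 * Q"
    using c3[of \<omega>] f c by (fastforce simp: minimizer_def intro: order_trans)
  have 2: "energy s \<nu> g \<le> (energy s \<nu> f + energy s \<nu> g) / 2 - 1 / 16 * Q"
    using c3[of \<nu>] g c by (fastforce simp: minimizer_def intro: order_trans)
  have D: "D = (LINT x|MI. (f x)\<^sup>2) - (LINT x|MI. (g x)\<^sup>2)"
    unfolding D_def using sqintD(2)[OF energy_spaceD(2)[OF E(1)]] sqintD(2)[OF energy_spaceD(2)[OF E(2)]] by simp
  have "Q \<le> 2 * (\<omega> - \<nu>) * D"
    using 1 2 unfolding energy_expand[OF energy_spaceD(1)[OF E(1)]] energy_expand[OF energy_spaceD(1)[OF E(2)]] D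
    by (simp add: field_simps)
  moreover have Q0: "0 \<le> Q" unfolding Q_def by (auto intro: Bochner_Integration.integral_nonneg)
  ultimately have "Q\<^sup>2 \<le> (2 * (\<omega> - \<nu>) * D)\<^sup>2" by (intro power_mono) auto
  also have "\<dots> = 4 * (\<omega> - \<nu>)\<^sup>2 * D\<^sup>2" by (simp only: power_mult_distrib) simp
  also have "\<dots> \<le> 4 * (\<omega> - \<nu>)\<^sup>2 * (pi * Q)"
    using CS_MI[OF sqint_const[of 1] sqint_diff[OF L4_sq[OF energy_spaceD(1)[OF E(1)]] L4_sq[OF energy_spaceD(1)[OF E(2)]]]]
    by (intro mult_left_mono) (auto simp: D_def Q_def)
  finally have "Q * Q \<le> 4 * pi * (\<omega> - \<nu>)\<^sup>2 * Q"
    by (simp only: power2_eq_square[of Q] mult_ac)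
  then show ?thesis using Q0 unfolding Q_def[symmetric]
    by (cases "Q = 0") (auto simp: mult_le_cancel_right)
qed

text \<open>The bound on the squares gives a squared L^2 distance of order |\<omega> - \<nu>|. The
  equation for the difference raises it to the form: the cubic contribution has a good sign and is
  dropped.\<close>

theorem minimizer_form_dist:
  assumes s: "0 < s" "s \<le> 1" and f: "minimizer s \<omega> f" and g: "minimizer s \<nu> g" and \<omega>: "0 \<le> \<omega>"
  shows "form s (\<lambda>x. f x - g x) (\<lambda>x. f x - g x)
    \<le> (2 * pi * \<omega> + (LINT x|MI. (g x)\<^sup>2) + 2 * pi * \<bar>\<omega> - \<nu>\<bar>) * \<bar>\<omega> - \<nu>\<bar>"
proof -
  define w where "w = (\<lambda>x. f x - g x)"
  define W where "W = (LINT x|MI. (w x)\<^sup>2)"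
  define G where "G = (LINT x|MI. (g x)\<^sup>2)"
  define d where "d = \<bar>\<omega> - \<nu>\<bar>"
  have E: "energy_space s f" "energy_space s g" "half_pos f" "half_pos g" "oddper f" "oddper g" using f g
    by (auto simp: minimizer_def half_pos_def)
  have wE: "energy_space s w" unfolding w_def using E by (auto intro: energy_space_diff)
  have "W \<le> sqrt pi * sqrt (LINT x|MI. ((f x)\<^sup>2 - (g x)\<^sup>2)\<^sup>2)"
    unfolding W_def w_def by (intro half_pos_L2_dist energy_spaceD(1)[OF E(1)] energy_spaceD(1)[OF E(2)] E)
  also have "\<dots> \<le> sqrt pi * sqrt (4 * pi * (\<omega> - \<nu>)\<^sup>2)"
    by (intro mult_left_mono real_sqrt_le_mono minimizer_sq_dist[OF s f g]) auto
  also have "\<dots> = 2 * pi * d"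
    by (simp add: real_sqrt_mult d_def)
  finally have W: "W \<le> 2 * pi * d" .
  note dd = weak_solution_diff[OF minimizer_weak_solution[OF f] E(5) minimizer_weak_solution[OF g] E(6)]
  have "0 \<le> (LINT x|MI. ((f x)\<^sup>2 + f x * g x + (g x)\<^sup>2) * (f x - g x)\<^sup>2)"
    by (auto intro!: Bochner_Integration.integral_nonneg mult_nonneg_nonneg sum_products_nonneg)
  then have "form s w w \<le> \<omega> * W + (\<omega> - \<nu>) * (LINT x|MI. g x * w x)"
    using dd(2) by (simp add: w_def W_def)
  also have "\<dots> \<le> \<omega> * W + d * (G + W)"
  proof -
    have "(\<omega> - \<nu>) * (LINT x|MI. g x * w x) \<le> \<bar>(\<omega> - \<nu>) * (LINT x|MI. g x * w x)\<bar>" by simp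
    also have "\<dots> \<le> d * (G + W)"
      unfolding abs_mult d_def G_def W_def
      by (intro mult_left_mono integral_abs_mult_le energy_spaceD(2)[OF E(2)] energy_spaceD(2)[OF wE]) auto
    finally show ?thesis by simp
  qed
  also have "\<dots> \<le> \<omega> * (2 * pi * d) + d * (G + 2 * pi * d)"
    using W \<omega> by (intro add_mono mult_left_mono) (auto simp: d_def)
  finally show ?thesis by (simp add: w_def G_def d_def algebra_simps)
qed

text \<open>Testing with \<open>f\<close> itself and the Poincare inequality bound the integral of
  f^4 by \<omega> - 1 times that of f^2. The common factor is not divided out, as \<open>f\<close>
  may vanish.\<close>

lemma weak_solution_L2_bound:
  assumes s: "0 \<le> s" and f: "weak_solution s \<omega> f" "oddper f"
  shows "(LINT x|MI. (f x)\<^sup>2)\<^sup>2 \<le> pi * ((\<omega> - 1) * (LINT x|MI. (f x)\<^sup>2))"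
proof -
  have E: "energy_space s f" using f by (auto simp: weak_solution_def)
  have "(LINT x|MI. (f x)\<^sup>2) \<le> form s f f"
    using form_ge[OF E s, of 1] by simp
  also have "\<dots> = \<omega> * (LINT x|MI. (f x)\<^sup>2) - (LINT x|MI. ((f x)\<^sup>2)\<^sup>2)"
    using weak_solution_test[OF f(1) E f(2)] by (simp add: power2_eq_square mult.assoc)
  finally have "(LINT x|MI. ((f x)\<^sup>2)\<^sup>2) \<le> (\<omega> - 1) * (LINT x|MI. (f x)\<^sup>2)" by (simp add: algebra_simps)
  moreover have "(LINT x|MI. (f x)\<^sup>2)\<^sup>2 \<le> pi * (LINT x|MI. ((f x)\<^sup>2)\<^sup>2)"
    using CS_MI[OF sqint_const[of 1] L4_sq[OF energy_spaceD(1)[OF E]]] by simp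
  ultimately show ?thesis by (meson mult_left_mono order_trans pi_ge_zero)
qed

text \<open>\<open>f * sin\<close> is nonnegative, so a vanishing first coefficient would force
  \<open>f = 0\<close> almost everywhere; but for \<omega> > 1 zero is not minimal, a suitable
  multiple of sin having less energy.\<close>

lemma minimizer_scf_pos:
  assumes s: "0 < s" "s \<le> 1" and f: "minimizer s \<omega> f" and \<omega>: "\<omega> > 1"
  shows "scf f 1 > 0"
proof (rule ccontr)
  assume np: "\<not> ?thesis"
  have E: "energy_space s f" and pos: "\<And>x. 0 \<le> f x * sin x" using f by (auto simp: minimizer_def half_pos_def)
  have [measurable]: "f \<in> borel_measurable borel" using energy_spaceD(5)[OF E] .
  have i: "integrable MI (\<lambda>x. f x * sin x)" using integrable_MI_sin[OF energy_spaceD(3)[OF E], of 1] by simp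
  have n: "0 \<le> (LINT x|MI. f x * sin x)" using pos by (auto intro: Bochner_Integration.integral_nonneg)
  have "\<not> (LINT x|MI. f x * sin x) > 0" 
  proof
    assume "0 < (LINT x|MI. f x * sin x)"
    then have "0 < 2 / pi * (LINT x|MI. f x * sin x)" by (intro mult_pos_pos) auto
    then show False using np by (simp add: scf_def)
  qed
  with n have "(LINT x|MI. f x * sin x) = 0" by simp
  then have "AE x in MI. f x * sin x = 0" using i pos by (simp add: integral_nonneg_eq_0_iff_AE)
  then have ae: "AE x in MI. f x = 0" using AE_MI_open
  proof eventually_elim
    case (elim x)
    then show ?case using sin_gt_zero[of x] by auto
  qed
  have "energy s \<omega> f = energy s \<omega> (\<lambda>x. 0)" by (rule energy_cong[OF ae]) auto
  also have "\<dots> = pi * \<omega>\<^sup>2 / 4" by (simp add: energy_def form_def scf_def)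
  finally have Jf: "energy s \<omega> f = pi * \<omega>\<^sup>2 / 4" .
  \<comment> \<open>By sin^4 \<le> 1 the energy of \<open>t sin\<close> exceeds that of 0 by at most
    pi / 4 times t^2 (1 + t^2 - \<omega>), negative for 0 < t^2 < \<omega> - 1; t^2 is taken in the
    middle of this range.\<close>
  define t where "t = sqrt ((\<omega> - 1) / 2)"
  have t2: "t\<^sup>2 = (\<omega> - 1) / 2" using \<omega> by (simp add: t_def)
  have sE: "energy_space s (\<lambda>x. t * sin (real 1 * x))" "oddper (\<lambda>x. t * sin (real 1 * x))"
    by (intro energy_space_cmult energy_space_sin, intro oddper_cmult oddper_sin)
  have "energy s \<omega> f \<le> energy s \<omega> (\<lambda>x. t * sin (real 1 * x))"
    using f sE by (auto simp: minimizer_def)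
  also have "\<dots> \<le> pi * t\<^sup>2 / 4 + 1 / 4 * (pi * t ^ 4) - \<omega> / 2 * (pi / 2 * t\<^sup>2) + pi * \<omega>\<^sup>2 / 4"
  proof -
    have 1: "form s (\<lambda>x. t * sin (real 1 * x)) (\<lambda>x. t * sin (real 1 * x)) = pi * t\<^sup>2 / 2"
      using form_cmult_left[OF energy_space_sin[of s 1] sE(1), of t] form_sin[of s "\<lambda>x. t * sin (real 1 * x)" 1]
        form_commute[of s "\<lambda>x. sin (real 1 * x)" "\<lambda>x. t * sin (real 1 * x)"] scf_sin[of 1 1]
      by (simp add: power2_eq_square)
    have 2: "(LINT x|MI. (t * sin (real 1 * x))\<^sup>2) = pi / 2 * t\<^sup>2"
      using integral_sin_sin_MI[of 1 1] by (simp add: power_mult_distrib power2_eq_square[of "sin _"])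
    have 3: "(LINT x|MI. (t * sin (real 1 * x)) ^ 4) \<le> pi * t ^ 4"
    proof -
      have "(LINT x|MI. (t * sin (real 1 * x)) ^ 4) \<le> (LINT x|MI. t ^ 4)"
      proof (rule integral_mono)
        show "integrable MI (\<lambda>x. (t * sin (real 1 * x)) ^ 4)" using energy_spaceD(1)[OF sE(1)] by (simp add: L4_def)
        show "(t * sin (real 1 * x)) ^ 4 \<le> t ^ 4" for x
        proof -
          have "\<bar>sin x\<bar> ^ 4 \<le> 1" by (rule power_le_one) auto
          then have "t ^ 4 * (sin x) ^ 4 \<le> t ^ 4 * 1" by (intro mult_left_mono) auto
          then show ?thesis by (simp add: power_mult_distrib)
        qed
      qed simp
      then show ?thesis by simp
    qed
    show ?thesis unfolding energy_expand[OF energy_spaceD(1)[OF sE(1)]] 1 2 using 3 by simp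
  qed
  also have "t ^ 4 = (t\<^sup>2)\<^sup>2" by simp
  finally have "0 \<le> pi / 4 * (t\<^sup>2 * (1 + t\<^sup>2 - \<omega>))" unfolding Jf by (simp add: power2_eq_square algebra_simps)
  moreover have "t\<^sup>2 * (1 + t\<^sup>2 - \<omega>) < 0" unfolding t2 using \<omega> by (intro mult_pos_neg) (auto simp: field_simps)
  then have "pi / 4 * (t\<^sup>2 * (1 + t\<^sup>2 - \<omega>)) < 0" by (rule mult_pos_neg[rotated]) simp
  ultimately show False by (meson not_less)
qed

text \<open>A form of Young's inequality for t^3 u, proved by exhibiting the difference as a
  nonnegative expression.\<close>

lemma quartic_AMGM: "- (u ^ 4 / 4) \<le> (t::real) ^ 4 - t ^ 3 * u"
proof -
  have "0 \<le> 1 / 4 * t ^ 4 + 1 / 4 * ((t - u)\<^sup>2 * (2 * t\<^sup>2 + (t + u)\<^sup>2))" by simp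
  also have "\<dots> = t ^ 4 - t ^ 3 * u + u ^ 4 / 4"
    by (simp add: power2_eq_square power3_eq_cube power4_eq_xxxx algebra_simps)
  finally show ?thesis by simp
qed

text \<open>The equation is tested with the part \<open>r\<close> of \<open>f\<close> orthogonal to
  sin. There the form is at least 2^(2s) times the squared norm, and f^3 r = f^4 - f^3 (a sin x) is
  bounded below by - a^4 / 4. So \<open>r\<close> is of order a^2 in L^2 as long as \<omega> stays
  away from 2^(2s) from below, with no smallness assumed of \<open>f\<close>.\<close>

lemma weak_solution_remainder:
  assumes s: "0 < s" and f: "weak_solution s \<omega> f" "oddper f" and a: "scf f 1 = a"
  defines "r \<equiv> \<lambda>x. f x - a * sin x"
  shows "energy_space s r" "scf r 1 = 0" "(2 powr (2 * s) - \<omega>) * (LINT x|MI. (r x)\<^sup>2) \<le> pi * a ^ 4 / 4"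
proof -
  have E: "energy_space s f" using f by (auto simp: weak_solution_def)
  have sn: "energy_space s (\<lambda>x. a * sin x)" "oddper (\<lambda>x. a * sin x)"
    using energy_space_cmult[OF energy_space_sin[of s 1]] oddper_cmult[OF oddper_sin[of 1]] by auto
  show rE: "energy_space s r" unfolding r_def by (rule energy_space_diff[OF E sn(1)])
  have ro: "oddper r" unfolding r_def by (rule oddper_diff[OF f(2) sn(2)])
  show r1: "scf r 1 = 0"
    using scf_diff[OF energy_spaceD(3)[OF E] energy_spaceD(3)[OF sn(1)], of 1] scf_sin[of 1 1] a by (simp add: r_def)
  then have rs: "(LINT x|MI. r x * sin x) = 0" by (simp add: scf_def)
  have ge: "2 powr (2 * s) * (LINT x|MI. (r x)\<^sup>2) \<le> form s r r"
  proof -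
    have "scf r n = 0" if "n < 2" for n using that r1 by (cases n) (auto simp: less_Suc_eq numeral_2_eq_2)
    then show ?thesis using form_ge[OF rE, of 2] s by simp
  qed
  have "form s r r = form s f r - form s (\<lambda>x. a * sin x) r"
    unfolding r_def by (rule form_diff_left[OF E sn(1)]) (use rE in \<open>simp add: r_def\<close>)
  also have "form s (\<lambda>x. a * sin x) r = 0"
    using form_cmult_left[OF energy_space_sin[of s 1] rE, of a] form_sin[of s r 1] r1
    by (simp add: form_commute[of s sin r])
  also have "form s f r = \<omega> * (LINT x|MI. f x * r x) - (LINT x|MI. (f x)\<^sup>2 * (f x * r x))"
    by (rule weak_solution_test[OF f(1) rE ro])
  also have "(LINT x|MI. f x * r x) = (LINT x|MI. (r x)\<^sup>2)"
  proof -
    have "(LINT x|MI. f x * r x) = (LINT x|MI. (r x)\<^sup>2 + a * (r x * sin x))"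
      by (intro Bochner_Integration.integral_cong refl) (simp add: r_def power2_eq_square algebra_simps)
    also have "\<dots> = (LINT x|MI. (r x)\<^sup>2)"
      using sqintD(2)[OF energy_spaceD(2)[OF rE]] integrable_MI_sin[OF energy_spaceD(3)[OF rE], of 1] rs by simp
    finally show ?thesis .
  qed
  finally have fr: "form s r r = \<omega> * (LINT x|MI. (r x)\<^sup>2) - (LINT x|MI. (f x)\<^sup>2 * (f x * r x))" by simp
  have "- (pi * a ^ 4 / 4) \<le> (LINT x|MI. (f x)\<^sup>2 * (f x * r x))"
  proof -
    have "(LINT x|MI. - (a ^ 4 / 4)) \<le> (LINT x|MI. (f x)\<^sup>2 * (f x * r x))"
    proof (rule integral_mono)
      show "integrable MI (\<lambda>x. (f x)\<^sup>2 * (f x * r x))"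
        by (intro sqint_prod L4_sq L4_mult energy_spaceD(1)[OF E] energy_spaceD(1)[OF rE])
      show "- (a ^ 4 / 4) \<le> (f x)\<^sup>2 * (f x * r x)" for x
      proof -
        have "\<bar>sin x\<bar> ^ 4 \<le> 1" by (rule power_le_one) auto
        then have "a ^ 4 * (sin x) ^ 4 \<le> a ^ 4 * 1" by (intro mult_left_mono) auto
        then have "- (a ^ 4 / 4) \<le> - ((a * sin x) ^ 4 / 4)" by (simp add: power_mult_distrib)
        also have "\<dots> \<le> f x ^ 4 - f x ^ 3 * (a * sin x)" by (rule quartic_AMGM)
        also have "\<dots> = (f x)\<^sup>2 * (f x * r x)"
          by (simp add: r_def power2_eq_square power3_eq_cube power4_eq_xxxx algebra_simps)
        finally show ?thesis .
      qed
    qed simp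
    then show ?thesis by simp
  qed
  with fr show "(2 powr (2 * s) - \<omega>) * (LINT x|MI. (r x)\<^sup>2) \<le> pi * a ^ 4 / 4"
    using ge by (simp add: algebra_simps)
qed

text \<open>Testing the difference of the equations with \<open>w = f - g\<close> and with \<open>sin\<close>: since the nonlinearity is
  defocusing, \<open>Q = \<integral> (f\<^sup>2 + f g + g\<^sup>2) w\<^sup>2\<close> appears on the good side of the first identity, and the
  second one bounds \<open>\<bar>\<omega> - \<nu>\<bar>\<close> by \<open>4 * sqrt Q\<close>.\<close>

theorem weak_solution_unique:
  assumes s: "0 < s" and e: "0 < e" "1 + 2 * e \<le> 2 powr (2 * s)"
    and a: "0 < a" "a\<^sup>2 \<le> e / 4"
    and f: "weak_solution s \<omega> f" "oddper f" "scf f 1 = a" "\<bar>\<omega> - 1\<bar> < e"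
    and g: "weak_solution s \<nu> g" "oddper g" "scf g 1 = a" "\<bar>\<nu> - 1\<bar> < e"
  shows "\<omega> = \<nu>" "AE x in MI. f x = g x"
proof -
  define w where "w = (\<lambda>x. f x - g x)"
  define P where "P = (\<lambda>x. (f x)\<^sup>2 + f x * g x + (g x)\<^sup>2)"
  define W where "W = (LINT x|MI. (w x)\<^sup>2)"
  define Q where "Q = (LINT x|MI. P x * (w x)\<^sup>2)"
  have E: "energy_space s f" "energy_space s g" using f g by (auto simp: weak_solution_def)
  have wE: "energy_space s w" and wo: "oddper w" unfolding w_def using E f g by (auto intro: energy_space_diff oddper_diff)
  have P0: "0 \<le> P x" for x unfolding P_def by (rule sum_products_nonneg)
  have Q0: "0 \<le> Q" unfolding Q_def using P0 by (auto intro!: Bochner_Integration.integral_nonneg)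
  have W0: "0 \<le> W" unfolding W_def by (auto intro!: Bochner_Integration.integral_nonneg)
  have d: "integrable MI (\<lambda>x. P x * (w x)\<^sup>2)"
    "form s w w = \<omega> * W + (\<omega> - \<nu>) * (LINT x|MI. g x * w x) - Q"
    using weak_solution_diff[OF f(1,2) g(1,2)] by (simp_all add: w_def P_def W_def Q_def)
  have w1: "scf w 1 = 0"
    unfolding w_def using scf_diff[OF energy_spaceD(3)[OF E(1)] energy_spaceD(3)[OF E(2)], of 1] f g by simp
  then have ws: "(LINT x|MI. w x * sin x) = 0" by (simp add: scf_def)
  \<comment> \<open>Since 1 + 2 e \<le> 2^(2s) and |\<mu> - 1| < e, the gap 2^(2s) - \<mu> is at
    least \<open>e\<close>.\<close>
  have remainder: "(LINT x|MI. (h x - a * sin x)\<^sup>2) \<le> a ^ 4 / e" "(LINT x|MI. (h x)\<^sup>2) \<le> 4 * pi * a\<^sup>2"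
    if h: "weak_solution s \<mu> h" "oddper h" "scf h 1 = a" "\<bar>\<mu> - 1\<bar> < e" for h \<mu>
  proof -
    define R where "R = (LINT x|MI. (h x - a * sin x)\<^sup>2)"
    note r = weak_solution_remainder[OF s h(1,2,3), folded R_def]
    have R0: "0 \<le> R" unfolding R_def by (auto intro!: Bochner_Integration.integral_nonneg)
    have "e * R \<le> (2 powr (2 * s) - \<mu>) * R" using e h(4) R0 by (intro mult_right_mono) auto
    also have "\<dots> \<le> pi * a ^ 4 / 4" by (rule r(3))
    also have "\<dots> \<le> a ^ 4" using pi_less_4 mult_right_mono[of pi 4 "a ^ 4"] by simp
    finally have R: "R \<le> a ^ 4 / e" using e by (simp add: field_simps)
    then show "(LINT x|MI. (h x - a * sin x)\<^sup>2) \<le> a ^ 4 / e" by (simp add: R_def)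
    have hE: "energy_space s h" using h by (simp add: weak_solution_def)
    have "(LINT x|MI. (h x)\<^sup>2) \<le> (LINT x|MI. 2 * (h x - a * sin x)\<^sup>2 + 2 * a\<^sup>2)"
    proof (rule integral_mono)
      show "integrable MI (\<lambda>x. 2 * (h x - a * sin x)\<^sup>2 + 2 * a\<^sup>2)"
        using sqintD(2)[OF energy_spaceD(2)[OF r(1)]] by simp
      show "(h x)\<^sup>2 \<le> 2 * (h x - a * sin x)\<^sup>2 + 2 * a\<^sup>2" for x
      proof -
        have "0 \<le> (h x - 2 * (a * sin x))\<^sup>2" by simp
        then have "(h x)\<^sup>2 \<le> 2 * (h x - a * sin x)\<^sup>2 + 2 * (a * sin x)\<^sup>2"
          by (simp add: power2_eq_square algebra_simps)
        moreover have "(a * sin x)\<^sup>2 \<le> a\<^sup>2" 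
          using mult_left_mono[OF abs_square_le_1[THEN iffD2, OF abs_sin_le_one[of x]], of "a\<^sup>2"]
          by (simp add: power_mult_distrib)
        ultimately show ?thesis by linarith
      qed
    qed (use sqintD(2)[OF energy_spaceD(2)[OF hE]] in simp)
    also have "\<dots> = 2 * R + 2 * pi * a\<^sup>2"
      using sqintD(2)[OF energy_spaceD(2)[OF r(1)]] by (simp add: R_def)
    also have "2 * R \<le> 2 * pi * a\<^sup>2"
    proof -
      have "a ^ 4 / e = a\<^sup>2 * (a\<^sup>2 / e)" by (simp add: power2_eq_square power4_eq_xxxx)
      also have "\<dots> \<le> a\<^sup>2 * pi"
      proof (rule mult_left_mono)
        have "a\<^sup>2 \<le> 2 * e" using a e by simp
        also have "\<dots> \<le> pi * e" using e pi_ge_two by (intro mult_right_mono) auto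
        finally show "a\<^sup>2 / e \<le> pi" using e by (simp add: divide_le_eq)
      qed simp
      finally show ?thesis using R by (simp add: mult.commute)
    qed
    finally show "(LINT x|MI. (h x)\<^sup>2) \<le> 4 * pi * a\<^sup>2" by simp
  qed
  define R where "R = (LINT x|MI. (g x - a * sin x)\<^sup>2)"
  have R: "R \<le> a ^ 4 / e" unfolding R_def by (rule remainder(1)[OF g])
  have rE: "energy_space s (\<lambda>x. g x - a * sin x)" by (rule weak_solution_remainder(1)[OF s g(1,2,3)])
  have ge: "2 powr (2 * s) * W \<le> form s w w"
  proof -
    have "scf w n = 0" if "n < 2" for n using that w1 by (cases n) (auto simp: less_Suc_eq numeral_2_eq_2)
    then show ?thesis using form_ge[OF wE, of 2] s by (simp add: W_def)
  qed
  \<comment> \<open>\<open>w\<close> is orthogonal to sin, so only the remainder of \<open>g\<close>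
    survives in the pairing with \<open>w\<close>, and its norm is of order a^2. This is the
    smallness that closes the estimate.\<close>
  define G where "G = (LINT x|MI. (g x - a * sin x) * w x)"
  have gw: "(LINT x|MI. g x * w x) = G"
  proof -
    have "(LINT x|MI. g x * w x) = (LINT x|MI. (g x - a * sin x) * w x + a * (w x * sin x))"
      by (intro Bochner_Integration.integral_cong refl) (simp add: algebra_simps)
    also have "\<dots> = G"
      using sqint_prod[OF energy_spaceD(2)[OF rE] energy_spaceD(2)[OF wE]] integrable_MI_sin[OF energy_spaceD(3)[OF wE], of 1] ws
      by (simp add: G_def)
    finally show ?thesis .
  qed
  have "e * W + Q \<le> (2 powr (2 * s) - \<omega>) * W + Q"
    using e f(4) W0 by (intro add_right_mono mult_right_mono) auto
  also have "\<dots> \<le> (\<omega> - \<nu>) * G"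
    using ge d(2) unfolding gw by (simp add: algebra_simps)
  finally have main: "e * W + Q \<le> (\<omega> - \<nu>) * G" .
  have G: "G\<^sup>2 \<le> R * W"
    unfolding G_def R_def W_def by (rule CS_MI[OF energy_spaceD(2)[OF rE] energy_spaceD(2)[OF wE]])
  \<comment> \<open>The integral of (f^3 - g^3) sin x, with \<open>P\<close> split evenly so that
    Cauchy-Schwarz produces \<open>Q\<close> as a factor.\<close>
  define S where "S = (LINT x|MI. sqrt (P x) * w x * (sqrt (P x) * sin x))"
  have Pm: "P \<in> borel_measurable borel" unfolding P_def using energy_spaceD(5)[OF E(1)] energy_spaceD(5)[OF E(2)] by measurable
  have Pi: "integrable MI P" unfolding P_def
    using sqintD(2)[OF energy_spaceD(2)[OF E(1)]] sqintD(2)[OF energy_spaceD(2)[OF E(2)]] sqint_prod[OF energy_spaceD(2)[OF E(1)] energy_spaceD(2)[OF E(2)]]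
    by simp
  have q1: "sqint (\<lambda>x. sqrt (P x) * w x)"
    using d(1) P0 Pm energy_spaceD(5)[OF wE] by (simp add: sqint_def power_mult_distrib)
  have "integrable MI (\<lambda>x. P x * (sin x)\<^sup>2)"
    by (rule integrable_MI_times_bounded[OF Pi, where B=1]) (auto simp: abs_square_le_1)
  then have q2: "sqint (\<lambda>x. sqrt (P x) * sin x)"
    using P0 Pm by (simp add: sqint_def power_mult_distrib)
  have S: "S = (\<omega> - \<nu>) * (pi / 2 * a)"
  proof -
    have sn: "energy_space s sin" "oddper sin" using energy_space_sin[of s 1] oddper_sin[of 1] by auto
    have t: "pi / 2 * a = \<mu> * (pi / 2 * a) - (LINT x|MI. (h x)\<^sup>2 * (h x * sin x))"
      "integrable MI (\<lambda>x. (h x)\<^sup>2 * (h x * sin x))"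
      if h: "weak_solution s \<mu> h" "scf h 1 = a" for h \<mu>
    proof -
      have hE: "energy_space s h" using h by (simp add: weak_solution_def)
      have "form s h sin = pi / 2 * a" using form_sin[of s h 1] h by simp
      moreover have "(LINT x|MI. h x * sin x) = pi / 2 * a" using h by (simp add: scf_def field_simps)
      ultimately show "pi / 2 * a = \<mu> * (pi / 2 * a) - (LINT x|MI. (h x)\<^sup>2 * (h x * sin x))"
        using weak_solution_test[OF h(1) sn] by simp
      show "integrable MI (\<lambda>x. (h x)\<^sup>2 * (h x * sin x))"
        by (intro sqint_prod L4_sq L4_mult energy_spaceD(1)[OF hE] energy_spaceD(1)[OF sn(1)])
    qed
    have "S = (LINT x|MI. (f x)\<^sup>2 * (f x * sin x) - (g x)\<^sup>2 * (g x * sin x))"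
      unfolding S_def
    proof (intro Bochner_Integration.integral_cong refl)
      fix x
      have "sqrt (P x) * w x * (sqrt (P x) * sin x) = (sqrt (P x))\<^sup>2 * w x * sin x"
        by (simp add: power2_eq_square)
      also have "\<dots> = P x * w x * sin x" using P0[of x] by simp
      also have "\<dots> = (f x)\<^sup>2 * (f x * sin x) - (g x)\<^sup>2 * (g x * sin x)"
        by (simp add: P_def w_def power2_eq_square algebra_simps)
      finally show "sqrt (P x) * w x * (sqrt (P x) * sin x) = (f x)\<^sup>2 * (f x * sin x) - (g x)\<^sup>2 * (g x * sin x)" .
    qed
    also have "\<dots> = (LINT x|MI. (f x)\<^sup>2 * (f x * sin x)) - (LINT x|MI. (g x)\<^sup>2 * (g x * sin x))"
      using t(2)[OF f(1,3)] t(2)[OF g(1,3)] by simp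
    also have "\<dots> = (\<omega> - \<nu>) * (pi / 2 * a)"
      using t(1)[OF f(1,3)] t(1)[OF g(1,3)] by (simp add: left_diff_distrib)
    finally show ?thesis .
  qed
  have "S\<^sup>2 \<le> Q * (12 * pi * a\<^sup>2)"
  proof -
    have "S\<^sup>2 \<le> (LINT x|MI. (sqrt (P x) * w x)\<^sup>2) * (LINT x|MI. (sqrt (P x) * sin x)\<^sup>2)"
      unfolding S_def by (rule CS_MI[OF q1 q2])
    also have "(LINT x|MI. (sqrt (P x) * w x)\<^sup>2) = Q" using P0 by (simp add: Q_def power_mult_distrib)
    also have "(LINT x|MI. (sqrt (P x) * sin x)\<^sup>2) \<le> (LINT x|MI. 3 / 2 * ((f x)\<^sup>2 + (g x)\<^sup>2))"
    proof (rule integral_mono)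
      show "(sqrt (P x) * sin x)\<^sup>2 \<le> 3 / 2 * ((f x)\<^sup>2 + (g x)\<^sup>2)" for x
      proof -
        have "(sqrt (P x) * sin x)\<^sup>2 = P x * (sin x)\<^sup>2" using P0[of x] by (simp add: power_mult_distrib)
        also have "\<dots> \<le> P x * 1" using P0[of x] by (intro mult_left_mono) (auto simp: abs_square_le_1)
        also have "\<dots> \<le> 3 / 2 * ((f x)\<^sup>2 + (g x)\<^sup>2)"
        proof -
          have "0 \<le> (f x - g x)\<^sup>2" by simp
          then show ?thesis by (simp add: P_def power2_eq_square algebra_simps)
        qed
        finally show ?thesis .
      qed
    qed (use q2 sqintD(2)[OF energy_spaceD(2)[OF E(1)]] sqintD(2)[OF energy_spaceD(2)[OF E(2)]] in \<open>auto simp: sqint_def\<close>)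
    also have "\<dots> = 3 / 2 * ((LINT x|MI. (f x)\<^sup>2) + (LINT x|MI. (g x)\<^sup>2))"
      using sqintD(2)[OF energy_spaceD(2)[OF E(1)]] sqintD(2)[OF energy_spaceD(2)[OF E(2)]] by simp
    also have "\<dots> \<le> 12 * pi * a\<^sup>2"
      using remainder(2)[OF f] remainder(2)[OF g] by simp
    finally show ?thesis using Q0 by (simp add: mult_left_mono)
  qed
  moreover have "S\<^sup>2 = a\<^sup>2 * ((\<omega> - \<nu>)\<^sup>2 * (pi\<^sup>2 / 4))"
    unfolding S by (simp only: power_mult_distrib power_divide) simp
  moreover have "x * (d * (p\<^sup>2 / 4)) = (x * (p / 4)) * (d * p)" "q * (12 * p * x) = (x * (p / 4)) * (q * 48)"
    for x d p q :: real by (simp_all add: power2_eq_square)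
  ultimately have "(a\<^sup>2 * (pi / 4)) * ((\<omega> - \<nu>)\<^sup>2 * pi) \<le> (a\<^sup>2 * (pi / 4)) * (Q * 48)" by metis
  moreover have "0 < a\<^sup>2 * (pi / 4)" using a by simp
  ultimately have "(\<omega> - \<nu>)\<^sup>2 * pi \<le> Q * 48" by (rule mult_left_le_imp_le)
  moreover have "(\<omega> - \<nu>)\<^sup>2 * 3 \<le> (\<omega> - \<nu>)\<^sup>2 * pi" using pi_gt3 by (intro mult_left_mono) auto
  ultimately have om: "(\<omega> - \<nu>)\<^sup>2 \<le> 16 * Q" by simp
  \<comment> \<open>The constants meet here: (\<omega> - \<nu>)^2 \<le> 16 Q, and a^2 \<le> e / 4
    makes a^4 / e at most e / 16. The outcome (e W + Q)^2 \<le> e W Q forces W = Q = 0.\<close>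
  have "(e * W + Q)\<^sup>2 \<le> ((\<omega> - \<nu>) * G)\<^sup>2"
    using main e W0 Q0 by (intro power_mono) auto
  also have "\<dots> = (\<omega> - \<nu>)\<^sup>2 * G\<^sup>2" by (simp add: power_mult_distrib)
  also have "\<dots> \<le> (16 * Q) * (a ^ 4 / e * W)"
    using om Q0 order_trans[OF G mult_right_mono[OF R W0]] by (intro mult_mono) simp_all
  also have "\<dots> \<le> (16 * Q) * (e / 16 * W)"
  proof -
    have "a ^ 4 = (a\<^sup>2)\<^sup>2" by simp
    also have "\<dots> \<le> (e / 4)\<^sup>2" using a by (intro power_mono) auto
    finally have "a ^ 4 / e \<le> e / 16" using e by (simp add: power2_eq_square field_simps)
    then show ?thesis using W0 Q0 by (intro mult_left_mono mult_right_mono) auto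
  qed
  finally have "(e * W + Q)\<^sup>2 \<le> e * W * Q" by (simp add: mult_ac)
  then have "(e * W)\<^sup>2 + Q\<^sup>2 + e * W * Q \<le> 0" by (simp add: power2_sum mult_ac add_ac)
  moreover have "0 \<le> e * W * Q" using e W0 Q0 by simp
  moreover have "0 \<le> (e * W)\<^sup>2" "0 \<le> Q\<^sup>2" by auto
  ultimately have z: "(e * W)\<^sup>2 = 0" "Q\<^sup>2 = 0" by linarith+
  then have "W = 0" "Q = 0" using e by auto
  with om show "\<omega> = \<nu>" by simp
  have "AE x in MI. (w x)\<^sup>2 = 0"
    using \<open>W = 0\<close> sqintD(2)[OF energy_spaceD(2)[OF wE]] unfolding W_def
    by (subst (asm) integral_nonneg_eq_0_iff_AE) auto
  then show "AE x in MI. f x = g x" by eventually_elim (simp add: w_def)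
qed

section \<open>Odd periodic functions and their sine series\<close>

lemma set_integral_symmetric:
  fixes h :: "real \<Rightarrow> 'b :: {banach, second_countable_topology}"
  assumes [measurable]: "h \<in> borel_measurable borel"
    and i: "set_integrable lborel {0..pi} h" "set_integrable lborel {0..pi} (\<lambda>x. h (- x))"
  shows "set_integrable lborel {-pi..pi} h"
    "(LINT x:{-pi..pi}|lborel. h x) = (LINT x:{0..pi}|lborel. h x) + (LINT x:{0..pi}|lborel. h (- x))"
proof -
  let ?g = "\<lambda>x. indicator {0..pi} x *\<^sub>R h x" and ?r = "\<lambda>x. indicator {0..pi} (- x) *\<^sub>R h x"
  have ae: "AE x in lborel. indicator {-pi..pi} x *\<^sub>R h x = ?g x + ?r x"
    using AE_lborel_singleton[of "0::real"] by eventually_elim (auto simp: indicator_def)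
  have 1: "integrable lborel ?g" using i(1) by (simp add: set_integrable_def)
  have i2: "integrable lborel (\<lambda>x. indicator {0..pi} x *\<^sub>R h (- x))" using i(2) by (simp add: set_integrable_def)
  have 2: "integrable lborel ?r"
    using lborel_integrable_real_affine[OF i2, of "-1" 0] by simp
  have 3: "integral\<^sup>L lborel ?r = (LINT x:{0..pi}|lborel. h (- x))"
    using lborel_integral_real_affine[of "-1" ?r 0] by (simp add: set_lebesgue_integral_def)
  show "set_integrable lborel {-pi..pi} h"
    unfolding set_integrable_def
    by (subst integrable_cong_AE[OF _ _ ae]) (use 1 2 in auto)
  have "(LINT x:{-pi..pi}|lborel. h x) = integral\<^sup>L lborel (\<lambda>x. ?g x + ?r x)"
    unfolding set_lebesgue_integral_def by (rule integral_cong_AE[OF _ _ ae]) auto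
  also have "\<dots> = integral\<^sup>L lborel ?g + integral\<^sup>L lborel ?r"
    using 1 2 by (rule Bochner_Integration.integral_add)
  finally show "(LINT x:{-pi..pi}|lborel. h x) = (LINT x:{0..pi}|lborel. h x) + (LINT x:{0..pi}|lborel. h (- x))"
    unfolding 3 by (simp add: set_lebesgue_integral_def)
qed

lemma oddperD: "oddper f \<Longrightarrow> f (- x) = - f x" "oddper f \<Longrightarrow> periodic_2pi f"
  by (auto simp: oddper_def)

lemma oddper_set_integrable:
  assumes "oddper f" "f \<in> borel_measurable borel" "integrable MI f"
  shows "set_integrable lborel {-pi..pi} f"
proof (rule set_integral_symmetric(1)[OF assms(2)])
  show i: "set_integrable lborel {0..pi} f" using assms(3) integrable_MI[OF assms(2)] by simp
  then show "set_integrable lborel {0..pi} (\<lambda>x. f (- x))"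
    using assms(1) by (simp add: oddperD set_integrable_def)
qed

lemma integrable_MI_of_symmetric:
  fixes f :: "real \<Rightarrow> real"
  assumes "f \<in> borel_measurable borel" "set_integrable lborel {-pi..pi} f"
  shows "integrable MI f"
  using assms set_integrable_subset[OF assms(2), of "{0..pi}"] by (simp add: integrable_MI)

text \<open>Folding the interval at 0 leaves the sine part of the exponential.
  \<open>fourier_coeff\<close> carries the factor 1 / (2 pi) on the whole interval and
  \<open>scf\<close> the factor 2 / pi on half of it, whence - i / 2.\<close>

lemma fourier_coeff_odd:
  assumes f: "oddper f" and [measurable]: "f \<in> borel_measurable borel" and i: "integrable MI f"
  shows "fourier_coeff f k = - (\<i> / 2) * complex_of_real (of_int (sgn k) * scf f (nat \<bar>k\<bar>))"
proof -
  let ?h = "\<lambda>x. complex_of_real (f x) * cis (- (real_of_int k * x))"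
  have si: "set_integrable lborel {0..pi} f" using i by (simp add: integrable_MI)
  have b: "set_integrable lborel {0..pi} (\<lambda>x. complex_of_real (f x) * cis (c * x))" for c
  proof -
    have [measurable]: "(\<lambda>x. cis (c * x)) \<in> borel_measurable borel"
      by (intro borel_measurable_continuous_onI continuous_intros)
    show ?thesis
      unfolding set_integrable_def
    proof (rule Bochner_Integration.integrable_bound)
      show "integrable lborel (\<lambda>x. indicator {0..pi} x *\<^sub>R f x)" using si by (simp add: set_integrable_def)
      show "AE x in lborel. norm (indicator {0..pi} x *\<^sub>R (complex_of_real (f x) * cis (c * x))) \<le> norm (indicator {0..pi} x *\<^sub>R f x)"
        by (rule AE_I2) (simp add: norm_mult)
    qed measurable
  qed
  have m: "?h \<in> borel_measurable borel"
  proof -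
    have [measurable]: "(\<lambda>x. cis (- (real_of_int k * x))) \<in> borel_measurable borel"
      by (intro borel_measurable_continuous_onI continuous_intros)
    show ?thesis by measurable
  qed
  have i1: "set_integrable lborel {0..pi} ?h" using b[of "- real_of_int k"] by simp
  have i2: "set_integrable lborel {0..pi} (\<lambda>x. ?h (- x))"
  proof -
    have "(\<lambda>x. ?h (- x)) = (\<lambda>x. (- 1) * (complex_of_real (f x) * cis (real_of_int k * x)))"
      by (auto simp: oddperD[OF f])
    then show ?thesis using set_integrable_mult_right[OF b[of "real_of_int k"], of "-1"] by (simp only:)
  qed
  have "(LINT x:{-pi..pi}|lborel. ?h x) = (LINT x:{0..pi}|lborel. ?h x) + (LINT x:{0..pi}|lborel. ?h (- x))"
    by (rule set_integral_symmetric(2)[OF m i1 i2])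
  also have "\<dots> = (LINT x:{0..pi}|lborel. ?h x + ?h (- x))"
    by (rule set_integral_add(2)[OF i1 i2, symmetric])
  also have "\<dots> = (LINT x:{0..pi}|lborel. (- 2 * \<i>) * complex_of_real (f x * sin (real_of_int k * x)))"
    by (intro set_lebesgue_integral_cong) (auto simp: oddperD[OF f] complex_eq_iff)
  also have "\<dots> = (- 2 * \<i>) * complex_of_real (LINT x:{0..pi}|lborel. f x * sin (real_of_int k * x))"
    by (simp only: set_integral_mult_right set_integral_complex_of_real)
  also have "(LINT x:{0..pi}|lborel. f x * sin (real_of_int k * x)) = (LINT x|MI. f x * sin (real_of_int k * x))"
    by (simp add: integral_MI)
  also have "\<dots> = pi / 2 * (of_int (sgn k) * scf f (nat \<bar>k\<bar>))"
  proof (cases "k \<ge> 0")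
    case True
    then show ?thesis by (cases "k = 0") (auto simp: scf_def sgn_if)
  next
    case False
    then have "real_of_int k = - real (nat \<bar>k\<bar>)" by simp
    then show ?thesis using False by (simp add: scf_def sgn_if)
  qed
  finally show ?thesis by (simp add: fourier_coeff_def field_simps)
qed

lemma cmod_fourier_coeff_odd:
  assumes f: "oddper f" "f \<in> borel_measurable borel" "integrable MI f"
  shows "(cmod (fourier_coeff f k))\<^sup>2 = (scf f (nat \<bar>k\<bar>))\<^sup>2 / 4"
proof (cases "k = 0")
  case True
  then show ?thesis by (simp add: fourier_coeff_odd[OF f])
next
  case False
  then have "\<bar>sgn k\<bar> = 1" by simp
  then have "\<bar>of_int (sgn k) :: real\<bar> = 1" by (metis of_int_1 of_int_abs)
  then show ?thesis
    unfolding fourier_coeff_odd[OF f] norm_mult norm_of_real abs_mult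
    by (simp add: norm_divide power_divide)
qed

text \<open>The integers are two copies of the natural numbers glued at 0, and
  \<open>F 0 = 0\<close> makes the double count there harmless.\<close>

lemma has_sum_even_int:
  fixes F :: "nat \<Rightarrow> real"
  assumes F: "\<And>n. 0 \<le> F n" "F 0 = 0" and s: "F sums S"
  shows "((\<lambda>k::int. F (nat \<bar>k\<bar>)) has_sum (2 * S)) UNIV"
proof -
  have h: "(F has_sum S) UNIV" by (rule sums_nonneg_imp_has_sum[OF s F(1)])
  have p: "((\<lambda>k::int. F (nat \<bar>k\<bar>)) has_sum S) (range int)"
    using h by (subst has_sum_reindex) (auto simp: o_def)
  have n: "((\<lambda>k::int. F (nat \<bar>k\<bar>)) has_sum S) (range (\<lambda>n. - int n))"
    using h by (subst has_sum_reindex) (auto simp: o_def inj_on_def)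
  have n': "((\<lambda>k::int. F (nat \<bar>k\<bar>)) has_sum S) (range (\<lambda>n. - int n) - {0})"
    using n by (subst has_sum_cong_neutral[where T="range (\<lambda>n. - int n)"]) (auto simp: F(2))
  have "((\<lambda>k::int. F (nat \<bar>k\<bar>)) has_sum (S + S)) (range int \<union> (range (\<lambda>n. - int n) - {0}))"
    by (rule has_sum_Un_disjoint[OF p n']) auto
  also have "range int \<union> (range (\<lambda>n. - int n) - {0}) = UNIV"
  proof -
    have "x \<in> range int \<union> (range (\<lambda>n. - int n) - {0})" for x :: int
    proof (cases "x \<ge> 0")
      case True
      then have "x = int (nat x)" by simp
      then show ?thesis by blast
    next
      case False
      then have "x = - int (nat (- x))" "x \<noteq> 0" by simp_all
      then show ?thesis by blast
    qed
    then show ?thesis by blast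
  qed
  finally show ?thesis by simp
qed

lemma summable_even_int:
  fixes F :: "nat \<Rightarrow> real"
  assumes F: "\<And>n. 0 \<le> F n" "F 0 = 0"
  shows "(\<lambda>k::int. F (nat \<bar>k\<bar>)) summable_on UNIV \<longleftrightarrow> summable F"
proof
  assume "summable F"
  then show "(\<lambda>k::int. F (nat \<bar>k\<bar>)) summable_on UNIV"
    using has_sum_even_int[where F=F, OF F] unfolding summable_def summable_on_def by blast
next
  assume "(\<lambda>k::int. F (nat \<bar>k\<bar>)) summable_on UNIV"
  then have "(\<lambda>k::int. F (nat \<bar>k\<bar>)) summable_on (range int)"
    by (rule summable_on_subset_banach) simp
  then have "F summable_on UNIV"
    by (subst (asm) summable_on_reindex) (auto simp: o_def)
  then show "summable F" by (rule summable_on_imp_summable)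
qed

section \<open>Sobolev spaces and norms in terms of sine coefficients\<close>

lemma oddper_sqintI:
  assumes f: "oddper f" and [measurable]: "f \<in> borel_measurable borel"
  shows "sqint f \<longleftrightarrow> set_integrable lborel {-pi..pi} (\<lambda>x. (f x)\<^sup>2)"
proof
  assume "sqint f"
  then have "set_integrable lborel {0..pi} (\<lambda>x. (f x)\<^sup>2)"
    by (simp add: sqint_def integrable_MI)
  then show "set_integrable lborel {-pi..pi} (\<lambda>x. (f x)\<^sup>2)"
    by (intro set_integral_symmetric(1)) (auto simp: oddperD[OF f])
next
  assume "set_integrable lborel {-pi..pi} (\<lambda>x. (f x)\<^sup>2)"
  then have "integrable MI (\<lambda>x. (f x)\<^sup>2)" by (intro integrable_MI_of_symmetric) auto
  then show "sqint f" by (simp add: sqint_def)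
qed

lemma Hper_odd_iff:
  "f \<in> Hper_odd s \<longleftrightarrow> oddper f \<and> sqint f \<and> summable (\<lambda>n. (1 + (real n)\<^sup>2) powr s * (scf f n)\<^sup>2)"
proof (cases "oddper f \<and> f \<in> borel_measurable borel \<and> sqint f")
  case True
  then have f: "oddper f" "f \<in> borel_measurable borel" "integrable MI f" by (auto intro: sqint_integrable)
  let ?F = "\<lambda>n. (1 + (real n)\<^sup>2) powr s * (scf f n)\<^sup>2 / 4"
  have "(\<lambda>k. (1 + (real_of_int k)\<^sup>2) powr s * (cmod (fourier_coeff f k))\<^sup>2) = (\<lambda>k. ?F (nat \<bar>k\<bar>))"
    by (rule ext) (simp add: cmod_fourier_coeff_odd[OF f])
  moreover have "(\<lambda>k. ?F (nat \<bar>k\<bar>)) summable_on (UNIV :: int set) \<longleftrightarrow> summable ?F"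
    by (rule summable_even_int) auto
  moreover have "summable ?F \<longleftrightarrow> summable (\<lambda>n. (1 + (real n)\<^sup>2) powr s * (scf f n)\<^sup>2)"
    using summable_cmult_iff[of "1 / 4" "\<lambda>n. (1 + (real n)\<^sup>2) powr s * (scf f n)\<^sup>2"] by simp
  ultimately show ?thesis
    using True oddper_sqintI[OF f(1,2)] by (auto simp: Hper_odd_def Hper_def oddper_def)
next
  case False
  moreover have "f \<in> borel_measurable borel" if "sqint f" using that by (rule sqintD)
  ultimately show ?thesis
    using oddper_sqintI[of f] by (auto simp: Hper_odd_def Hper_def oddper_def)
qed

text \<open>Each of \<open>k\<close> and \<open>- k\<close> contributes a quarter of the squared
  sine coefficient, so the factor 2 pi becomes pi.\<close>

lemma Hper_norm_odd:
  assumes f: "oddper f" "f \<in> borel_measurable borel" "integrable MI f"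
    and s: "summable (\<lambda>n. (1 + (real n)\<^sup>2) powr s * (scf f n)\<^sup>2)"
  shows "Hper_norm s f = sqrt (pi * (\<Sum>n. (1 + (real n)\<^sup>2) powr s * (scf f n)\<^sup>2))"
proof -
  let ?F = "\<lambda>n. (1 + (real n)\<^sup>2) powr s * (scf f n)\<^sup>2 / 4"
  have e: "(\<lambda>k. (1 + (real_of_int k)\<^sup>2) powr s * (cmod (fourier_coeff f k))\<^sup>2) = (\<lambda>k. ?F (nat \<bar>k\<bar>))"
    by (rule ext) (simp add: cmod_fourier_coeff_odd[OF f])
  have "((\<lambda>k::int. ?F (nat \<bar>k\<bar>)) has_sum (2 * ((\<Sum>n. (1 + (real n)\<^sup>2) powr s * (scf f n)\<^sup>2) / 4))) UNIV"
    by (rule has_sum_even_int) (use s in \<open>auto intro!: sums_divide summable_sums\<close>)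
  then show ?thesis
    unfolding Hper_norm_def e by (simp add: infsumI)
qed

lemma one_plus_sq_powr_le:
  assumes "s \<ge> 0" "n > 0"
  shows "(1 + (real n)\<^sup>2) powr s \<le> 2 powr s * real n powr (2 * s)"
proof -
  have "1 \<le> (real n)\<^sup>2" using assms by (simp add: one_le_power)
  then have "(1 + (real n)\<^sup>2) powr s \<le> (2 * (real n)\<^sup>2) powr s" using assms by (intro powr_mono2) auto
  also have "\<dots> = 2 powr s * real n powr (2 * s)"
    using assms powr_powr[of "real n" 2 s] by (simp add: powr_mult powr_numeral)
  finally show ?thesis .
qed

lemma powr_le_one_plus_sq_powr:
  assumes "s \<ge> 0"
  shows "real n powr (2 * s) \<le> (1 + (real n)\<^sup>2) powr s"
proof (cases "n = 0")
  case False
  then have "real n powr (2 * s) = ((real n)\<^sup>2) powr s" using powr_powr[of "real n" 2 s] by (simp add: powr_numeral)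
  also have "\<dots> \<le> (1 + (real n)\<^sup>2) powr s" using assms by (intro powr_mono2) auto
  finally show ?thesis .
qed simp

text \<open>There is no zero mode, and 1 + n^2 \<le> 2 n^2 for all others; this gives the factor
  2^s. The remaining 2 is the ratio of pi to the pi / 2 in \<open>form\<close>.\<close>

lemma Hper_odd_of_energy_space:
  assumes s: "0 \<le> s" and f: "energy_space s f" "oddper f"
  shows "f \<in> Hper_odd s" "Hper_norm s f \<le> sqrt (2 powr (s + 1) * form s f f)"
proof -
  have le: "(1 + (real n)\<^sup>2) powr s * (scf f n)\<^sup>2 \<le> 2 powr s * (real n powr (2 * s) * (scf f n)\<^sup>2)" for n
  proof (cases "n = 0")
    case False
    then show ?thesis
      using mult_right_mono[OF one_plus_sq_powr_le[OF s], of n "(scf f n)\<^sup>2"] by (simp add: mult.assoc)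
  qed simp
  have s2: "summable (\<lambda>n. 2 powr s * (real n powr (2 * s) * (scf f n)\<^sup>2))"
    using energy_spaceD(4)[OF f(1)] unfolding fin_form_def by (rule summable_mult)
  have s1: "summable (\<lambda>n. (1 + (real n)\<^sup>2) powr s * (scf f n)\<^sup>2)"
    by (rule summable_comparison_test'[OF s2]) (use le in simp)
  then show "f \<in> Hper_odd s" using f energy_spaceD(2)[OF f(1)] by (simp add: Hper_odd_iff)
  have "(\<Sum>n. (1 + (real n)\<^sup>2) powr s * (scf f n)\<^sup>2) \<le> (\<Sum>n. 2 powr s * (real n powr (2 * s) * (scf f n)\<^sup>2))"
    by (rule suminf_le[OF le s1 s2])
  also have "\<dots> = 2 powr s * (\<Sum>n. real n powr (2 * s) * (scf f n)\<^sup>2)"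
    using energy_spaceD(4)[OF f(1)] unfolding fin_form_def by (rule suminf_mult)
  finally have "pi * (\<Sum>n. (1 + (real n)\<^sup>2) powr s * (scf f n)\<^sup>2)
      \<le> pi * (2 powr s * (\<Sum>n. real n powr (2 * s) * (scf f n)\<^sup>2))" by (intro mult_left_mono) auto
  also have "\<dots> = 2 powr (s + 1) * form s f f"
    by (simp add: form_def powr_add power2_eq_square)
  finally show "Hper_norm s f \<le> sqrt (2 powr (s + 1) * form s f f)"
    using Hper_norm_odd[OF f(2) energy_spaceD(5)[OF f(1)] energy_spaceD(3)[OF f(1)] s1] by simp
qed

lemma sum_sq_le_sq_sum:
  fixes x :: "nat \<Rightarrow> real"
  assumes x: "\<And>n. 0 \<le> x n" and s: "summable x"
  shows "summable (\<lambda>n. (x n)\<^sup>2)" "(\<Sum>n. (x n)\<^sup>2) \<le> (\<Sum>n. x n)\<^sup>2"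
proof -
  have xl: "x n \<le> (\<Sum>n. x n)" for n
    using sum_le_suminf[OF s, of "{n}"] x by simp
  have le: "(x n)\<^sup>2 \<le> (\<Sum>n. x n) * x n" for n
    using mult_right_mono[OF xl[of n] x[of n]] by (simp add: power2_eq_square)
  have s2: "summable (\<lambda>n. (\<Sum>n. x n) * x n)" using s by (rule summable_mult)
  show s1: "summable (\<lambda>n. (x n)\<^sup>2)"
    by (rule summable_comparison_test'[OF s2]) (use le in simp)
  have "(\<Sum>n. (x n)\<^sup>2) \<le> (\<Sum>n. (\<Sum>n. x n) * x n)" by (rule suminf_le[OF le s1 s2])
  also have "\<dots> = (\<Sum>n. x n)\<^sup>2" using suminf_mult[OF s] by (simp add: power2_eq_square)
  finally show "(\<Sum>n. (x n)\<^sup>2) \<le> (\<Sum>n. x n)\<^sup>2" .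
qed

text \<open>l^1 is contained in l^2 with norm 1. Through this the local branch is measured by
  weighted absolute sums, which suit products, and still lands in H^(2s).\<close>

lemma Hper_odd_of_weighted_l1:
  assumes s: "0 \<le> s" and f: "oddper f" "sqint f" and b: "summable (\<lambda>n. real n powr (2 * s) * \<bar>scf f n\<bar>)"
  shows "f \<in> Hper_odd (2 * s)" "Hper_norm (2 * s) f \<le> sqrt pi * 2 powr s * (\<Sum>n. real n powr (2 * s) * \<bar>scf f n\<bar>)"
proof -
  define x where "x n = 2 powr s * (real n powr (2 * s) * \<bar>scf f n\<bar>)" for n
  have x: "0 \<le> x n" for n by (simp add: x_def)
  have sx: "summable x" unfolding x_def using b by (rule summable_mult)
  have le: "(1 + (real n)\<^sup>2) powr (2 * s) * (scf f n)\<^sup>2 \<le> (x n)\<^sup>2" for n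
  proof (cases "n = 0")
    case False
    have "((1 + (real n)\<^sup>2) powr s)\<^sup>2 \<le> (2 powr s * real n powr (2 * s))\<^sup>2"
      using one_plus_sq_powr_le[OF s, of n] False by (intro power_mono) auto
    moreover have "((1 + (real n)\<^sup>2) powr s)\<^sup>2 = (1 + (real n)\<^sup>2) powr (2 * s)"
      by (simp add: power2_eq_square flip: powr_add)
    ultimately have "(1 + (real n)\<^sup>2) powr (2 * s) * (scf f n)\<^sup>2 \<le> (2 powr s * real n powr (2 * s))\<^sup>2 * (scf f n)\<^sup>2"
      by (intro mult_right_mono) auto
    also have "\<dots> = (x n)\<^sup>2" by (simp add: x_def power_mult_distrib)
    finally show ?thesis .
  qed simp
  note q = sum_sq_le_sq_sum[OF x sx]
  have s1: "summable (\<lambda>n. (1 + (real n)\<^sup>2) powr (2 * s) * (scf f n)\<^sup>2)"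
    by (rule summable_comparison_test'[OF q(1)]) (use le in simp)
  then show "f \<in> Hper_odd (2 * s)" using f by (simp add: Hper_odd_iff)
  have "(\<Sum>n. (1 + (real n)\<^sup>2) powr (2 * s) * (scf f n)\<^sup>2) \<le> (\<Sum>n. x n)\<^sup>2"
    using suminf_le[OF le s1 q(1)] q(2) by linarith
  then have "sqrt (pi * (\<Sum>n. (1 + (real n)\<^sup>2) powr (2 * s) * (scf f n)\<^sup>2)) \<le> sqrt (pi * (\<Sum>n. x n)\<^sup>2)"
    by (intro real_sqrt_le_mono mult_left_mono) auto
  also have "\<dots> = sqrt pi * (\<Sum>n. x n)"
    using x sx by (simp add: real_sqrt_mult suminf_nonneg)
  also have "(\<Sum>n. x n) = 2 powr s * (\<Sum>n. real n powr (2 * s) * \<bar>scf f n\<bar>)"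
    unfolding x_def using b by (rule suminf_mult)
  finally show "Hper_norm (2 * s) f \<le> sqrt pi * 2 powr s * (\<Sum>n. real n powr (2 * s) * \<bar>scf f n\<bar>)"
    using Hper_norm_odd[OF f(1) sqintD(1)[OF f(2)] sqint_integrable[OF f(2)] s1] by (simp add: mult.assoc)
qed

text \<open>The equation determines the fractional Laplacian almost everywhere as \<omega> f - f^3,
  so the existential quantifier in \<open>solves\<close> concerns only that function
  \<open>W\<close>. Integrability of the cube is that of \<open>W\<close>, and comparing Fourier
  coefficients gives the system for the sine coefficients.\<close>

lemma solves_odd_iff:
  assumes f: "oddper f" "sqint f"
  shows "solves s \<omega> f \<longleftrightarrow> integrable MI (\<lambda>x. f x ^ 3) \<and>
    (\<forall>n. real n powr (2 * s) * scf f n = \<omega> * scf f n - scf (\<lambda>x. f x ^ 3) n)"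
proof -
  have [measurable]: "f \<in> borel_measurable borel" by (rule sqintD(1)[OF f(2)])
  have f3: "oddper (\<lambda>x. f x ^ 3)" using f by (auto simp: oddper_def periodic_2pi_def)
  have fi: "integrable MI f" by (rule sqint_integrable[OF f(2)])
  define W where "W x = \<omega> * f x - f x ^ 3" for x
  have Wo: "oddper W" unfolding W_def using f f3 by (intro oddper_diff oddper_cmult)
  have Wm [measurable]: "W \<in> borel_measurable borel" unfolding W_def by measurable
  have fS: "set_integrable lborel {-pi..pi} f" by (rule oddper_set_integrable[OF f(1) _ fi]) measurable
  have Wi: "integrable MI W" if "integrable MI (\<lambda>x. f x ^ 3)"
    unfolding W_def using that fi by auto
  have Wc: "scf W n = \<omega> * scf f n - scf (\<lambda>x. f x ^ 3) n" if "integrable MI (\<lambda>x. f x ^ 3)" for n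
    unfolding W_def using that fi by (subst scf_diff) auto
  have coeff: "(\<forall>k. fourier_coeff W k = complex_of_real (\<bar>real_of_int k\<bar> powr (2 * s)) * fourier_coeff f k)
    \<longleftrightarrow> (\<forall>n. real n powr (2 * s) * scf f n = \<omega> * scf f n - scf (\<lambda>x. f x ^ 3) n)" (is "?L \<longleftrightarrow> ?R")
    if i3: "integrable MI (\<lambda>x. f x ^ 3)"
  proof -
    have e: "fourier_coeff W k = complex_of_real (\<bar>real_of_int k\<bar> powr (2 * s)) * fourier_coeff f k
      \<longleftrightarrow> of_int (sgn k) * (\<omega> * scf f (nat \<bar>k\<bar>) - scf (\<lambda>x. f x ^ 3) (nat \<bar>k\<bar>))
        = of_int (sgn k) * (\<bar>real_of_int k\<bar> powr (2 * s) * scf f (nat \<bar>k\<bar>))" (is "?A \<longleftrightarrow> ?B") for k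
    proof -
      have "?A \<longleftrightarrow> - (\<i> / 2) * complex_of_real (of_int (sgn k) * (\<omega> * scf f (nat \<bar>k\<bar>) - scf (\<lambda>x. f x ^ 3) (nat \<bar>k\<bar>)))
        = - (\<i> / 2) * complex_of_real (of_int (sgn k) * (\<bar>real_of_int k\<bar> powr (2 * s) * scf f (nat \<bar>k\<bar>)))"
        unfolding fourier_coeff_odd[OF Wo Wm Wi[OF i3]] fourier_coeff_odd[OF f(1) \<open>f \<in> _\<close> fi] Wc[OF i3]
        by (simp add: mult_ac)
      also have "\<dots> \<longleftrightarrow> ?B" unfolding mult_cancel_left of_real_eq_iff by simp
      finally show ?thesis .
    qed
    show ?thesis unfolding e
    proof
      assume L: "\<forall>k::int. of_int (sgn k) * (\<omega> * scf f (nat \<bar>k\<bar>) - scf (\<lambda>x. f x ^ 3) (nat \<bar>k\<bar>))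
        = of_int (sgn k) * (\<bar>real_of_int k\<bar> powr (2 * s) * scf f (nat \<bar>k\<bar>))"
      show ?R
      proof
        fix n
        show "real n powr (2 * s) * scf f n = \<omega> * scf f n - scf (\<lambda>x. f x ^ 3) n"
          using L[rule_format, of "int n"] by (cases "n = 0") auto
      qed
    next
      assume R: ?R
      have "\<bar>real_of_int k\<bar> = real (nat \<bar>k\<bar>)" for k by simp
      then show "\<forall>k::int. of_int (sgn k) * (\<omega> * scf f (nat \<bar>k\<bar>) - scf (\<lambda>x. f x ^ 3) (nat \<bar>k\<bar>))
        = of_int (sgn k) * (\<bar>real_of_int k\<bar> powr (2 * s) * scf f (nat \<bar>k\<bar>))"
        using R by (simp only: simp_thms)
    qed
  qed
  show ?thesis
  proof
    assume "solves s \<omega> f"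
    then obtain V where V: "set_integrable lborel {-pi..pi} V"
      "\<And>k. fourier_coeff V k = complex_of_real (\<bar>real_of_int k\<bar> powr (2 * s)) * fourier_coeff f k"
      and ae: "AE x in lborel. V x - \<omega> * f x + f x ^ 3 = 0"
      unfolding solves_def frac_laplacian_def by auto
    have ae': "AE x in lborel. W x = V x"
      using ae by eventually_elim (simp add: W_def)
    \<comment> \<open>\<open>V\<close> is known to be measurable only after restriction to
      [-pi, pi]; its comparison with \<open>W\<close> is therefore made under that
      indicator.\<close>
    have Vi: "integrable lborel (\<lambda>x. indicator {-pi..pi} x *\<^sub>R V x)" using V(1) by (simp add: set_integrable_def)
    then have Vm [measurable]: "(\<lambda>x. indicator {-pi..pi} x *\<^sub>R V x) \<in> borel_measurable borel"
      using borel_measurable_integrable by fastforce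
    have "set_integrable lborel {-pi..pi} W"
      unfolding set_integrable_def
    proof (subst integrable_cong_AE)
      show "AE x in lborel. indicator {-pi..pi} x *\<^sub>R W x = indicator {-pi..pi} x *\<^sub>R V x"
        using ae by eventually_elim (simp add: W_def)
    qed (use Vi in auto)
    then have "set_integrable lborel {-pi..pi} (\<lambda>x. \<omega> * f x - W x)"
      using fS by (intro set_integral_diff(1) set_integrable_mult_right) auto
    then have i3: "integrable MI (\<lambda>x. f x ^ 3)"
      by (intro integrable_MI_of_symmetric) (auto simp: W_def)
    have "fourier_coeff W k = fourier_coeff V k" for k
    proof -
      have [measurable]: "(\<lambda>x. cis (- (real_of_int k * x))) \<in> borel_measurable borel"
        by (intro borel_measurable_continuous_onI continuous_intros)
      have "(\<lambda>x. indicator {-pi..pi} x *\<^sub>R (complex_of_real (V x) * cis (- (real_of_int k * x))))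
        = (\<lambda>x. complex_of_real (indicator {-pi..pi} x *\<^sub>R V x) * cis (- (real_of_int k * x)))"
        by (auto simp: indicator_def)
      then have m: "(\<lambda>x. indicator {-pi..pi} x *\<^sub>R (complex_of_real (V x) * cis (- (real_of_int k * x)))) \<in> borel_measurable borel"
        by (simp only:) measurable
      have "(LINT x:{-pi..pi}|lborel. complex_of_real (W x) * cis (- (real_of_int k * x)))
        = (LINT x:{-pi..pi}|lborel. complex_of_real (V x) * cis (- (real_of_int k * x)))"
        unfolding set_lebesgue_integral_def
      proof (rule integral_cong_AE)
        show "AE x in lborel. indicator {-pi..pi} x *\<^sub>R (complex_of_real (W x) * cis (- (real_of_int k * x)))
          = indicator {-pi..pi} x *\<^sub>R (complex_of_real (V x) * cis (- (real_of_int k * x)))"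
          using ae' by eventually_elim simp
      qed (use m in auto)
      then show ?thesis by (simp add: fourier_coeff_def)
    qed
    then show "integrable MI (\<lambda>x. f x ^ 3) \<and> (\<forall>n. real n powr (2 * s) * scf f n = \<omega> * scf f n - scf (\<lambda>x. f x ^ 3) n)"
      using i3 coeff[OF i3] V(2) by simp
  next
    assume R: "integrable MI (\<lambda>x. f x ^ 3) \<and> (\<forall>n. real n powr (2 * s) * scf f n = \<omega> * scf f n - scf (\<lambda>x. f x ^ 3) n)"
    then have "set_integrable lborel {-pi..pi} W" by (intro oddper_set_integrable Wo Wm Wi) auto
    then have "frac_laplacian s f W"
      unfolding frac_laplacian_def using coeff R oddperD(2)[OF Wo] by simp
    then show "solves s \<omega> f"
      unfolding solves_def by (intro exI[of _ W]) (simp add: W_def)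
  qed
qed

lemma periodic_2pi_of_nat: "periodic_2pi f \<Longrightarrow> f (x + 2 * pi * real n) = f x"
proof (induction n)
  case (Suc n)
  have "f (x + 2 * pi * real (Suc n)) = f ((x + 2 * pi * real n) + 2 * pi)"
    by (simp add: algebra_simps)
  then show ?case using Suc by (simp add: periodic_2pi_def)
qed simp

lemma periodic_2pi_of_int: "periodic_2pi f \<Longrightarrow> f (x + 2 * pi * real_of_int k) = f x"
proof (cases "k \<ge> 0")
  case True
  assume "periodic_2pi f"
  from periodic_2pi_of_nat[OF this, of x "nat k"] True show ?thesis by simp
next
  case False
  assume "periodic_2pi f"
  from periodic_2pi_of_nat[OF this, of "x + 2 * pi * real_of_int k" "nat (- k)"] False show ?thesis
    by (simp add: algebra_simps)
qed

text \<open>The exceptional set in [0, pi] is spread by reflection and by countably many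
  translations by multiples of 2 pi, all of which preserve null sets.\<close>

lemma oddper_AE_eq:
  assumes f: "oddper f" "f \<in> borel_measurable borel" and g: "oddper g" "g \<in> borel_measurable borel"
    and ae: "AE x in MI. f x = g x"
  shows "AE x in lborel. f x = g x"
proof -
  define h where "h x = f x - g x" for x
  have ho: "oddper h" unfolding h_def using f g by (intro oddper_diff)
  have [measurable]: "h \<in> borel_measurable borel" unfolding h_def using f g by measurable
  define N where "N = {x. x \<in> {0..pi} \<and> h x \<noteq> 0}"
  have Nm [measurable]: "N \<in> sets borel" unfolding N_def by measurable
  have "AE x in lborel. x \<notin> N" using ae unfolding AE_MI by eventually_elim (auto simp: N_def h_def)
  then have N: "N \<in> null_sets lborel" by (subst (asm) AE_iff_null_sets[symmetric]) auto
  have N': "uminus -` N \<in> null_sets lborel"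
  proof -
    have "emeasure lborel (uminus -` N) = emeasure (distr lborel borel uminus) N"
      by (subst emeasure_distr) auto
    also have "\<dots> = 0" using N by (simp add: lborel_distr_uminus null_sets_def)
    finally show ?thesis using measurable_sets[of uminus borel borel N] by (simp add: null_sets_def)
  qed
  have "(\<Union>k::int. {x. x - 2 * pi * real_of_int k \<in> N}) \<union> (\<Union>k::int. {x. x - 2 * pi * real_of_int k \<in> uminus -` N}) \<in> null_sets lborel"
    by (intro null_sets.Un null_sets_UN null_sets_translation N N')
  moreover have "{x \<in> space lborel. \<not> f x = g x} \<subseteq> (\<Union>k::int. {x. x - 2 * pi * real_of_int k \<in> N}) \<union> (\<Union>k::int. {x. x - 2 * pi * real_of_int k \<in> uminus -` N})"
  proof
    fix x assume "x \<in> {x \<in> space lborel. \<not> f x = g x}"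
    then have hx: "h x \<noteq> 0" by (simp add: h_def)
    \<comment> \<open>The number of periods that moves \<open>x\<close> into [-pi, pi).\<close>
    define k where "k = \<lfloor>(x + pi) / (2 * pi)\<rfloor>"
    define y where "y = x - 2 * pi * real_of_int k"
    have hy: "h y = h x" using periodic_2pi_of_int[OF oddperD(2)[OF ho], of y k] by (simp add: y_def)
    have "real_of_int k \<le> (x + pi) / (2 * pi)" "(x + pi) / (2 * pi) < real_of_int k + 1"
      unfolding k_def by linarith+
    then have "real_of_int k * (2 * pi) \<le> x + pi" "x + pi < (real_of_int k + 1) * (2 * pi)"
      by (simp_all add: pos_le_divide_eq pos_divide_less_eq)
    then have y: "- pi \<le> y" "y \<le> pi" unfolding y_def by (simp_all add: algebra_simps)
    show "x \<in> (\<Union>k::int. {x. x - 2 * pi * real_of_int k \<in> N}) \<union> (\<Union>k::int. {x. x - 2 * pi * real_of_int k \<in> uminus -` N})"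
    proof (cases "y \<ge> 0")
      case True
      then have "y \<in> N" using y hy hx by (simp add: N_def)
      then show ?thesis unfolding y_def by blast
    next
      case False
      then have "- y \<in> N" using y hy hx by (simp add: N_def oddperD(1)[OF ho])
      then show ?thesis unfolding y_def by blast
    qed
  qed
  ultimately show ?thesis by (rule AE_I')
qed

lemma sin_coeff1_odd:
  assumes f: "oddper f" and [measurable]: "f \<in> borel_measurable borel" and i: "integrable MI f"
  shows "sin_coeff1 f = scf f 1"
proof -
  have si: "set_integrable lborel {0..pi} (\<lambda>x. f x * sin x)"
    using integrable_MI_sin[OF i, of 1] by (subst integrable_MI[symmetric]) auto
  have "(LINT x:{-pi..pi}|lborel. f x * sin x) = (LINT x:{0..pi}|lborel. f x * sin x) + (LINT x:{0..pi}|lborel. f (- x) * sin (- x))"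
    by (rule set_integral_symmetric(2)) (use si in \<open>auto simp: oddperD[OF f]\<close>)
  then show ?thesis by (simp add: sin_coeff1_def scf_def oddperD[OF f] integral_MI)
qed

text \<open>The equation gives the coefficients of the cube as (\<omega> - n^(2s)) b_n, square
  summable for \<open>f\<close> in H^(2s). Hence f^3 is in L^2 and f^4 = f f^3 is integrable for
  every \<open>s\<close>, whereas an embedding of H^(2s) into L^4 fails for small
  \<open>s\<close>.\<close>

lemma Hper_odd_solves_weak:
  assumes s: "0 < s" and f: "f \<in> Hper_odd (2 * s)" "solves s \<omega> f"
  shows "weak_solution s \<omega> f" "oddper f"
proof -
  have o: "oddper f" and sq: "sqint f" and sm: "summable (\<lambda>n. (1 + (real n)\<^sup>2) powr (2 * s) * (scf f n)\<^sup>2)"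
    using f by (auto simp: Hper_odd_iff)
  show "oddper f" by (rule o)
  have [measurable]: "f \<in> borel_measurable borel" using sq by (rule sqintD)
  let ?c = "\<lambda>x. f x ^ 3"
  have i3: "integrable MI ?c" and eq: "real n powr (2 * s) * scf f n = \<omega> * scf f n - scf ?c n" for n
    using f(2) solves_odd_iff[OF o sq] by auto
  have pw: "real n powr (2 * s) \<le> (1 + (real n)\<^sup>2) powr s" for n
    using s by (intro powr_le_one_plus_sq_powr) auto
  have pw2: "(real n powr (2 * s))\<^sup>2 \<le> (1 + (real n)\<^sup>2) powr (2 * s)" for n
  proof -
    have "(real n powr (2 * s))\<^sup>2 \<le> ((1 + (real n)\<^sup>2) powr s)\<^sup>2" using pw[of n] by (intro power_mono) auto
    also have "\<dots> = (1 + (real n)\<^sup>2) powr (2 * s)" by (simp add: power2_eq_square flip: powr_add)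
    finally show ?thesis .
  qed
  have one: "1 \<le> (1 + (real n)\<^sup>2) powr (2 * s)" for n using s by (intro ge_one_powr_ge_zero) auto
  have "summable (\<lambda>n. (scf ?c n)\<^sup>2)"
  proof (rule summable_comparison_test')
    show "summable (\<lambda>n. (2 * \<omega>\<^sup>2 + 2) * ((1 + (real n)\<^sup>2) powr (2 * s) * (scf f n)\<^sup>2))"
      using sm by (rule summable_mult)
    fix n
    have "(scf ?c n)\<^sup>2 = ((\<omega> - real n powr (2 * s)) * scf f n)\<^sup>2"
    proof -
      have "scf ?c n = (\<omega> - real n powr (2 * s)) * scf f n" using eq[of n] by (simp add: algebra_simps)
      then show ?thesis by (simp only:)
    qed
    also have "\<dots> = (\<omega> - real n powr (2 * s))\<^sup>2 * (scf f n)\<^sup>2" by (simp add: power_mult_distrib)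
    also have "\<dots> \<le> ((2 * \<omega>\<^sup>2 + 2) * (1 + (real n)\<^sup>2) powr (2 * s)) * (scf f n)\<^sup>2"
    proof (rule mult_right_mono)
      have "0 \<le> (\<omega> + real n powr (2 * s))\<^sup>2" by simp
      then have "(\<omega> - real n powr (2 * s))\<^sup>2 \<le> 2 * \<omega>\<^sup>2 * 1 + 2 * (real n powr (2 * s))\<^sup>2"
        by (simp add: power2_sum power2_diff)
      also have "\<dots> \<le> 2 * \<omega>\<^sup>2 * (1 + (real n)\<^sup>2) powr (2 * s) + 2 * (1 + (real n)\<^sup>2) powr (2 * s)"
        using one[of n] pw2[of n] by (intro add_mono mult_left_mono) auto
      finally show "(\<omega> - real n powr (2 * s))\<^sup>2 \<le> (2 * \<omega>\<^sup>2 + 2) * (1 + (real n)\<^sup>2) powr (2 * s)"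
        by (simp add: algebra_simps)
    qed simp
    finally show "norm ((scf ?c n)\<^sup>2) \<le> (2 * \<omega>\<^sup>2 + 2) * ((1 + (real n)\<^sup>2) powr (2 * s) * (scf f n)\<^sup>2)"
      by (simp add: mult.assoc)
  qed
  then have c2: "sqint ?c" by (rule Riesz_Fischer(1)[OF i3])
  have L: "L4 f"
    using sqint_prod[OF sq c2] by (simp add: L4_def power4_eq_xxxx power3_eq_cube mult_ac)
  have "fin_form s f"
    unfolding fin_form_def
  proof (rule summable_comparison_test'[OF sm])
    fix n
    have "(1 + (real n)\<^sup>2) powr s \<le> (1 + (real n)\<^sup>2) powr (2 * s)" using s by (intro powr_mono) auto
    then have "real n powr (2 * s) \<le> (1 + (real n)\<^sup>2) powr (2 * s)" using pw[of n] by linarith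
    then show "norm (real n powr (2 * s) * (scf f n)\<^sup>2) \<le> (1 + (real n)\<^sup>2) powr (2 * s) * (scf f n)\<^sup>2"
      by (simp add: mult_right_mono)
  qed
  with L have E: "energy_space s f" by (simp add: energy_space_def)
  show "weak_solution s \<omega> f"
    unfolding weak_solution_def
  proof (intro conjI allI impI E)
    fix \<eta> assume \<eta>: "energy_space s \<eta>" "oddper \<eta>"
    have "(\<lambda>n. \<omega> * (scf f n * scf \<eta> n) - scf ?c n * scf \<eta> n) sums
       (\<omega> * (2 / pi * (LINT x|MI. f x * \<eta> x)) - 2 / pi * (LINT x|MI. ?c x * \<eta> x))"
      by (intro sums_diff sums_mult Parseval_bilinear sq c2 energy_spaceD(2)[OF \<eta>(1)])
    moreover have "(\<lambda>n. \<omega> * (scf f n * scf \<eta> n) - scf ?c n * scf \<eta> n) = (\<lambda>n. real n powr (2 * s) * (scf f n * scf \<eta> n))"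
    proof
      fix n
      have "\<omega> * (scf f n * scf \<eta> n) - scf ?c n * scf \<eta> n = (\<omega> * scf f n - scf ?c n) * scf \<eta> n" by (simp add: left_diff_distrib)
      then show "\<omega> * (scf f n * scf \<eta> n) - scf ?c n * scf \<eta> n = real n powr (2 * s) * (scf f n * scf \<eta> n)"
        by (simp add: eq[symmetric])
    qed
    ultimately have "form s f \<eta> = pi / 2 * (\<omega> * (2 / pi * (LINT x|MI. f x * \<eta> x)) - 2 / pi * (LINT x|MI. ?c x * \<eta> x))"
      by (simp add: form_def sums_iff)
    also have "\<dots> = \<omega> * (LINT x|MI. f x * \<eta> x) - (LINT x|MI. ?c x * \<eta> x)"
      by (simp add: right_diff_distrib)
    finally have 1: "form s f \<eta> = \<omega> * (LINT x|MI. f x * \<eta> x) - (LINT x|MI. ?c x * \<eta> x)" .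
    have "(LINT x|MI. ((f x)\<^sup>2 - \<omega>) * (f x * \<eta> x)) = (LINT x|MI. ?c x * \<eta> x - \<omega> * (f x * \<eta> x))"
      by (intro Bochner_Integration.integral_cong refl) (simp add: power2_eq_square power3_eq_cube algebra_simps)
    also have "\<dots> = (LINT x|MI. ?c x * \<eta> x) - \<omega> * (LINT x|MI. f x * \<eta> x)"
      using sqint_prod[OF c2 energy_spaceD(2)[OF \<eta>(1)]] sqint_prod[OF sq energy_spaceD(2)[OF \<eta>(1)]] by simp
    finally show "form s f \<eta> + (LINT x|MI. ((f x)\<^sup>2 - \<omega>) * (f x * \<eta> x)) = 0" using 1 by simp
  qed
qed

lemma weak_solution_solves:
  assumes f: "weak_solution s \<omega> f" "oddper f"
  shows "solves s \<omega> f"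
proof -
  have E: "energy_space s f" using f by (simp add: weak_solution_def)
  have "integrable MI (\<lambda>x. (f x)\<^sup>2 * f x)" by (intro sqint_prod L4_sq energy_spaceD(1)[OF E] energy_spaceD(2)[OF E])
  then have i3: "integrable MI (\<lambda>x. f x ^ 3)" by (simp add: power2_eq_square power3_eq_cube)
  have "real n powr (2 * s) * scf f n = \<omega> * scf f n - scf (\<lambda>x. f x ^ 3) n" for n
  proof -
    have "pi / 2 * (real n powr (2 * s) * scf f n)
       = \<omega> * (LINT x|MI. f x * sin (real n * x)) - (LINT x|MI. (f x)\<^sup>2 * (f x * sin (real n * x)))"
      using weak_solution_test[OF f(1) energy_space_sin oddper_sin, of n] by (simp add: form_sin)
    also have "(LINT x|MI. (f x)\<^sup>2 * (f x * sin (real n * x))) = (LINT x|MI. f x ^ 3 * sin (real n * x))"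
      by (simp add: power2_eq_square power3_eq_cube mult.assoc)
    finally show ?thesis by (simp add: scf_def field_simps)
  qed
  then show ?thesis using i3 solves_odd_iff[OF f(2) energy_spaceD(2)[OF E]] by blast
qed

section \<open>Power series of the local branch\<close>

text \<open>Equality holds at every point, so that products and Cauchy products of such functions
  can be formed pointwise; \<open>N\<close> is any strict bound on the degree.\<close>

definition sine_poly :: "(real \<Rightarrow> real) \<Rightarrow> bool" where
  "sine_poly f \<longleftrightarrow> (\<exists>N. (\<forall>n\<ge>N. scf f n = 0) \<and> f = sine_sum (scf f) N)"

text \<open>A weighted Wiener norm. For s = 0 it is the l^1 norm of the coefficients, the one that
  is stable under products.\<close>

definition wnorm :: "real \<Rightarrow> (real \<Rightarrow> real) \<Rightarrow> real" where
  "wnorm s f = (\<Sum>n. real n powr (2 * s) * \<bar>scf f n\<bar>)"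

lemma sine_polyI:
  assumes "b 0 = 0" "f = sine_sum b N"
  shows "sine_poly f"
proof -
  have c: "scf f n = (if n < N then b n else 0)" for n
    using assms by (simp add: scf_sine_sum)
  then have "f = sine_sum (scf f) N" by (subst assms(2)) (auto simp: sine_sum_def)
  then show ?thesis unfolding sine_poly_def using c by (intro exI[of _ N]) auto
qed

lemma sine_poly_extend:
  assumes "sine_poly f"
  obtains N where "\<And>M. M \<ge> N \<Longrightarrow> f = sine_sum (scf f) M" "\<And>n. n \<ge> N \<Longrightarrow> scf f n = 0"
proof -
  obtain N where N: "\<forall>n\<ge>N. scf f n = 0" "f = sine_sum (scf f) N"
    using assms unfolding sine_poly_def by blast
  have "f = sine_sum (scf f) M" if "M \<ge> N" for M
  proof
    fix x
    have "sine_sum (scf f) N x = sine_sum (scf f) M x"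
      unfolding sine_sum_def using that N(1) by (intro sum.mono_neutral_left) auto
    then show "f x = sine_sum (scf f) M x" using N(2) by metis
  qed
  then show ?thesis using that N(1) by blast
qed

lemma sine_poly_sqint: "sine_poly f \<Longrightarrow> sqint f"
  unfolding sine_poly_def using sqint_sine_sum by metis

lemma sine_poly_integrable: "sine_poly f \<Longrightarrow> integrable MI f"
  by (intro sqint_integrable sine_poly_sqint)

lemma sine_poly_measurable: "sine_poly f \<Longrightarrow> f \<in> borel_measurable borel"
  by (intro sqintD sine_poly_sqint)

lemma sine_poly_oddper: assumes "sine_poly f" shows "oddper f"
proof -
  obtain N where f: "f = sine_sum (scf f) N" using assms unfolding sine_poly_def by blast
  define b where "b = scf f"
  have "sin (real n * (x + 2 * pi)) = sin (real n * x)" for n x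
    using oddper_sin[of n] by (simp add: oddper_def periodic_2pi_def)
  then have "oddper (sine_sum b N)"
    by (simp add: oddper_def periodic_2pi_def sine_sum_def sum_negf)
  then show ?thesis using f by (simp add: b_def)
qed

lemma sine_poly_wnorm_summable: "sine_poly f \<Longrightarrow> summable (\<lambda>n. real n powr (2 * s) * \<bar>scf f n\<bar>)"
proof -
  assume "sine_poly f"
  then obtain N where "\<And>n. n \<ge> N \<Longrightarrow> scf f n = 0" by (rule sine_poly_extend) auto
  then show ?thesis by (intro summable_finite[of "{..<N}"]) (auto simp: not_less)
qed

lemma wnorm_0: "wnorm 0 f = (\<Sum>n. \<bar>scf f n\<bar>)"
proof -
  have "(\<lambda>n. real n powr (2 * 0) * \<bar>scf f n\<bar>) = (\<lambda>n. \<bar>scf f n\<bar>)"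
  proof
    \<comment> \<open>At n = 0 the weight is \<open>0 powr 0 = 0\<close> rather than 1, but the
      coefficient there is 0 as well.\<close>
    show "real n powr (2 * 0) * \<bar>scf f n\<bar> = \<bar>scf f n\<bar>" for n by (cases "n = 0") auto
  qed
  then show ?thesis by (simp only: wnorm_def)
qed

lemma sine_poly_l1_summable: "sine_poly f \<Longrightarrow> summable (\<lambda>n. \<bar>scf f n\<bar>)"
proof -
  assume "sine_poly f"
  then obtain N where "\<And>n. n \<ge> N \<Longrightarrow> scf f n = 0" by (rule sine_poly_extend) auto
  then show ?thesis by (intro summable_finite[of "{..<N}"]) (auto simp: not_less)
qed

text \<open>Membership and bound are kept in one predicate, so that one set of closure rules carries
  both through the recursion.\<close>

definition trig_bound :: "(real \<Rightarrow> real) \<Rightarrow> real \<Rightarrow> bool" where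
  "trig_bound f B \<longleftrightarrow> sine_poly f \<and> wnorm 0 f \<le> B"

lemma trig_bound_sine_poly: "trig_bound f B \<Longrightarrow> sine_poly f"
  by (simp add: trig_bound_def)

lemma trig_bound_mono: "trig_bound f A \<Longrightarrow> A \<le> B \<Longrightarrow> trig_bound f B"
  by (simp add: trig_bound_def)

lemma sine_poly_trig_bound: "sine_poly f \<Longrightarrow> trig_bound f (wnorm 0 f)"
  by (simp add: trig_bound_def)

lemma trig_bound_nonneg: "trig_bound f B \<Longrightarrow> 0 \<le> B"
  unfolding trig_bound_def wnorm_0 using suminf_nonneg[OF sine_poly_l1_summable] by force

lemma trig_bound_cmult: assumes "trig_bound f B" shows "trig_bound (\<lambda>x. c * f x) (\<bar>c\<bar> * B)"
proof -
  obtain N where f: "f = sine_sum (scf f) N" using assms unfolding trig_bound_def sine_poly_def by blast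
  have "(\<lambda>x. c * f x) = sine_sum (\<lambda>n. c * scf f n) N"
    by (subst f) (auto simp: sine_sum_def sum_distrib_left mult.assoc)
  then have o: "sine_poly (\<lambda>x. c * f x)" by (intro sine_polyI) auto
  have "wnorm 0 (\<lambda>x. c * f x) = \<bar>c\<bar> * wnorm 0 f"
    unfolding wnorm_0 using suminf_mult[OF sine_poly_l1_summable[OF trig_bound_sine_poly[OF assms]], of "\<bar>c\<bar>"]
    by (simp add: abs_mult)
  also have "\<dots> \<le> \<bar>c\<bar> * B" using assms by (intro mult_left_mono) (auto simp: trig_bound_def)
  finally show ?thesis using o by (simp add: trig_bound_def)
qed

lemma trig_bound_add: assumes f: "trig_bound f A" and g: "trig_bound g B" shows "trig_bound (\<lambda>x. f x + g x) (A + B)"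
proof -
  note i = sine_poly_integrable[OF trig_bound_sine_poly[OF f]] sine_poly_integrable[OF trig_bound_sine_poly[OF g]]
  note sm = sine_poly_l1_summable[OF trig_bound_sine_poly[OF f]] sine_poly_l1_summable[OF trig_bound_sine_poly[OF g]]
  obtain N where N: "\<And>M. M \<ge> N \<Longrightarrow> f = sine_sum (scf f) M" by (rule sine_poly_extend[OF trig_bound_sine_poly[OF f]]) (rule that)
  obtain N' where N': "\<And>M. M \<ge> N' \<Longrightarrow> g = sine_sum (scf g) M" by (rule sine_poly_extend[OF trig_bound_sine_poly[OF g]]) (rule that)
  have "f x + g x = sine_sum (\<lambda>n. scf f n + scf g n) (max N N') x" for x
  proof -
    have "f x = sine_sum (scf f) (max N N') x" by (rule fun_cong[OF N]) simp
    moreover have "g x = sine_sum (scf g) (max N N') x" by (rule fun_cong[OF N']) simp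
    ultimately show ?thesis by (simp add: sine_sum_def distrib_right sum.distrib)
  qed
  then have o: "sine_poly (\<lambda>x. f x + g x)" by (intro sine_polyI[where b="\<lambda>n. scf f n + scf g n"]) auto
  have "wnorm 0 (\<lambda>x. f x + g x) \<le> (\<Sum>n. \<bar>scf f n\<bar> + \<bar>scf g n\<bar>)"
    unfolding wnorm_0
    by (rule suminf_le) (auto simp: scf_add[OF i] intro!: sine_poly_l1_summable[OF o, simplified scf_add[OF i]] summable_add sm)
  also have "\<dots> = wnorm 0 f + wnorm 0 g" unfolding wnorm_0 by (rule suminf_add[OF sm, symmetric])
  finally show ?thesis using f g o by (simp add: trig_bound_def)
qed

lemma trig_bound_zero: "trig_bound (\<lambda>x. 0) 0"
proof -
  have "sine_poly (\<lambda>x. 0)" by (rule sine_polyI[of "\<lambda>_. 0" _ 0]) (auto simp: sine_sum_def)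
  then show ?thesis by (simp add: trig_bound_def wnorm_def scf_def)
qed

lemma trig_bound_sum: "(\<And>i. i \<in> I \<Longrightarrow> trig_bound (f i) (B i)) \<Longrightarrow> trig_bound (\<lambda>x. \<Sum>i\<in>I. f i x) (\<Sum>i\<in>I. B i)"
  by (induction I rule: infinite_finite_induct) (auto simp: trig_bound_zero intro: trig_bound_add)

lemma trig_bound_diff: "trig_bound f A \<Longrightarrow> trig_bound g B \<Longrightarrow> trig_bound (\<lambda>x. f x - g x) (A + B)"
  using trig_bound_add[of f A "\<lambda>x. (-1) * g x" B] trig_bound_cmult[of g B "-1"] by simp

lemma trig_bound_sin_nat: "trig_bound (\<lambda>x. sin (real m * x)) 1"
proof (cases "m = 0")
  case True
  then show ?thesis using trig_bound_mono[OF trig_bound_zero] by simp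
next
  case False
  have "(\<lambda>x. sin (real m * x)) = sine_sum (\<lambda>n. if n = m then 1 else 0) (Suc m)"
    by (auto simp: sine_sum_def if_distrib[of "\<lambda>y. y * _"] cong: if_cong)
  then have o: "sine_poly (\<lambda>x. sin (real m * x))" using False by (intro sine_polyI) auto
  have "wnorm 0 (\<lambda>x. sin (real m * x)) = (\<Sum>n\<in>{m}. \<bar>scf (\<lambda>x. sin (real m * x)) n\<bar>)"
    unfolding wnorm_0 by (rule suminf_finite) (auto simp: scf_sin)
  also have "\<dots> \<le> 1" by (simp add: scf_sin)
  finally show ?thesis using o by (simp add: trig_bound_def)
qed

lemma trig_bound_sin_int: "trig_bound (\<lambda>x. sin (real_of_int m * x)) 1"
proof (cases "m \<ge> 0")
  case True
  then show ?thesis using trig_bound_sin_nat[of "nat m"] by simp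
next
  case False
  then have "real_of_int m * x = - (real (nat (- m)) * x)" for x by simp
  then show ?thesis using trig_bound_cmult[OF trig_bound_sin_nat[of "nat (- m)"], of "-1"] by simp
qed

text \<open>Two sines multiply to cosines, three again to sines; this is why products are treated
  three at a time.\<close>

lemma sin_triple_product:
  "sin a * sin b * sin c =
    (1 / 4) * (((sin (a + b - c) + sin (a - b + c)) + sin (- a + b + c)) - sin ((a::real) + b + c))"
proof -
  have "4 * (sin a * sin b * sin c) = 2 * sin c * cos (a - b) - 2 * sin c * cos (a + b)"
    by (simp add: cos_diff cos_add algebra_simps)
  also have "2 * sin c * cos (a - b) = sin (c + (a - b)) + sin (c - (a - b))"
    by (simp add: sin_add[of c] sin_diff[of c])
  also have "2 * sin c * cos (a + b) = sin (c + (a + b)) + sin (c - (a + b))"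
    by (simp add: sin_add[of c] sin_diff[of c])
  also have "c + (a - b) = a - b + c" by simp
  also have "c - (a - b) = - a + b + c" by simp
  also have "c + (a + b) = a + b + c" by simp
  also have "sin (c - (a + b)) = - sin (a + b - c)" using sin_minus[of "a + b - c"] by (simp add: algebra_simps)
  finally show ?thesis by simp
qed

lemma trig_bound_sin_triple: "trig_bound (\<lambda>x. sin (real i * x) * sin (real j * x) * sin (real k * x)) 1"
proof -
  have e: "(\<lambda>x. sin (real i * x) * sin (real j * x) * sin (real k * x)) = (\<lambda>x. (1 / 4) *
      (((sin (real_of_int (int i + int j - int k) * x) + sin (real_of_int (int i - int j + int k) * x))
       + sin (real_of_int (- int i + int j + int k) * x)) - sin (real_of_int (int i + int j + int k) * x)))"
    by (rule ext, subst sin_triple_product) (simp add: algebra_simps)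
  have "trig_bound (\<lambda>x. (1 / 4) *
      (((sin (real_of_int (int i + int j - int k) * x) + sin (real_of_int (int i - int j + int k) * x))
       + sin (real_of_int (- int i + int j + int k) * x)) - sin (real_of_int (int i + int j + int k) * x)))
       (\<bar>1 / 4\<bar> * (((1 + 1) + 1) + 1))"
    by (intro trig_bound_cmult trig_bound_diff trig_bound_add trig_bound_sin_int)
  then show ?thesis unfolding e by simp
qed

text \<open>The l^1 norm is submultiplicative because a product of three sines is a combination of
  four sines with coefficients 1/4 in modulus, of total weight 1.\<close>

lemma trig_bound_triple:
  assumes f: "trig_bound f A" and g: "trig_bound g B" and h: "trig_bound h C"
  shows "trig_bound (\<lambda>x. f x * (g x * h x)) (A * (B * C))"
proof -
  have *: "\<exists>M. \<forall>N\<ge>M. f = sine_sum (scf f) N \<and> (\<Sum>n<N. \<bar>scf f n\<bar>) = wnorm 0 f" if "trig_bound f A" for f A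
  proof -
    have o: "sine_poly f" using that by (rule trig_bound_sine_poly)
    obtain M where M: "\<And>N. N \<ge> M \<Longrightarrow> f = sine_sum (scf f) N" "\<And>n. n \<ge> M \<Longrightarrow> scf f n = 0"
      by (rule sine_poly_extend[OF o]) (rule that)
    have "(\<Sum>n<N. \<bar>scf f n\<bar>) = wnorm 0 f" if "N \<ge> M" for N
      unfolding wnorm_0 by (rule suminf_finite[symmetric]) (use M(2) that in auto)
    then show ?thesis using M(1) by blast
  qed
  obtain M1 M2 M3 where M: "\<forall>N\<ge>M1. f = sine_sum (scf f) N \<and> (\<Sum>n<N. \<bar>scf f n\<bar>) = wnorm 0 f"
    "\<forall>N\<ge>M2. g = sine_sum (scf g) N \<and> (\<Sum>n<N. \<bar>scf g n\<bar>) = wnorm 0 g"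
    "\<forall>N\<ge>M3. h = sine_sum (scf h) N \<and> (\<Sum>n<N. \<bar>scf h n\<bar>) = wnorm 0 h"
    using *[OF f] *[OF g] *[OF h] by blast
  define N where "N = max M1 (max M2 M3)"
  have N: "f = sine_sum (scf f) N" "g = sine_sum (scf g) N" "h = sine_sum (scf h) N"
    and S: "(\<Sum>n<N. \<bar>scf f n\<bar>) = wnorm 0 f" "(\<Sum>n<N. \<bar>scf g n\<bar>) = wnorm 0 g" "(\<Sum>n<N. \<bar>scf h n\<bar>) = wnorm 0 h"
    using M[rule_format, of N] by (simp_all add: N_def)
  have e: "(\<lambda>x. f x * (g x * h x)) = (\<lambda>x. \<Sum>i<N. \<Sum>j<N. \<Sum>k<N.
      (scf f i * (scf g j * scf h k)) * (sin (real i * x) * sin (real j * x) * sin (real k * x)))"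
  proof
    fix x
    have "f x * (g x * h x) = sine_sum (scf f) N x * (sine_sum (scf g) N x * sine_sum (scf h) N x)"
      by (intro arg_cong2[where f=times] fun_cong[OF N(1)] fun_cong[OF N(2)] fun_cong[OF N(3)])
    also have "\<dots> = (\<Sum>i<N. \<Sum>j<N. \<Sum>k<N.
      (scf f i * (scf g j * scf h k)) * (sin (real i * x) * sin (real j * x) * sin (real k * x)))"
      unfolding sine_sum_def sum_product by (simp add: sum_distrib_left mult_ac)
    finally show "f x * (g x * h x) = \<dots>" .
  qed
  have "trig_bound (\<lambda>x. f x * (g x * h x)) (\<Sum>i<N. \<Sum>j<N. \<Sum>k<N. \<bar>scf f i * (scf g j * scf h k)\<bar> * 1)"
    unfolding e by (intro trig_bound_sum trig_bound_cmult trig_bound_sin_triple)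
  also have "(\<Sum>i<N. \<Sum>j<N. \<Sum>k<N. \<bar>scf f i * (scf g j * scf h k)\<bar> * 1) = wnorm 0 f * (wnorm 0 g * wnorm 0 h)"
    unfolding S[symmetric] sum_product by (simp add: abs_mult sum_distrib_left)
  finally show ?thesis
  proof (rule trig_bound_mono)
    show "wnorm 0 f * (wnorm 0 g * wnorm 0 h) \<le> A * (B * C)"
      using f g h trig_bound_nonneg[OF f] trig_bound_nonneg[OF g] trig_bound_nonneg[OF h]
        trig_bound_nonneg[OF sine_poly_trig_bound[OF trig_bound_sine_poly[OF f]]] trig_bound_nonneg[OF sine_poly_trig_bound[OF trig_bound_sine_poly[OF g]]] trig_bound_nonneg[OF sine_poly_trig_bound[OF trig_bound_sine_poly[OF h]]]
      by (intro mult_mono) (auto simp: trig_bound_def)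
  qed
qed

lemma trig_bound_bound: assumes "trig_bound f B" shows "\<bar>f x\<bar> \<le> B"
proof -
  obtain N where N: "\<And>M. M \<ge> N \<Longrightarrow> f = sine_sum (scf f) M" by (rule sine_poly_extend[OF trig_bound_sine_poly[OF assms]]) (rule that)
  have "f x = sine_sum (scf f) N x" by (rule fun_cong[OF N]) simp
  also have "\<bar>\<dots>\<bar> \<le> (\<Sum>n<N. \<bar>scf f n * sin (real n * x)\<bar>)" unfolding sine_sum_def by (rule sum_abs)
  also have "\<dots> \<le> (\<Sum>n<N. \<bar>scf f n\<bar>)" by (rule sum_mono) (simp add: abs_mult mult_left_le)
  also have "\<dots> \<le> wnorm 0 f" unfolding wnorm_0
    by (rule sum_le_suminf) (use sine_poly_l1_summable[OF trig_bound_sine_poly[OF assms]] in auto)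
  also have "\<dots> \<le> B" using assms by (simp add: trig_bound_def)
  finally show ?thesis .
qed

lemma trig_bound_scf: assumes "trig_bound f B" shows "\<bar>scf f n\<bar> \<le> B"
proof -
  have "\<bar>scf f n\<bar> \<le> wnorm 0 f" unfolding wnorm_0
    using sum_le_suminf[OF sine_poly_l1_summable[OF trig_bound_sine_poly[OF assms]], of "{n}"] by simp
  also have "\<dots> \<le> B" using assms by (simp add: trig_bound_def)
  finally show ?thesis .
qed

lemma wnorm_0_le: assumes "sine_poly f" "0 \<le> s" shows "wnorm 0 f \<le> wnorm s f"
  unfolding wnorm_def
proof (rule suminf_le)
  show "real n powr (2 * 0) * \<bar>scf f n\<bar> \<le> real n powr (2 * s) * \<bar>scf f n\<bar>" for n
    using assms(2) by (cases "n = 0") (auto simp: ge_one_powr_ge_zero mult_le_cancel_right1)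
qed (rule sine_poly_wnorm_summable[OF assms(1)])+

section \<open>Cauchy products and the recursion for the coefficients\<close>

definition conv :: "(nat \<Rightarrow> real) \<Rightarrow> (nat \<Rightarrow> real) \<Rightarrow> nat \<Rightarrow> real" where
  "conv a b m = (\<Sum>i\<le>m. a i * b (m - i))"

lemma conv_nonneg: "(\<And>i. 0 \<le> a i) \<Longrightarrow> (\<And>i. 0 \<le> b i) \<Longrightarrow> 0 \<le> conv a b m"
  by (auto simp: conv_def intro!: sum_nonneg)

lemma conv_scale: "conv (\<lambda>i. u ^ i * a i) (\<lambda>i. u ^ i * b i) m = u ^ m * conv a b m"
proof -
  have "u ^ i * a i * (u ^ (m - i) * b (m - i)) = u ^ m * (a i * b (m - i))" if "i \<le> m" for i
  proof -
    have "u ^ m = u ^ i * u ^ (m - i)" using that by (simp flip: power_add)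
    then show ?thesis by simp
  qed
  then show ?thesis unfolding conv_def sum_distrib_left by (intro sum.cong) auto
qed

text \<open>The triangle i + j \<le> M lies in a square. The sums are truncated, so the bound is
  available before convergence is known.\<close>

lemma sum_conv_le:
  assumes "\<And>i. 0 \<le> a i" "\<And>i. 0 \<le> b i"
  shows "(\<Sum>m\<le>M. conv a b m) \<le> (\<Sum>m\<le>M. a m) * (\<Sum>m\<le>M. b m)"
proof -
  have "(\<Sum>m\<le>M. conv a b m) = (\<Sum>(i, j)\<in>{(i, j). i + j \<le> M}. a i * b j)"
    unfolding conv_def by (rule sum.triangle_reindex_eq[symmetric])
  also have "\<dots> \<le> (\<Sum>(i, j)\<in>{..M} \<times> {..M}. a i * b j)"
    using assms by (intro sum_mono2) auto
  also have "\<dots> = (\<Sum>m\<le>M. a m) * (\<Sum>m\<le>M. b m)"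
    by (simp add: sum_product sum.cartesian_product)
  finally show ?thesis .
qed

lemma sums_conv:
  assumes a: "summable (\<lambda>i. \<bar>a i\<bar>)" and b: "summable (\<lambda>i. \<bar>b i\<bar>)"
  shows "conv a b sums (suminf a * suminf b)"
  using Cauchy_product_sums[of a b] a b by (simp add: conv_def[abs_def])

lemma summable_abs_conv:
  assumes a: "summable (\<lambda>i. \<bar>a i\<bar>)" and b: "summable (\<lambda>i. \<bar>b i\<bar>)"
  shows "summable (\<lambda>m. \<bar>conv a b m\<bar>)"
proof (rule summable_comparison_test')
  show "summable (conv (\<lambda>i. \<bar>a i\<bar>) (\<lambda>i. \<bar>b i\<bar>))"
    using sums_conv[of "\<lambda>i. \<bar>a i\<bar>" "\<lambda>i. \<bar>b i\<bar>"] a b by (auto simp: sums_iff)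
  show "norm \<bar>conv a b m\<bar> \<le> conv (\<lambda>i. \<bar>a i\<bar>) (\<lambda>i. \<bar>b i\<bar>) m" for m
    using sum_abs[of "\<lambda>i. a i * b (m - i)" "{..m}"] by (simp add: conv_def abs_mult)
qed

text \<open>The coefficient of u^m in the cube of the power series with coefficients
  \<open>F i\<close>.\<close>

definition cube :: "(nat \<Rightarrow> real \<Rightarrow> real) \<Rightarrow> nat \<Rightarrow> real \<Rightarrow> real" where
  "cube F m x = conv (\<lambda>i. F i x) (conv (\<lambda>i. F i x) (\<lambda>i. F i x)) m"

lemma trig_bound_cube:
  assumes "\<And>i. i \<le> m \<Longrightarrow> trig_bound (F i) (B i)"
  shows "trig_bound (cube F m) (conv B (conv B B) m)"
proof -
  have "cube F m = (\<lambda>x. \<Sum>i\<le>m. \<Sum>j\<le>m - i. F i x * (F j x * F (m - i - j) x))"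
    by (rule ext) (simp add: cube_def conv_def sum_distrib_left)
  moreover have "trig_bound (\<lambda>x. \<Sum>i\<le>m. \<Sum>j\<le>m - i. F i x * (F j x * F (m - i - j) x))
      (\<Sum>i\<le>m. \<Sum>j\<le>m - i. B i * (B j * B (m - i - j)))"
    using assms by (intro trig_bound_sum trig_bound_triple) auto
  ultimately show ?thesis by (simp add: conv_def sum_distrib_left)
qed

lemma cube_cong:
  assumes "\<And>i. i \<le> m \<Longrightarrow> F i = G i"
  shows "cube F m = cube G m"
  using assms by (auto simp: cube_def conv_def intro!: sum.cong)

text \<open>The inverse of \<open>(-\<Delta>)\<^sup>s - 1\<close> on the orthogonal complement of its kernel.\<close>

definition Linv :: "real \<Rightarrow> (real \<Rightarrow> real) \<Rightarrow> real \<Rightarrow> real" where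
  "Linv s h x = (\<Sum>n. (if n < 2 then 0 else scf h n / (real n powr (2 * s) - 1)) * sin (real n * x))"

text \<open>x / (x - 1) decreases for x > 1, so the worst index is n = 2.\<close>

lemma powr_minus_one:
  assumes "0 < s" "n \<ge> (2::nat)"
  shows "0 < real n powr (2 * s) - 1"
    "real n powr (2 * s) / (real n powr (2 * s) - 1) \<le> 2 powr (2 * s) / (2 powr (2 * s) - 1)"
proof -
  have 1: "1 < (2::real) powr (2 * s)" using assms by simp
  have 2: "2 powr (2 * s) \<le> real n powr (2 * s)" using assms by (intro powr_mono2) auto
  show 3: "0 < real n powr (2 * s) - 1" using 1 2 by linarith
  show "real n powr (2 * s) / (real n powr (2 * s) - 1) \<le> 2 powr (2 * s) / (2 powr (2 * s) - 1)"
    using 1 2 3 by (simp add: field_simps)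
qed

lemma powr_ratio_nonneg: "0 < s \<Longrightarrow> 0 \<le> 2 powr (2 * s) / (2 powr (2 * s) - (1::real))"
  by (rule divide_nonneg_nonneg[OF powr_ge_zero less_imp_le]) simp

text \<open>Division by n^(2s) - 1 gains the full weight n^(2s), uniformly in \<open>n\<close>: an
  l^1 bound becomes a bound in the weighted norm.\<close>

lemma sine_poly_Linv:
  assumes h: "sine_poly h" and s: "0 < s"
  shows "sine_poly (Linv s h)"
    "scf (Linv s h) n = (if n < 2 then 0 else scf h n / (real n powr (2 * s) - 1))"
    "wnorm s (Linv s h) \<le> 2 powr (2 * s) / (2 powr (2 * s) - 1) * wnorm 0 h"
proof -
  define b where "b n = (if n < 2 then 0 else scf h n / (real n powr (2 * s) - 1))" for n
  obtain N where N: "\<And>n. n \<ge> N \<Longrightarrow> scf h n = 0"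
    by (rule sine_poly_extend[OF h]) (rule that)
  have "Linv s h = sine_sum b N"
    unfolding Linv_def[abs_def] sine_sum_def[abs_def] b_def
    by (intro ext suminf_finite) (use N in auto)
  moreover have b0: "b 0 = 0" by (simp add: b_def)
  ultimately show o: "sine_poly (Linv s h)" by (intro sine_polyI)
  have c: "scf (Linv s h) n = b n" for n
    unfolding \<open>Linv s h = sine_sum b N\<close> scf_sine_sum[where b=b, OF b0] using N by (simp add: b_def)
  then show "scf (Linv s h) n = (if n < 2 then 0 else scf h n / (real n powr (2 * s) - 1))"
    by (simp add: b_def)
  let ?K = "2 powr (2 * s) / (2 powr (2 * s) - 1)"
  have K: "0 \<le> ?K" using s by (rule powr_ratio_nonneg)
  have "wnorm s (Linv s h) \<le> (\<Sum>n. ?K * \<bar>scf h n\<bar>)"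
    unfolding wnorm_def
  proof (rule suminf_le)
    show "real n powr (2 * s) * \<bar>scf (Linv s h) n\<bar> \<le> ?K * \<bar>scf h n\<bar>" for n
    proof (cases "n < 2")
      case False
      then have "real n powr (2 * s) * \<bar>scf (Linv s h) n\<bar> = real n powr (2 * s) / (real n powr (2 * s) - 1) * \<bar>scf h n\<bar>"
        using powr_minus_one(1)[OF s, of n] by (simp add: c b_def)
      also have "\<dots> \<le> ?K * \<bar>scf h n\<bar>"
        using False by (intro mult_right_mono powr_minus_one(2)[OF s]) auto
      finally show ?thesis .
    next
      case True
      then have "scf (Linv s h) n = 0" by (simp add: c b_def)
      then show ?thesis using mult_nonneg_nonneg[OF K abs_ge_zero[of "scf h n"]]
        by (simp only: mult_zero_right abs_zero)
    qed
  qed (use sine_poly_wnorm_summable[OF o] sine_poly_l1_summable[OF h] in \<open>auto intro: summable_mult\<close>)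
  also have "\<dots> = ?K * wnorm 0 h"
    unfolding wnorm_0 by (rule suminf_mult[OF sine_poly_l1_summable[OF h]])
  finally show "wnorm s (Linv s h) \<le> ?K * wnorm 0 h" .
qed

text \<open>For a solution \<open>a f\<close> with f the sum of u^m F_m, a^2 = T u and \<omega> = 1
  + a^2 C, the equation divided by \<open>a\<close> reads ((-\<Delta>)^s - 1) f = T u (C f - f^3).
  Solvability requires the coefficients of \<open>C\<close> to be the first sine coefficients of the
  cube; \<open>residual F m\<close> is then the coefficient of u^m in C f - f^3.\<close>

definition residual :: "(nat \<Rightarrow> real \<Rightarrow> real) \<Rightarrow> nat \<Rightarrow> real \<Rightarrow> real" where
  "residual F m x = (\<Sum>i\<le>m. scf (cube F i) 1 * F (m - i) x) - cube F m x"

text \<open>The factor \<open>T\<close> rescales the series variable, so that all u with |u| < 1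
  become admissible once \<open>T\<close> is small.\<close>

definition step :: "real \<Rightarrow> real \<Rightarrow> (nat \<Rightarrow> real \<Rightarrow> real) \<Rightarrow> nat \<Rightarrow> real \<Rightarrow> real" where
  "step s T F m x = T * Linv s (residual F m) x"

lemma step_cong:
  assumes "\<And>i. i \<le> m \<Longrightarrow> F i = G i"
  shows "step s T F m = step s T G m"
proof -
  have "cube F i = cube G i" if "i \<le> m" for i using that assms by (intro cube_cong) auto
  then have "residual F m = residual G m" unfolding residual_def[abs_def] using assms by (intro ext) simp
  then show ?thesis by (simp add: step_def[abs_def])
qed

text \<open>Each term depends on all earlier ones, so the recursion carries the whole sequence.
  Stage \<open>m\<close> is final up to index \<open>m\<close>; its later entries are
  placeholders.\<close>

primrec curve_iter :: "real \<Rightarrow> real \<Rightarrow> nat \<Rightarrow> nat \<Rightarrow> real \<Rightarrow> real" where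
  "curve_iter s T 0 = (\<lambda>_. sin)"
| "curve_iter s T (Suc m) = (curve_iter s T m)(Suc m := step s T (curve_iter s T m) m)"

text \<open>The terms of the expansion of the branch in powers of \<open>a\<^sup>2 / T\<close>, after division by \<open>a\<close>.\<close>

definition curve_term :: "real \<Rightarrow> real \<Rightarrow> nat \<Rightarrow> real \<Rightarrow> real" where
  "curve_term s T m = curve_iter s T m m"

lemma curve_iter_eq: "k \<le> m \<Longrightarrow> curve_iter s T m k = curve_term s T k"
  by (induction m) (auto simp: curve_term_def le_Suc_eq)

lemma curve_term_0: "curve_term s T 0 = sin"
  by (simp add: curve_term_def)

lemma curve_term_Suc: "curve_term s T (Suc m) = step s T (curve_term s T) m"
proof -
  have "curve_term s T (Suc m) = step s T (curve_iter s T m) m" by (simp add: curve_term_def)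
  also have "\<dots> = step s T (curve_term s T) m" by (intro step_cong curve_iter_eq)
  finally show ?thesis .
qed

lemma trig_bound_residual:
  assumes F: "\<And>i. i \<le> m \<Longrightarrow> trig_bound (F i) (B i)" and B: "\<And>i. 0 \<le> B i"
  shows "trig_bound (residual F m) (conv (conv B (conv B B)) B m + conv B (conv B B) m)"
proof -
  have c: "trig_bound (cube F i) (conv B (conv B B) i)" if "i \<le> m" for i
    using that F by (intro trig_bound_cube) auto
  have "trig_bound (\<lambda>x. \<Sum>i\<le>m. scf (cube F i) 1 * F (m - i) x) (\<Sum>i\<le>m. conv B (conv B B) i * B (m - i))"
  proof (rule trig_bound_sum)
    fix i assume i: "i \<in> {..m}"
    have "trig_bound (\<lambda>x. scf (cube F i) 1 * F (m - i) x) (\<bar>scf (cube F i) 1\<bar> * B (m - i))"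
      using i F by (intro trig_bound_cmult) auto
    then show "trig_bound (\<lambda>x. scf (cube F i) 1 * F (m - i) x) (conv B (conv B B) i * B (m - i))"
      using i trig_bound_scf[OF c] B by (elim trig_bound_mono) (auto intro!: mult_right_mono)
  qed
  from trig_bound_diff[OF this c[OF order_refl]] show ?thesis
    by (simp add: residual_def[abs_def] conv_def[of "conv B (conv B B)" B])
qed

text \<open>The fraction bounds \<open>Linv\<close> from l^1 to the weighted norm. The number 24 is
  2^4 + 2^3, the bounds of the two parts of the residual when the partial sums of the norms are at
  most 2.\<close>

locale branch =
  fixes s T :: real
  assumes s: "0 < s" and T: "0 < T" "24 * (T * (2 powr (2 * s) / (2 powr (2 * s) - 1))) \<le> 1"
begin

abbreviation "g \<equiv> curve_term s T"

definition \<beta> :: "nat \<Rightarrow> real" where "\<beta> m = wnorm s (g m)"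

text \<open>Majorant of the norms of the coefficients of the cube, and thereby of
  \<open>c\<close>.\<close>

definition \<gamma> :: "nat \<Rightarrow> real" where "\<gamma> = conv \<beta> (conv \<beta> \<beta>)"

definition c :: "nat \<Rightarrow> real" where "c m = scf (cube g m) 1"

lemma sine_poly_g: "sine_poly (g m)"
proof (induction m rule: less_induct)
  case (less m)
  show ?case
  proof (cases m)
    case 0
    have "sine_poly sin" using trig_bound_sine_poly[OF trig_bound_sin_nat[of 1]] by simp
    then show ?thesis by (simp add: 0 curve_term_0)
  next
    case (Suc k)
    have "sine_poly (residual g k)"
      using less Suc trig_bound_nonneg[OF sine_poly_trig_bound] 
      by (intro trig_bound_sine_poly[OF trig_bound_residual[where B="\<lambda>i. \<bar>wnorm 0 (g i)\<bar>"]]) (auto simp: trig_bound_def)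
    then have "sine_poly (Linv s (residual g k))" using sine_poly_Linv(1) s by blast
    then show ?thesis
      using trig_bound_sine_poly[OF trig_bound_cmult[OF sine_poly_trig_bound], of "Linv s (residual g k)" T] by (simp add: Suc curve_term_Suc step_def[abs_def])
  qed
qed

lemma \<beta>_nonneg: "0 \<le> \<beta> m"
  unfolding \<beta>_def wnorm_def by (intro suminf_nonneg sine_poly_wnorm_summable sine_poly_g) auto

lemma \<gamma>_nonneg: "0 \<le> \<gamma> m"
  unfolding \<gamma>_def by (intro conv_nonneg \<beta>_nonneg)

lemma trig_bound_g: "trig_bound (g m) (\<beta> m)"
  using wnorm_0_le[OF sine_poly_g[of m], of s] s by (simp add: trig_bound_def sine_poly_g \<beta>_def)

lemma trig_bound_cube_g: "trig_bound (cube g m) (\<gamma> m)"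
  unfolding \<gamma>_def by (intro trig_bound_cube trig_bound_g)

lemma sine_poly_residual: "sine_poly (residual g m)"
  by (rule trig_bound_sine_poly[OF trig_bound_residual[OF trig_bound_g \<beta>_nonneg]])

lemma \<beta>_Suc: "\<beta> (Suc m) \<le> T * (2 powr (2 * s) / (2 powr (2 * s) - 1)) * (conv \<gamma> \<beta> m + \<gamma> m)"
proof -
  have "\<beta> (Suc m) = T * wnorm s (Linv s (residual g m))"
  proof -
    have "\<beta> (Suc m) = (\<Sum>n. T * (real n powr (2 * s) * \<bar>scf (Linv s (residual g m)) n\<bar>))"
      using T by (simp add: \<beta>_def wnorm_def curve_term_Suc step_def[abs_def] abs_mult mult_ac)
    also have "\<dots> = T * wnorm s (Linv s (residual g m))"
      unfolding wnorm_def by (intro suminf_mult sine_poly_wnorm_summable sine_poly_Linv(1) sine_poly_residual s)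
    finally show ?thesis .
  qed
  also have "\<dots> \<le> T * (2 powr (2 * s) / (2 powr (2 * s) - 1) * wnorm 0 (residual g m))"
    using T by (intro mult_left_mono sine_poly_Linv(3) sine_poly_residual s) auto
  also have "\<dots> \<le> T * (2 powr (2 * s) / (2 powr (2 * s) - 1) * (conv \<gamma> \<beta> m + \<gamma> m))"
    using T powr_ratio_nonneg[OF s] trig_bound_residual[where m = m and F = g and B = \<beta>, OF trig_bound_g \<beta>_nonneg]
    by (intro mult_left_mono) (auto simp: trig_bound_def \<gamma>_def)
  finally show ?thesis by (simp only: mult.assoc)
qed

lemma sum_\<gamma>_le: "(\<Sum>m\<le>M. \<gamma> m) \<le> (\<Sum>m\<le>M. \<beta> m) ^ 3"
proof -
  have S: "0 \<le> (\<Sum>m\<le>M. \<beta> m)" by (intro sum_nonneg \<beta>_nonneg)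
  have "(\<Sum>m\<le>M. \<gamma> m) \<le> (\<Sum>m\<le>M. \<beta> m) * (\<Sum>m\<le>M. conv \<beta> \<beta> m)"
    unfolding \<gamma>_def by (intro sum_conv_le \<beta>_nonneg conv_nonneg)
  also have "\<dots> \<le> (\<Sum>m\<le>M. \<beta> m) * ((\<Sum>m\<le>M. \<beta> m) * (\<Sum>m\<le>M. \<beta> m))"
    using S by (intro mult_left_mono sum_conv_le \<beta>_nonneg)
  finally show ?thesis by (simp add: power3_eq_cube mult.assoc)
qed

text \<open>If a partial sum is at most 2, the two convolutions sum to at most 2^4 and 2^3. The
  recursion returns \<beta> 0 = 1 plus at most 24 times the small constant of the locale, hence
  again at most 2.\<close>

lemma sum_\<beta>_le: "(\<Sum>m\<le>M. \<beta> m) \<le> 2"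
proof (induction M)
  have "\<beta> 0 = (\<Sum>n\<in>{1::nat}. real n powr (2 * s) * \<bar>scf sin n\<bar>)"
    unfolding \<beta>_def wnorm_def curve_term_0
    by (rule suminf_finite) (use scf_sin[of 1] in auto)
  also have "\<dots> = 1" using scf_sin[of 1 1] by simp
  finally have \<beta>0: "\<beta> 0 = 1" .
  {
    case 0
    then show ?case using \<beta>0 by simp
  next
    case (Suc M)
    let ?S = "\<Sum>m\<le>M. \<beta> m" and ?K = "T * (2 powr (2 * s) / (2 powr (2 * s) - 1))"
    have S: "0 \<le> ?S" by (intro sum_nonneg \<beta>_nonneg)
    have K: "0 \<le> ?K" using T powr_ratio_nonneg[OF s] by (intro mult_nonneg_nonneg) auto
    have S3: "?S ^ 3 \<le> 2 ^ 3" using S Suc by (intro power_mono)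
    have "(\<Sum>m\<le>M. conv \<gamma> \<beta> m) \<le> (\<Sum>m\<le>M. \<gamma> m) * ?S"
      by (intro sum_conv_le \<beta>_nonneg \<gamma>_nonneg)
    also have "\<dots> \<le> 2 ^ 3 * 2"
      using S Suc S3 sum_\<gamma>_le[of M] by (intro mult_mono) auto
    finally have 1: "(\<Sum>m\<le>M. conv \<gamma> \<beta> m) \<le> 16" by simp
    have 2: "(\<Sum>m\<le>M. \<gamma> m) \<le> 8" using sum_\<gamma>_le[of M] S3 by simp
    have "(\<Sum>m\<le>Suc M. \<beta> m) = 1 + (\<Sum>m\<le>M. \<beta> (Suc m))" by (simp add: sum.atMost_Suc_shift \<beta>0 del: sum.atMost_Suc)
    also have "(\<Sum>m\<le>M. \<beta> (Suc m)) \<le> (\<Sum>m\<le>M. ?K * (conv \<gamma> \<beta> m + \<gamma> m))"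
      by (intro sum_mono \<beta>_Suc)
    also have "\<dots> = ?K * ((\<Sum>m\<le>M. conv \<gamma> \<beta> m) + (\<Sum>m\<le>M. \<gamma> m))"
      by (simp only: sum_distrib_left[symmetric] sum.distrib)
    also have "\<dots> \<le> ?K * 24" using 1 2 K by (intro mult_left_mono) auto
    also have "?K * 24 \<le> 1" by (subst mult.commute) (rule T(2))
    finally show ?case by simp
  }
qed

lemma sum_lessThan_le_atMost:
  fixes a :: "nat \<Rightarrow> real"
  shows "(\<And>i. 0 \<le> a i) \<Longrightarrow> (\<Sum>i<n. a i) \<le> (\<Sum>i\<le>n. a i)"
  by (intro sum_mono2) auto

lemma \<beta>_le: "\<beta> m \<le> 2"
  using sum_\<beta>_le[of m] member_le_sum[of m "{..m}" \<beta>] \<beta>_nonneg by fastforce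

lemma summable_\<gamma>: "summable \<gamma>"
proof (rule summableI_nonneg_bounded[OF \<gamma>_nonneg])
  fix n
  have "(\<Sum>i<n. \<gamma> i) \<le> (\<Sum>i\<le>n. \<gamma> i)" by (intro sum_lessThan_le_atMost \<gamma>_nonneg)
  also have "\<dots> \<le> (\<Sum>m\<le>n. \<beta> m) ^ 3" by (rule sum_\<gamma>_le)
  also have "\<dots> \<le> 2 ^ 3" by (intro power_mono sum_\<beta>_le sum_nonneg \<beta>_nonneg)
  finally show "(\<Sum>i<n. \<gamma> i) \<le> 2 ^ 3" .
qed

lemma c_le: "\<bar>c m\<bar> \<le> \<gamma> m"
  unfolding c_def by (rule trig_bound_scf[OF trig_bound_cube_g])

lemma summable_c: "summable (\<lambda>m. \<bar>c m\<bar>)"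
  by (rule summable_comparison_test'[OF summable_\<gamma>]) (use c_le in auto)

lemma scf_g_0: "scf (g 0) n = (if n = 1 then 1 else 0)"
  using scf_sin[of 1 n] by (auto simp: curve_term_0)

lemma scf_residual: "scf (residual g m) n = conv c (\<lambda>j. scf (g j) n) m - scf (cube g m) n"
proof -
  have o: "sine_poly (\<lambda>x. c i * g (m - i) x)" for i by (rule trig_bound_sine_poly[OF trig_bound_cmult[OF trig_bound_g]])
  have i: "integrable MI (\<lambda>x. \<Sum>i\<le>m. c i * g (m - i) x)"
    by (intro Bochner_Integration.integrable_sum sine_poly_integrable o)
  have "scf (residual g m) n = scf (\<lambda>x. \<Sum>i\<le>m. c i * g (m - i) x) n - scf (cube g m) n"
    unfolding residual_def[abs_def] c_def[symmetric]
    by (rule scf_diff[OF i sine_poly_integrable[OF trig_bound_sine_poly[OF trig_bound_cube_g]]])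
  also have "scf (\<lambda>x. \<Sum>i\<le>m. c i * g (m - i) x) n = (\<Sum>i\<le>m. scf (\<lambda>x. c i * g (m - i) x) n)"
    by (rule scf_sum) (rule sine_poly_integrable[OF o])
  finally show ?thesis by (simp add: conv_def)
qed

lemma scf_g_Suc:
  "scf (g (Suc m)) n = (if n < 2 then 0 else
     T * (conv c (\<lambda>j. scf (g j) n) m - scf (cube g m) n) / (real n powr (2 * s) - 1))"
  by (simp add: curve_term_Suc step_def[abs_def] sine_poly_Linv(2)[OF sine_poly_residual s] scf_residual)

end

section \<open>Superpositions of the terms and the equation for the sum\<close>

lemma scf_suminf:
  fixes h :: "nat \<Rightarrow> real \<Rightarrow> real"
  assumes m [measurable]: "\<And>m. h m \<in> borel_measurable borel" and b: "\<And>m x. \<bar>h m x\<bar> \<le> M m" and M: "summable M"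
  shows "(\<lambda>m. scf (h m) n) sums scf (\<lambda>x. \<Sum>m. h m x) n"
proof -
  have i: "integrable MI (\<lambda>x. h m x * sin (real n * x))" for m
    using sqint_integrable[OF sqint_bounded[OF m b]] by (rule integrable_MI_sin)
  have hb: "\<bar>h m x * sin (real n * x)\<bar> \<le> M m" for m x
  proof -
    have "\<bar>h m x\<bar> * \<bar>sin (real n * x)\<bar> \<le> M m * 1"
      using b[of m x] by (intro mult_mono) auto
    then show ?thesis by (simp add: abs_mult)
  qed
  have "(\<lambda>m. LINT x|MI. h m x * sin (real n * x)) sums (LINT x|MI. (\<Sum>m. h m x * sin (real n * x)))"
  proof (rule sums_integral[OF i])
    show "AE x in MI. summable (\<lambda>m. norm (h m x * sin (real n * x)))"
    proof (rule AE_I2)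
      fix x
      show "summable (\<lambda>m. norm (h m x * sin (real n * x)))"
        by (rule summable_comparison_test'[OF M]) (use hb in auto)
    qed
    have i': "(LINT x|MI. norm (h m x * sin (real n * x))) \<le> pi * M m" for m
    proof -
      have "(LINT x|MI. norm (h m x * sin (real n * x))) \<le> (LINT x|MI. M m)"
        using i[of m] hb by (intro integral_mono) auto
      then show ?thesis by simp
    qed
    show "summable (\<lambda>m. LINT x|MI. norm (h m x * sin (real n * x)))"
      by (rule summable_comparison_test'[OF summable_mult[OF M, of pi]]) (use i' in \<open>auto simp: abs_of_nonneg\<close>)
  qed
  moreover have "(\<Sum>m. h m x * sin (real n * x)) = (\<Sum>m. h m x) * sin (real n * x)" for x
  proof -
    have "summable (\<lambda>m. h m x)" by (rule summable_comparison_test'[OF M]) (use b in auto)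
    then show ?thesis by (rule suminf_mult2[symmetric])
  qed
  ultimately have "(\<lambda>m. LINT x|MI. h m x * sin (real n * x)) sums (LINT x|MI. (\<Sum>m. h m x) * sin (real n * x))" by simp
  then show ?thesis unfolding scf_def by (rule sums_mult)
qed

context branch
begin

text \<open>The branch, its parameter derivative, its difference quotients and its Taylor remainders
  are all superpositions of the same functions \<open>g m\<close> with different scalar weights.
  Every estimate thus reduces to the absolute sum of the weights.\<close>

definition syn :: "(nat \<Rightarrow> real) \<Rightarrow> real \<Rightarrow> real" where
  "syn w x = (\<Sum>m. w m * g m x)"

lemma g_bound: "\<bar>g m x\<bar> \<le> 2"
  using trig_bound_bound[OF trig_bound_g, of m x] \<beta>_le[of m] by linarith

lemma g_measurable [measurable]: "g m \<in> borel_measurable borel"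
  by (rule sine_poly_measurable[OF sine_poly_g])

context
  fixes w :: "nat \<Rightarrow> real"
  assumes w: "summable (\<lambda>m. \<bar>w m\<bar>)"
begin

lemma syn_term_bound: "\<bar>w m * g m x\<bar> \<le> 2 * \<bar>w m\<bar>"
  using mult_left_mono[OF g_bound[of m x], of "\<bar>w m\<bar>"] by (simp add: abs_mult)

lemma syn_summable: "summable (\<lambda>m. w m * g m x)"
  by (rule summable_comparison_test'[OF summable_mult[OF w, of 2]]) (use syn_term_bound in auto)

lemma syn_measurable: "syn w \<in> borel_measurable borel"
  unfolding syn_def[abs_def] by measurable

lemma syn_bound: "\<bar>syn w x\<bar> \<le> 2 * (\<Sum>m. \<bar>w m\<bar>)"
proof -
  have s: "summable (\<lambda>m. \<bar>w m * g m x\<bar>)"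
    by (rule summable_comparison_test'[OF summable_mult[OF w, of 2]]) (use syn_term_bound in auto)
  have "\<bar>syn w x\<bar> \<le> (\<Sum>m. \<bar>w m * g m x\<bar>)" unfolding syn_def by (rule summable_rabs[OF s])
  also have "\<dots> \<le> (\<Sum>m. 2 * \<bar>w m\<bar>)"
    by (rule suminf_le[OF syn_term_bound s summable_mult[OF w]])
  also have "\<dots> = 2 * (\<Sum>m. \<bar>w m\<bar>)" by (rule suminf_mult[OF w])
  finally show ?thesis .
qed

lemma syn_sqint: "sqint (syn w)"
  by (rule sqint_bounded[OF syn_measurable syn_bound])

lemma syn_oddper: "oddper (syn w)"
  using sine_poly_oddper[OF sine_poly_g] syn_summable
  by (auto simp: oddper_def periodic_2pi_def syn_def suminf_minus)

lemma scf_syn: "(\<lambda>m. w m * scf (g m) n) sums scf (syn w) n"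
  using scf_suminf[where h="\<lambda>m x. w m * g m x", OF _ syn_term_bound summable_mult[OF w]]
  by (simp add: syn_def[abs_def])

text \<open>The weighted norms of the \<open>g m\<close> are at most 2. Only finitely many modes are
  summed at a time, so the exchange with the series in \<open>m\<close> is one with a finite
  sum.\<close>

lemma syn_weighted:
  "summable (\<lambda>n. real n powr (2 * s) * \<bar>scf (syn w) n\<bar>)"
  "(\<Sum>n. real n powr (2 * s) * \<bar>scf (syn w) n\<bar>) \<le> 2 * (\<Sum>m. \<bar>w m\<bar>)"
proof -
  have wb: "summable (\<lambda>m. \<bar>w m\<bar> * \<beta> m)"
    by (rule summable_comparison_test'[OF summable_mult2[OF w, of 2]])
      (use \<beta>_le \<beta>_nonneg in \<open>auto simp: abs_mult intro!: mult_left_mono\<close>)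
  have fin: "(\<Sum>n<N. real n powr (2 * s) * \<bar>scf (g m) n\<bar>) \<le> \<beta> m" for N m
    unfolding \<beta>_def wnorm_def by (rule sum_le_suminf[OF sine_poly_wnorm_summable[OF sine_poly_g]]) auto
  have *: "(\<Sum>n<N. real n powr (2 * s) * \<bar>scf (syn w) n\<bar>) \<le> 2 * (\<Sum>m. \<bar>w m\<bar>)" for N
  proof -
    have sm: "summable (\<lambda>m. \<bar>w m\<bar> * \<bar>scf (g m) n\<bar>)" for n
    proof (rule summable_comparison_test'[OF summable_mult2[OF w, of 2]])
      fix m
      have "\<bar>scf (g m) n\<bar> \<le> 2" using trig_bound_scf[OF trig_bound_g, of m n] \<beta>_le[of m] by linarith
      then show "norm (\<bar>w m\<bar> * \<bar>scf (g m) n\<bar>) \<le> \<bar>w m\<bar> * 2" by (simp add: mult_left_mono)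
    qed
    have "(\<Sum>n<N. real n powr (2 * s) * \<bar>scf (syn w) n\<bar>)
      \<le> (\<Sum>n<N. \<Sum>m. real n powr (2 * s) * (\<bar>w m\<bar> * \<bar>scf (g m) n\<bar>))"
    proof (rule sum_mono)
      fix n
      have "\<bar>scf (syn w) n\<bar> = \<bar>\<Sum>m. w m * scf (g m) n\<bar>" using scf_syn[of n] by (simp add: sums_iff)
      also have "\<dots> \<le> (\<Sum>m. \<bar>w m * scf (g m) n\<bar>)" by (rule summable_rabs) (use sm[of n] in \<open>simp add: abs_mult\<close>)
      finally have "\<bar>scf (syn w) n\<bar> \<le> (\<Sum>m. \<bar>w m\<bar> * \<bar>scf (g m) n\<bar>)" by (simp add: abs_mult)
      then have "real n powr (2 * s) * \<bar>scf (syn w) n\<bar> \<le> real n powr (2 * s) * (\<Sum>m. \<bar>w m\<bar> * \<bar>scf (g m) n\<bar>)"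
        by (rule mult_left_mono) simp
      also have "\<dots> = (\<Sum>m. real n powr (2 * s) * (\<bar>w m\<bar> * \<bar>scf (g m) n\<bar>))"
        by (rule suminf_mult[OF sm, symmetric])
      finally show "real n powr (2 * s) * \<bar>scf (syn w) n\<bar> \<le> (\<Sum>m. real n powr (2 * s) * (\<bar>w m\<bar> * \<bar>scf (g m) n\<bar>))" .
    qed
    also have "\<dots> = (\<Sum>m. \<Sum>n<N. real n powr (2 * s) * (\<bar>w m\<bar> * \<bar>scf (g m) n\<bar>))"
      by (rule suminf_sum[symmetric]) (intro summable_mult sm)
    also have "\<dots> = (\<Sum>m. \<bar>w m\<bar> * (\<Sum>n<N. real n powr (2 * s) * \<bar>scf (g m) n\<bar>))"
      by (simp add: sum_distrib_left mult_ac)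
    also have "\<dots> \<le> (\<Sum>m. \<bar>w m\<bar> * 2)"
    proof (rule suminf_le)
      show le: "\<bar>w m\<bar> * (\<Sum>n<N. real n powr (2 * s) * \<bar>scf (g m) n\<bar>) \<le> \<bar>w m\<bar> * 2" for m
        using fin[of m N] \<beta>_le[of m] by (intro mult_left_mono) auto
      show "summable (\<lambda>m. \<bar>w m\<bar> * (\<Sum>n<N. real n powr (2 * s) * \<bar>scf (g m) n\<bar>))"
        by (rule summable_comparison_test'[OF summable_mult2[OF w, of 2]])
          (use le in \<open>simp add: abs_mult abs_of_nonneg sum_nonneg\<close>)
      show "summable (\<lambda>m. \<bar>w m\<bar> * 2)" by (rule summable_mult2[OF w])
    qed
    also have "\<dots> = 2 * (\<Sum>m. \<bar>w m\<bar>)" using suminf_mult2[OF w, of 2] by simp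
    finally show ?thesis .
  qed
  show 1: "summable (\<lambda>n. real n powr (2 * s) * \<bar>scf (syn w) n\<bar>)"
    by (rule summableI_nonneg_bounded[OF _ *]) simp
  show "(\<Sum>n. real n powr (2 * s) * \<bar>scf (syn w) n\<bar>) \<le> 2 * (\<Sum>m. \<bar>w m\<bar>)"
    by (rule suminf_le_const[OF 1 *])
qed

lemma syn_Hper:
  "syn w \<in> Hper_odd (2 * s)"
  "Hper_norm (2 * s) (syn w) \<le> (sqrt pi * 2 powr s * 2) * (\<Sum>m. \<bar>w m\<bar>)"
proof -
  note h = Hper_odd_of_weighted_l1[OF less_imp_le[OF s] syn_oddper syn_sqint syn_weighted(1)]
  show "syn w \<in> Hper_odd (2 * s)" by (rule h(1))
  have "Hper_norm (2 * s) (syn w) \<le> sqrt pi * 2 powr s * (\<Sum>n. real n powr (2 * s) * \<bar>scf (syn w) n\<bar>)" by (rule h(2))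
  also have "\<dots> \<le> sqrt pi * 2 powr s * (2 * (\<Sum>m. \<bar>w m\<bar>))"
    by (intro mult_left_mono syn_weighted(2)) auto
  finally show "Hper_norm (2 * s) (syn w) \<le> (sqrt pi * 2 powr s * 2) * (\<Sum>m. \<bar>w m\<bar>)" by (simp add: mult_ac)
qed

end

lemma syn_diff:
  assumes "summable (\<lambda>m. \<bar>w m\<bar>)" "summable (\<lambda>m. \<bar>v m\<bar>)"
  shows "syn (\<lambda>m. w m - v m) x = syn w x - syn v x"
  unfolding syn_def using suminf_diff[OF syn_summable[OF assms(1), of x] syn_summable[OF assms(2), of x]]
  by (simp add: left_diff_distrib)

lemma syn_cmult:
  assumes "summable (\<lambda>m. \<bar>w m\<bar>)"
  shows "syn (\<lambda>m. k * w m) x = k * syn w x"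
  unfolding syn_def using suminf_mult[OF syn_summable[OF assms, of x], of k] by (simp add: mult.assoc)

definition C :: "real \<Rightarrow> real" where "C u = (\<Sum>m. c m * u ^ m)"

lemma c_powser_summable: "\<bar>u\<bar> \<le> 1 \<Longrightarrow> summable (\<lambda>m. \<bar>u ^ m * c m\<bar>)"
proof (rule summable_comparison_test'[OF summable_c])
  fix m assume "\<bar>u\<bar> \<le> 1"
  then have "\<bar>u\<bar> ^ m \<le> 1" by (intro power_le_one) auto
  then show "norm \<bar>u ^ m * c m\<bar> \<le> \<bar>c m\<bar>" by (simp add: abs_mult power_abs mult_left_le_one_le)
qed

text \<open>The recursion is multiplied by u^(m+1) and summed over \<open>m\<close>. At n = 1 both
  sides vanish, the left because of its factor, the right because \<open>C u\<close> is the first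
  coefficient of the cube.\<close>

lemma curve_equation:
  assumes u: "0 \<le> u" "u < 1"
  defines "f \<equiv> syn (\<lambda>m. u ^ m)"
  shows "scf f 1 = 1"
    "(real n powr (2 * s) - 1) * scf f n = u * T * (C u * scf f n - scf (\<lambda>x. f x ^ 3) n)"
proof -
  have su: "summable (\<lambda>m. \<bar>u ^ m\<bar>)" using u by (simp add: power_abs)
  have F: "(\<lambda>m. u ^ m * scf (g m) n) sums scf f n" for n unfolding f_def by (rule scf_syn[OF su])
  have "(\<lambda>m. u ^ m * scf (g m) 1) = (\<lambda>m. if m = 0 then 1 else 0)"
  proof
    show "u ^ m * scf (g m) 1 = (if m = 0 then 1 else 0)" for m
      by (cases m) (auto simp: scf_g_0[simplified] scf_g_Suc curve_term_0 scf_sin[of 1 1, simplified])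
  qed
  then have "(\<lambda>m. u ^ m * scf (g m) 1) sums 1" using sums_single[of 0 "\<lambda>_. 1::real"] by simp
  then show f1: "scf f 1 = 1" using F[of 1] sums_unique2 by blast
  have gs: "summable (\<lambda>m. \<bar>u ^ m * g m x\<bar>)" for x
    by (rule summable_comparison_test'[OF summable_mult[OF su, of 2]]) (use syn_term_bound[OF su] in auto)
  have cube_sums: "(\<lambda>m. u ^ m * cube g m x) sums f x ^ 3" for x
  proof -
    let ?a = "\<lambda>m. u ^ m * g m x"
    have "conv ?a (conv ?a ?a) sums (suminf ?a * suminf (conv ?a ?a))"
      by (intro sums_conv summable_abs_conv gs)
    moreover have "suminf (conv ?a ?a) = suminf ?a * suminf ?a"
      using sums_conv[OF gs gs] by (simp add: sums_iff)
    moreover have "conv ?a (conv ?a ?a) = (\<lambda>m. u ^ m * cube g m x)"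
    proof -
      have i: "conv ?a ?a = (\<lambda>m. u ^ m * conv (\<lambda>i. g i x) (\<lambda>i. g i x) m)"
        by (rule ext) (rule conv_scale)
      show ?thesis unfolding i cube_def by (rule ext) (rule conv_scale)
    qed
    ultimately show ?thesis by (simp add: f_def syn_def power3_eq_cube mult.assoc)
  qed
  have um: "\<bar>u ^ m\<bar> \<le> 1" for m using u by (simp add: power_abs power_le_one)
  have G: "(\<lambda>m. u ^ m * scf (cube g m) n) sums scf (\<lambda>x. f x ^ 3) n" for n
  proof -
    have "(\<lambda>m. scf (\<lambda>x. u ^ m * cube g m x) n) sums scf (\<lambda>x. \<Sum>m. u ^ m * cube g m x) n"
    proof (rule scf_suminf[OF _ _ summable_\<gamma>])
      fix m :: nat and x :: real
      have [measurable]: "cube g m \<in> borel_measurable borel" by (rule sine_poly_measurable[OF trig_bound_sine_poly[OF trig_bound_cube_g]])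
      show "(\<lambda>x. u ^ m * cube g m x) \<in> borel_measurable borel" by measurable
      have "\<bar>u ^ m\<bar> * \<bar>cube g m x\<bar> \<le> 1 * \<gamma> m"
        using um trig_bound_bound[OF trig_bound_cube_g, of m x] by (intro mult_mono) auto
      then show "\<bar>u ^ m * cube g m x\<bar> \<le> \<gamma> m" by (simp add: abs_mult)
    qed
    moreover have "(\<Sum>m. u ^ m * cube g m x) = f x ^ 3" for x using cube_sums[of x] by (simp add: sums_iff)
    ultimately show ?thesis by simp
  qed
  have C_sum: "(\<Sum>m. u ^ m * c m) = C u" unfolding C_def by (simp add: mult.commute)
  have sum_c: "summable (\<lambda>m. \<bar>u ^ m * c m\<bar>)" using u by (intro c_powser_summable) auto
  show "(real n powr (2 * s) - 1) * scf f n = u * T * (C u * scf f n - scf (\<lambda>x. f x ^ 3) n)"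
  proof (cases "n < 2")
    case True
    then consider "n = 0" | "n = 1" by linarith
    then show ?thesis
    proof cases
      case 2
      have "(\<lambda>m. u ^ m * scf (cube g m) 1) = (\<lambda>m. u ^ m * c m)" by (simp add: c_def)
      then have "scf (\<lambda>x. f x ^ 3) 1 = C u" using G[of 1] C_sum by (simp add: sums_iff)
      then show ?thesis using f1 2 by simp
    qed simp
  next
    case False
    define A where "A m = u ^ m * scf (g m) n" for m
    have Ab: "summable (\<lambda>m. \<bar>A m\<bar>)"
    proof (rule summable_comparison_test'[OF summable_mult[OF su, of 2]])
      fix m
      have "\<bar>scf (g m) n\<bar> \<le> 2" using trig_bound_scf[OF trig_bound_g, of m n] \<beta>_le[of m] by linarith
      from mult_left_mono[OF this, of "\<bar>u ^ m\<bar>"] show "norm \<bar>A m\<bar> \<le> 2 * \<bar>u ^ m\<bar>"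
        by (simp add: A_def abs_mult)
    qed
    have AF: "suminf A = scf f n" using F[of n] by (simp add: A_def[abs_def] sums_iff)
    \<comment> \<open>For n \<ge> 2 the leading term sin contributes nothing, so the series may be
      shifted by one to match the factor \<open>u\<close> on the right.\<close>
    have A0: "A 0 = 0" using False scf_sin[of 1 n] by (auto simp: A_def curve_term_0)
    have "A sums scf f n" using F[of n] by (simp add: A_def[abs_def])
    then have AS: "(\<lambda>m. A (Suc m)) sums scf f n" using A0 by (simp add: sums_Suc_iff)
    have cA: "(\<lambda>m. conv (\<lambda>m. u ^ m * c m) A m) sums (C u * scf f n)"
      using sums_conv[OF sum_c Ab] by (simp add: C_sum AF)
    have "(\<lambda>m. u * T * (conv (\<lambda>m. u ^ m * c m) A m - u ^ m * scf (cube g m) n)) sums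
       (u * T * (C u * scf f n - scf (\<lambda>x. f x ^ 3) n))"
      by (intro sums_mult sums_diff cA G)
    moreover have "(\<lambda>m. u * T * (conv (\<lambda>m. u ^ m * c m) A m - u ^ m * scf (cube g m) n))
       = (\<lambda>m. (real n powr (2 * s) - 1) * A (Suc m))"
    proof
      fix m
      have "conv (\<lambda>m. u ^ m * c m) A m = u ^ m * conv c (\<lambda>j. scf (g j) n) m"
        unfolding A_def[abs_def] by (rule conv_scale)
      moreover have "real n powr (2 * s) - 1 > 0" using False by (intro powr_minus_one(1) s) auto
      moreover have "u * T * (p * x - p * y) = d * (u * p * (T * (x - y) / d))" if "d > 0" for p x y d :: real
      proof -
        have "d * (u * p * (T * (x - y) / d)) = u * p * (T * (x - y))" using that by simp
        then show ?thesis by (simp add: algebra_simps)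
      qed
      moreover have "A (Suc m) = u * u ^ m * (T * (conv c (\<lambda>j. scf (g j) n) m - scf (cube g m) n) / (real n powr (2 * s) - 1))"
        using False by (simp add: A_def scf_g_Suc)
      ultimately show "u * T * (conv (\<lambda>m. u ^ m * c m) A m - u ^ m * scf (cube g m) n)
          = (real n powr (2 * s) - 1) * A (Suc m)"
        by (simp only:)
    qed
    ultimately have "(\<lambda>m. (real n powr (2 * s) - 1) * A (Suc m)) sums (u * T * (C u * scf f n - scf (\<lambda>x. f x ^ 3) n))"
      by simp
    with sums_mult[OF AS, of "real n powr (2 * s) - 1"] show ?thesis by (rule sums_unique2)
  qed
qed

lemma curve_solves:
  assumes u: "0 \<le> u" "u < 1" and a: "a\<^sup>2 = T * u"
  defines "\<phi> \<equiv> syn (\<lambda>m. a * u ^ m)"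
  shows "\<phi> \<in> Hper_odd (2 * s)" "solves s (1 + a\<^sup>2 * C u) \<phi>" "scf \<phi> 1 = a"
proof -
  define f where "f = syn (\<lambda>m. u ^ m)"
  have su: "summable (\<lambda>m. \<bar>u ^ m\<bar>)" using u by (simp add: power_abs)
  then have sa: "summable (\<lambda>m. \<bar>a * u ^ m\<bar>)" unfolding abs_mult by (rule summable_mult)
  have \<phi>: "\<phi> = (\<lambda>x. a * f x)" unfolding \<phi>_def f_def using syn_cmult[OF su] by auto
  have sq: "sqint \<phi>" and o: "oddper \<phi>" unfolding \<phi>_def using syn_sqint[OF sa] syn_oddper[OF sa] by auto
  show "\<phi> \<in> Hper_odd (2 * s)" unfolding \<phi>_def by (rule syn_Hper(1)[OF sa])
  note e = curve_equation[OF u, folded f_def]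
  show "scf \<phi> 1 = a" using e(1) by (simp add: \<phi>)
  have [measurable]: "\<phi> \<in> borel_measurable borel" using sq by (rule sqintD)
  have "\<bar>\<phi> x ^ 3\<bar> \<le> (2 * (\<Sum>m. \<bar>a * u ^ m\<bar>)) ^ 3" for x
    using syn_bound[OF sa, of x] unfolding \<phi>_def power_abs by (intro power_mono) auto
  then have i3: "integrable MI (\<lambda>x. \<phi> x ^ 3)"
    by (intro sqint_integrable sqint_bounded) measurable
  have "real n powr (2 * s) * scf \<phi> n = (1 + a\<^sup>2 * C u) * scf \<phi> n - scf (\<lambda>x. \<phi> x ^ 3) n" for n
  proof -
    have "scf (\<lambda>x. \<phi> x ^ 3) n = a ^ 3 * scf (\<lambda>x. f x ^ 3) n"
      by (simp add: \<phi> power_mult_distrib)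
    moreover have "(real n powr (2 * s) - 1) * scf f n = a\<^sup>2 * (C u * scf f n - scf (\<lambda>x. f x ^ 3) n)"
      using e(2)[of n] a by (simp add: mult_ac)
    then have "a * ((real n powr (2 * s) - 1) * scf f n) = a * (a\<^sup>2 * (C u * scf f n - scf (\<lambda>x. f x ^ 3) n))" by simp
    ultimately show ?thesis by (simp add: \<phi> power3_eq_cube power2_eq_square algebra_simps)
  qed
  then show "solves s (1 + a\<^sup>2 * C u) \<phi>" using solves_odd_iff[OF o sq] i3 by blast
qed

text \<open>From sin^3 x = 3/4 sin x - 1/4 sin 3x: the first coefficient is the leading correction
  of the frequency, and the third with opposite sign, divided by 3^(2s) - 1, that of the
  profile.\<close>

lemma c_0: "c 0 = 3 / 4"
  and g_1: "g 1 = (\<lambda>x. T * (1 / (4 * (3 powr (2 * s) - 1)) * sin (3 * x)))"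
proof -
  have sin3: "sin x ^ 3 = 3 / 4 * sin x - 1 / 4 * sin (3 * x)" for x :: real
  proof -
    have "sin (3 * x) = sin (2 * x + x)" by (simp add: algebra_simps)
    also have "\<dots> = 2 * sin x * cos x * cos x + (1 - 2 * (sin x)\<^sup>2) * sin x"
      by (simp only: sin_add sin_double cos_double_sin)
    also have "\<dots> = 2 * sin x * (cos x)\<^sup>2 + (1 - 2 * (sin x)\<^sup>2) * sin x" by (simp add: power2_eq_square)
    also have "\<dots> = 3 * sin x - 4 * sin x ^ 3" unfolding cos_squared_eq by (simp add: power2_eq_square power3_eq_cube algebra_simps)
    finally show ?thesis by (simp add: field_simps)
  qed
  have cube0: "cube g 0 = (\<lambda>x. 3 / 4 * sin x - 1 / 4 * sin (3 * x))"
  proof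
    fix x
    have "cube g 0 x = sin x ^ 3" by (simp add: cube_def conv_def curve_term_0 power3_eq_cube)
    then show "cube g 0 x = 3 / 4 * sin x - 1 / 4 * sin (3 * x)" by (simp only: sin3)
  qed
  have i1: "integrable MI sin" and i3: "integrable MI (\<lambda>x. sin (3 * x))"
    using sqint_integrable[OF sqint_sin[of 1]] sqint_integrable[OF sqint_sin[of 3]] by simp_all
  have s1: "scf sin n = (if n = 1 then 1 else 0)" for n using scf_sin[of 1 n] by auto
  have s3: "scf (\<lambda>x. sin (3 * x)) n = (if n = 3 then 1 else 0)" for n using scf_sin[of 3 n] by auto
  have sc: "scf (cube g 0) n = 3 / 4 * scf sin n - 1 / 4 * scf (\<lambda>x. sin (3 * x)) n" for n
    unfolding cube0 using scf_diff[of "\<lambda>x. 3 / 4 * sin x" "\<lambda>x. 1 / 4 * sin (3 * x)" n] i1 i3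
    by (simp only: scf_cmult integrable_mult_right)
  show c0: "c 0 = 3 / 4" unfolding c_def sc s1 s3 by simp
  have r: "scf (residual g 0) n = (if n = 3 then 1 / 4 else 0)" for n
    unfolding scf_residual sc s1 s3 by (simp add: conv_def c0 scf_g_0)
  have "Linv s (residual g 0) x = 1 / (4 * (3 powr (2 * s) - 1)) * sin (3 * x)" for x
  proof -
    have "Linv s (residual g 0) x = (\<Sum>n\<in>{3}. (if n < 2 then 0 else scf (residual g 0) n / (real n powr (2 * s) - 1)) * sin (real n * x))"
      unfolding Linv_def by (rule suminf_finite) (auto simp: r)
    then show ?thesis by (simp add: r)
  qed
  then show "g 1 = (\<lambda>x. T * (1 / (4 * (3 powr (2 * s) - 1)) * sin (3 * x)))"
    using curve_term_Suc[of s T 0] by (auto simp: step_def)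
qed

section \<open>The branch as a function of the amplitude\<close>

definition q :: real where "q = sqrt T"

text \<open>The weights are a u^m with u = a^2 / T, written as powers of a / q so that estimates for
  differences of powers apply to the derivative in \<open>a\<close>.\<close>

definition curve :: "real \<Rightarrow> real \<Rightarrow> real" where
  "curve a = syn (\<lambda>m. q * (a / q) ^ (2 * m + 1))"

text \<open>The termwise derivative of \<open>curve\<close> in \<open>a\<close>.\<close>

definition dcurve :: "real \<Rightarrow> real \<Rightarrow> real" where
  "dcurve a = syn (\<lambda>m. real (2 * m + 1) * (a / q) ^ (2 * m))"

definition freq :: "real \<Rightarrow> real" where
  "freq a = 1 + a\<^sup>2 * C (a\<^sup>2 / T)"

definition M :: real where "M = sqrt pi * 2 powr s * 2"

lemma M_nonneg: "0 \<le> M"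
  by (simp add: M_def)

lemma q: "q > 0" "q\<^sup>2 = T"
  using T by (auto simp: q_def)

lemma syn_dominated:
  assumes "\<And>m. \<bar>w m\<bar> \<le> k * v m" "summable v"
  shows "summable (\<lambda>m. \<bar>w m\<bar>)" "Hper_norm (2 * s) (syn w) \<le> M * (k * suminf v)"
proof -
  have kv: "summable (\<lambda>m. k * v m)" using assms(2) by (rule summable_mult)
  show w: "summable (\<lambda>m. \<bar>w m\<bar>)" by (rule summable_comparison_test'[OF kv]) (use assms(1) in auto)
  have "Hper_norm (2 * s) (syn w) \<le> M * (\<Sum>m. \<bar>w m\<bar>)"
    unfolding M_def by (rule syn_Hper(2)[OF w])
  also have "\<dots> \<le> M * (\<Sum>m. k * v m)"
    by (intro mult_left_mono suminf_le assms(1) w kv M_nonneg)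
  also have "(\<Sum>m. k * v m) = k * suminf v" by (rule suminf_mult[OF assms(2)])
  finally show "Hper_norm (2 * s) (syn w) \<le> M * (k * suminf v)" .
qed

lemma even_power_le:
  fixes z :: real
  assumes "\<bar>z\<bar> \<le> 1 / 2"
  shows "\<bar>z\<bar> ^ (2 * m) \<le> (1 / 4) ^ m"
proof -
  have "\<bar>z\<bar>\<^sup>2 \<le> (1 / 2)\<^sup>2" using assms by (intro power_mono) auto
  then have "(\<bar>z\<bar>\<^sup>2) ^ m \<le> (1 / 4) ^ m" by (intro power_mono) (auto simp: power2_eq_square)
  then show ?thesis by (simp add: power_mult)
qed

lemma summable_quarter: "summable (\<lambda>m. (1 / 4 :: real) ^ m)"
  by (simp add: summable_geometric)

lemma summable_odd_powers:
  assumes "0 \<le> x" "x < (1::real)"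
  shows "summable (\<lambda>m. real (2 * m + 1) * x ^ m)"
proof (rule summable_comparison_test')
  show "summable (\<lambda>m. 2 * (of_nat (Suc m) * x ^ m))"
    using geometric_deriv_sums[of x] assms by (intro summable_mult) (auto simp: sums_iff)
  fix m
  have "real (2 * m + 1) * x ^ m \<le> (2 * of_nat (Suc m)) * x ^ m"
    using assms by (intro mult_right_mono) auto
  then show "norm (real (2 * m + 1) * x ^ m) \<le> 2 * (of_nat (Suc m) * x ^ m)"
    using assms by (simp add: abs_mult algebra_simps)
qed

lemma curve_weights:
  assumes "\<bar>a\<bar> < q"
  shows "summable (\<lambda>m. \<bar>q * (a / q) ^ (2 * m + 1)\<bar>)"
proof -
  have "\<bar>a / q\<bar> < 1" using assms q by (simp add: abs_divide)
  then have "(a / q)\<^sup>2 < 1" by (simp add: abs_square_less_1)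
  then have "summable (\<lambda>m. ((a / q)\<^sup>2) ^ m)" by (intro summable_geometric) auto
  then have "summable (\<lambda>m. \<bar>a\<bar> * ((a / q)\<^sup>2) ^ m)" by (rule summable_mult)
  moreover have "\<bar>q * (a / q) ^ (2 * m + 1)\<bar> = \<bar>a\<bar> * ((a / q)\<^sup>2) ^ m" for m
  proof -
    have "q * (a / q) ^ (2 * m + 1) = a * ((a / q)\<^sup>2) ^ m" using q by (simp add: power_mult)
    then show ?thesis by (simp only: abs_mult abs_of_nonneg zero_le_power zero_le_power2)
  qed
  ultimately show ?thesis by simp
qed

lemma dcurve_weights:
  assumes "\<bar>a\<bar> < q"
  shows "summable (\<lambda>m. \<bar>real (2 * m + 1) * (a / q) ^ (2 * m)\<bar>)"
proof -
  have "\<bar>a / q\<bar> < 1" using assms q by (simp add: abs_divide)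
  then have "(a / q)\<^sup>2 < 1" by (simp add: abs_square_less_1)
  then have "summable (\<lambda>m. real (2 * m + 1) * ((a / q)\<^sup>2) ^ m)" by (intro summable_odd_powers) auto
  then show ?thesis by (simp add: abs_mult power_mult)
qed

lemma curve_properties:
  assumes a: "\<bar>a\<bar> < q"
  shows "curve a \<in> Hper_odd (2 * s)" "solves s (freq a) (curve a)" "scf (curve a) 1 = a"
proof -
  have "\<bar>a / q\<bar> < 1" using assms q by (simp add: abs_divide)
  then have u1: "(a / q)\<^sup>2 < 1" by (simp add: abs_square_less_1)
  have u: "(a / q)\<^sup>2 = a\<^sup>2 / T" using q by (simp add: power_divide)
  have "(\<lambda>m. q * (a / q) ^ (2 * m + 1)) = (\<lambda>m. a * (a\<^sup>2 / T) ^ m)"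
    using q by (auto simp: power_mult u)
  then have e: "curve a = syn (\<lambda>m. a * (a\<^sup>2 / T) ^ m)" by (simp add: curve_def)
  have *: "0 \<le> a\<^sup>2 / T" "a\<^sup>2 / T < 1" "a\<^sup>2 = T * (a\<^sup>2 / T)" using u1 u T by auto
  show "curve a \<in> Hper_odd (2 * s)" "solves s (freq a) (curve a)" "scf (curve a) 1 = a"
    unfolding e freq_def using curve_solves[OF *] by auto
qed

lemma dcurve_Hper: "\<bar>a\<bar> < q \<Longrightarrow> dcurve a \<in> Hper_odd (2 * s)"
  unfolding dcurve_def by (intro syn_Hper(1) dcurve_weights)

lemma half_q: "\<bar>a\<bar> \<le> q / 2 \<Longrightarrow> \<bar>a / q\<bar> \<le> 1 / 2" "\<bar>a\<bar> \<le> q / 2 \<Longrightarrow> \<bar>a\<bar> < q"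
  using q by (auto simp: abs_divide field_simps)

lemma curve_norm:
  assumes a: "\<bar>a\<bar> \<le> q / 2"
  shows "Hper_norm (2 * s) (curve a) \<le> M * (\<bar>a\<bar> * (\<Sum>m. (1 / 4) ^ m))"
  unfolding curve_def
proof (rule syn_dominated(2)[OF _ summable_quarter])
  fix m
  have "\<bar>q * (a / q) ^ (2 * m + 1)\<bar> = \<bar>a\<bar> * \<bar>a / q\<bar> ^ (2 * m)"
    using q by (simp add: abs_mult power_abs abs_divide)
  also have "\<dots> \<le> \<bar>a\<bar> * (1 / 4) ^ m"
    by (intro mult_left_mono even_power_le half_q a) auto
  finally show "\<bar>q * (a / q) ^ (2 * m + 1)\<bar> \<le> \<bar>a\<bar> * (1 / 4) ^ m" .
qed

text \<open>Dropping the weight at m = 0, which belongs to sin, exposes a factor (a / q)^2; the 4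
  makes up for the shift by one in the powers of 1/4.\<close>

lemma dcurve_minus_sin_norm:
  assumes a: "\<bar>a\<bar> \<le> q / 2"
  shows "Hper_norm (2 * s) (\<lambda>x. dcurve a x - sin x) \<le> M * (4 * (a / q)\<^sup>2 * (\<Sum>m. real (2 * m + 1) * (1 / 4) ^ m))"
proof -
  let ?e = "\<lambda>m::nat. if m = 0 then 1 else 0 :: real"
  let ?w = "\<lambda>m. real (2 * m + 1) * (a / q) ^ (2 * m) - ?e m"
  have se: "summable (\<lambda>m. \<bar>?e m\<bar>)" by (rule summable_finite[of "{0}"]) auto
  have "syn ?e x = sin x" for x
  proof -
    have "syn ?e x = (\<Sum>m\<in>{0}. ?e m * g m x)" unfolding syn_def by (rule suminf_finite) auto
    then show ?thesis by (simp add: curve_term_0)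
  qed
  then have "(\<lambda>x. dcurve a x - sin x) = syn ?w"
    unfolding dcurve_def using syn_diff[OF dcurve_weights[OF half_q(2)[OF a]] se] by auto
  moreover have "Hper_norm (2 * s) (syn ?w) \<le> M * (4 * (a / q)\<^sup>2 * (\<Sum>m. real (2 * m + 1) * (1 / 4) ^ m))"
  proof (rule syn_dominated(2))
    show "summable (\<lambda>m. real (2 * m + 1) * (1 / 4) ^ m)" by (rule summable_odd_powers) auto
    fix m
    show "\<bar>?w m\<bar> \<le> 4 * (a / q)\<^sup>2 * (real (2 * m + 1) * (1 / 4) ^ m)"
    proof (cases m)
      case (Suc k)
      have "\<bar>?w m\<bar> = real (2 * m + 1) * ((a / q)\<^sup>2 * \<bar>a / q\<bar> ^ (2 * k))"
        using Suc by (simp add: abs_mult power_abs power2_eq_square mult.assoc)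
      also have "\<dots> \<le> real (2 * m + 1) * ((a / q)\<^sup>2 * (1 / 4) ^ k)"
        by (intro mult_left_mono even_power_le half_q a) auto
      also have "\<dots> = 4 * (a / q)\<^sup>2 * (real (2 * m + 1) * (1 / 4) ^ m)" using Suc by simp
      finally show ?thesis .
    qed simp
  qed
  ultimately show ?thesis by simp
qed

text \<open>The subtracted terms are those with m = 0 and m = 1. Each remaining weight contains (a /
  q)^5, and 16 makes up for the shift by two in the powers of 1/4.\<close>

lemma curve_expansion_norm:
  assumes a: "\<bar>a\<bar> \<le> q / 2"
  shows "Hper_norm (2 * s) (\<lambda>x. curve a x - (a * sin x + 1 / (4 * (3 powr (2 * s) - 1)) * a ^ 3 * sin (3 * x)))
    \<le> M * (16 * (\<bar>a\<bar> ^ 5 / q ^ 4) * (\<Sum>m. (1 / 4) ^ m))"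
proof -
  let ?w = "\<lambda>m. q * (a / q) ^ (2 * m + 1)"
  let ?e = "\<lambda>m::nat. if m < 2 then ?w m else 0"
  have se: "summable (\<lambda>m. \<bar>?e m\<bar>)" by (rule summable_finite[of "{..<2}"]) auto
  have "syn ?e x = a * sin x + 1 / (4 * (3 powr (2 * s) - 1)) * a ^ 3 * sin (3 * x)" for x
  proof -
    have "syn ?e x = (\<Sum>m\<in>{0, 1}. ?e m * g m x)" unfolding syn_def by (rule suminf_finite) auto
    also have "\<dots> = q * (a / q) * sin x + q * (a / q) ^ 3 * g 1 x" by (simp add: curve_term_0 numeral_3_eq_3)
    also have "q * (a / q) = a" using q by simp
    also have "q * (a / q) ^ 3 * g 1 x = 1 / (4 * (3 powr (2 * s) - 1)) * (q * (a / q) ^ 3 * q\<^sup>2) * sin (3 * x)"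
      unfolding g_1 q(2) by (simp add: mult_ac)
    also have "q * (a / q) ^ 3 * q\<^sup>2 = a ^ 3" using q(1) by (simp add: power2_eq_square power3_eq_cube)
    finally show ?thesis .
  qed
  then have "(\<lambda>x. curve a x - (a * sin x + 1 / (4 * (3 powr (2 * s) - 1)) * a ^ 3 * sin (3 * x))) = syn (\<lambda>m. ?w m - ?e m)"
    unfolding curve_def using syn_diff[OF curve_weights[OF half_q(2)[OF a]] se] by auto
  moreover have "Hper_norm (2 * s) (syn (\<lambda>m. ?w m - ?e m)) \<le> M * (16 * (\<bar>a\<bar> ^ 5 / q ^ 4) * (\<Sum>m. (1 / 4) ^ m))"
  proof (rule syn_dominated(2)[OF _ summable_quarter])
    fix m
    show "\<bar>?w m - ?e m\<bar> \<le> 16 * (\<bar>a\<bar> ^ 5 / q ^ 4) * (1 / 4) ^ m"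
    proof (cases "m < 2")
      case False
      then obtain k where k: "m = k + 2" using nat_le_iff_add[of 2 m] by (metis add.commute not_less)
      define z where "z = a / q"
      have "2 * m + 1 = 5 + 2 * k" using k by simp
      then have "?w m - ?e m = q * z ^ (5 + 2 * k)" using False by (simp only: z_def if_False diff_zero)
      then have "\<bar>?w m - ?e m\<bar> = q * (\<bar>a / q\<bar> ^ 5 * \<bar>a / q\<bar> ^ (2 * k))"
        using q unfolding z_def[symmetric] by (simp add: abs_mult power_abs power_add)
      also have "\<dots> \<le> q * (\<bar>a / q\<bar> ^ 5 * (1 / 4) ^ k)"
        using q by (intro mult_left_mono even_power_le half_q a) auto
      also have "q * (\<bar>a / q\<bar> ^ 5 * (1 / 4) ^ k) = (q * \<bar>a / q\<bar> ^ 5) * (1 / 4) ^ k" by simp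
      also have "q * \<bar>a / q\<bar> ^ 5 = \<bar>a\<bar> ^ 5 / q ^ 4"
        using q by (simp add: abs_divide power_divide eval_nat_numeral)
      also have "(1 / 4 :: real) ^ k = 16 * (1 / 4) ^ m" using k by (simp add: power_add)
      finally show ?thesis by (simp add: mult_ac)
    qed (use q in auto)
  qed
  ultimately show ?thesis by simp
qed

lemma summable_second_difference:
  "summable (\<lambda>m. real (2 * m + 1) * real (2 * m + 1 - Suc 0) * (3 / 4) ^ (2 * m + 1 - 2))"
proof (rule summable_comparison_test')
  show "summable (\<lambda>m. 2 * ((2 * real m + 1) * (2 * real m) * (9 / 16) ^ m))"
  proof (rule summable_mult, rule summable_comparison_test_bigo)
    show "summable (\<lambda>m. norm ((3 / 4 :: real) ^ m))" by (simp add: summable_geometric)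
    show "(\<lambda>m. (2 * real m + 1) * (2 * real m) * (9 / 16) ^ m) \<in> O(\<lambda>m. (3 / 4) ^ m)"
      by real_asymp
  qed
  fix m
  show "norm (real (2 * m + 1) * real (2 * m + 1 - Suc 0) * (3 / 4) ^ (2 * m + 1 - 2))
     \<le> 2 * ((2 * real m + 1) * (2 * real m) * (9 / 16) ^ m)"
  proof (cases m)
    case (Suc k)
    \<comment> \<open>For m > 0 the left side is 4/3 times (9/16)^m. At m = 0, where the exponent is
      truncated, the factor in front is 0.\<close>
    have "(3 / 4 :: real) ^ (2 * m + 1 - 2) \<le> 2 * (9 / 16) ^ m"
    proof -
      have "(9 / 16 :: real) ^ m = (3 / 4) ^ (2 * m)" by (simp add: power_mult power2_eq_square)
      also have "\<dots> = 3 / 4 * (3 / 4) ^ (2 * m + 1 - 2)" using Suc by simp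
      finally have eq: "(9 / 16 :: real) ^ m = 3 / 4 * (3 / 4) ^ (2 * m + 1 - 2)" .
      have "p \<le> 2 * x" if "x = 3 / 4 * p" "0 \<le> x" for p x :: real
        using that by (simp add: field_simps)
      from this[OF eq] show ?thesis by simp
    qed
    then have "(2 * real m + 1) * (2 * real m) * (3 / 4) ^ (2 * m + 1 - 2) \<le> (2 * real m + 1) * (2 * real m) * (2 * (9 / 16) ^ m)"
      by (intro mult_left_mono) auto
    then show ?thesis by (simp add: abs_mult mult_ac add_ac)
  qed simp
qed

text \<open>The second-order estimate for (z + k)^n - z^n with z = a / q and k = h / q, of modulus
  at most 1/2 and 1/4, hence the powers of 3/4; it is summed over the weights.\<close>

lemma curve_difference_quotient:
  assumes a: "\<bar>a\<bar> \<le> q / 2" and h: "h \<noteq> 0" "\<bar>h\<bar> \<le> q / 4"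
  shows "Hper_norm (2 * s) (\<lambda>x. (curve (a + h) x - curve a x) / h - dcurve a x)
    \<le> M * (\<bar>h / q\<bar> * (\<Sum>m. real (2 * m + 1) * real (2 * m + 1 - Suc 0) * (3 / 4) ^ (2 * m + 1 - 2)))"
proof -
  let ?z = "a / q" and ?k = "h / q"
  have ah: "\<bar>a + h\<bar> < q" using a h q by linarith
  note sw = curve_weights[OF ah] curve_weights[OF half_q(2)[OF a]] dcurve_weights[OF half_q(2)[OF a]]
  let ?w = "\<lambda>m. (q * ((a + h) / q) ^ (2 * m + 1) - q * ?z ^ (2 * m + 1))"
  have s1: "summable (\<lambda>m. \<bar>?w m\<bar>)"
  proof (rule summable_comparison_test')
    show "summable (\<lambda>m. \<bar>q * ((a + h) / q) ^ (2 * m + 1)\<bar> + \<bar>q * ?z ^ (2 * m + 1)\<bar>)"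
      by (rule summable_add[OF sw(1,2)])
  qed (simp add: abs_triangle_ineq4)
  then have s2: "summable (\<lambda>m. \<bar>1 / h * ?w m\<bar>)" unfolding abs_mult by (rule summable_mult)
  have "(\<lambda>x. (curve (a + h) x - curve a x) / h - dcurve a x)
     = syn (\<lambda>m. 1 / h * ?w m - real (2 * m + 1) * ?z ^ (2 * m))"
  proof
    fix x
    have "syn (\<lambda>m. 1 / h * ?w m - real (2 * m + 1) * ?z ^ (2 * m)) x
        = syn (\<lambda>m. 1 / h * ?w m) x - syn (\<lambda>m. real (2 * m + 1) * ?z ^ (2 * m)) x"
      by (rule syn_diff[OF s2 sw(3)])
    also have "syn (\<lambda>m. 1 / h * ?w m) x = 1 / h * syn ?w x" by (rule syn_cmult[OF s1])
    also have "syn ?w x = curve (a + h) x - curve a x" unfolding curve_def by (rule syn_diff[OF sw(1,2)])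
    finally show "(curve (a + h) x - curve a x) / h - dcurve a x
        = syn (\<lambda>m. 1 / h * ?w m - real (2 * m + 1) * ?z ^ (2 * m)) x"
      by (simp add: dcurve_def)
  qed
  moreover have "Hper_norm (2 * s) (syn (\<lambda>m. 1 / h * ?w m - real (2 * m + 1) * ?z ^ (2 * m)))
     \<le> M * (\<bar>h / q\<bar> * (\<Sum>m. real (2 * m + 1) * real (2 * m + 1 - Suc 0) * (3 / 4) ^ (2 * m + 1 - 2)))"
  proof (rule syn_dominated(2)[OF _ summable_second_difference])
    fix m
    have k0: "?k \<noteq> 0" using h q by simp
    have z: "\<bar>?z\<bar> \<le> 1 / 2" by (rule half_q(1)[OF a])
    have k: "\<bar>?k\<bar> \<le> 1 / 4" using h q by (simp add: abs_divide field_simps)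
    have td: "norm (((?z + ?k) ^ (2 * m + 1) - ?z ^ (2 * m + 1)) / ?k - of_nat (2 * m + 1) * ?z ^ (2 * m + 1 - Suc 0))
       \<le> of_nat (2 * m + 1) * of_nat (2 * m + 1 - Suc 0) * (3 / 4) ^ (2 * m + 1 - 2) * norm ?k"
    proof (rule lemma_termdiff3[OF k0])
      show "norm ?z \<le> 3 / 4" using z unfolding real_norm_def by linarith
      show "norm (?z + ?k) \<le> 3 / 4" using z k abs_triangle_ineq[of ?z ?k] unfolding real_norm_def by linarith
    qed
    have e: "1 / h * ?w m = ((?z + ?k) ^ (2 * m + 1) - ?z ^ (2 * m + 1)) / ?k"
    proof -
      have "(a + h) / q = ?z + ?k" by (rule add_divide_distrib)
      moreover have "1 / h * (q * A - q * B) = (A - B) / ?k" for A B :: real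
        using h q by (simp add: field_simps)
      ultimately show ?thesis by (simp only:)
    qed
    have e1: "2 * m + 1 - Suc 0 = 2 * m" by simp
    show "\<bar>1 / h * ?w m - real (2 * m + 1) * ?z ^ (2 * m)\<bar>
       \<le> \<bar>h / q\<bar> * (real (2 * m + 1) * real (2 * m + 1 - Suc 0) * (3 / 4) ^ (2 * m + 1 - 2))"
      unfolding e using td unfolding real_norm_def e1 by (simp only: mult_ac)
  qed
  ultimately show ?thesis by simp
qed

lemma freq_expansion:
  assumes a: "\<bar>a\<bar> \<le> q"
  shows "\<bar>freq a - (1 + 3 / 4 * a\<^sup>2)\<bar> \<le> (\<Sum>m. \<bar>c m\<bar>) / T * a ^ 4"
proof -
  define u where "u = a\<^sup>2 / T"
  have "\<bar>a\<bar>\<^sup>2 \<le> q\<^sup>2" using a by (intro power_mono) auto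
  then have u: "0 \<le> u" "u \<le> 1" using T q by (auto simp: u_def)
  have sc: "summable (\<lambda>m. c m * u ^ m)"
    using summable_rabs_cancel[OF c_powser_summable[of u]] u by (simp add: mult.commute)
  have "\<bar>C u - c 0\<bar> \<le> u * (\<Sum>m. \<bar>c m\<bar>)"
  proof -
    have "C u - c 0 = (\<Sum>m. c (Suc m) * u ^ Suc m)"
      unfolding C_def using suminf_split_head[OF sc] by simp
    also have "\<bar>\<dots>\<bar> \<le> (\<Sum>m. \<bar>c (Suc m) * u ^ Suc m\<bar>)"
      by (rule summable_rabs) (use c_powser_summable[of u] u in \<open>subst summable_Suc_iff, simp add: mult.commute\<close>)
    also have "\<dots> \<le> (\<Sum>m. u * \<bar>c (Suc m)\<bar>)"
    proof (rule suminf_le)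
      fix m
      have "u ^ m \<le> 1" using u by (intro power_le_one)
      then have "\<bar>c (Suc m)\<bar> * (u * u ^ m) \<le> \<bar>c (Suc m)\<bar> * (u * 1)"
        using u by (intro mult_left_mono) auto
      then show "\<bar>c (Suc m) * u ^ Suc m\<bar> \<le> u * \<bar>c (Suc m)\<bar>" using u by (simp add: abs_mult mult_ac)
    next
      show "summable (\<lambda>m. \<bar>c (Suc m) * u ^ Suc m\<bar>)"
        using c_powser_summable[of u] u by (subst summable_Suc_iff) (simp add: mult.commute)
      show "summable (\<lambda>m. u * \<bar>c (Suc m)\<bar>)"
        using summable_c by (intro summable_mult) (subst summable_Suc_iff)
    qed
    also have "\<dots> = u * (\<Sum>m. \<bar>c (Suc m)\<bar>)"
      using summable_c by (intro suminf_mult) (subst summable_Suc_iff)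
    also have "(\<Sum>m. \<bar>c (Suc m)\<bar>) \<le> (\<Sum>m. \<bar>c m\<bar>)"
      using suminf_split_head[OF summable_c] by simp
    finally show ?thesis using u by (simp add: mult_left_mono)
  qed
  then have "a\<^sup>2 * \<bar>C u - c 0\<bar> \<le> a\<^sup>2 * (u * (\<Sum>m. \<bar>c m\<bar>))" by (intro mult_left_mono) auto
  moreover have "freq a - (1 + 3 / 4 * a\<^sup>2) = a\<^sup>2 * (C u - c 0)"
    by (simp add: freq_def u_def c_0 algebra_simps)
  moreover have "a\<^sup>2 * (u * (\<Sum>m. \<bar>c m\<bar>)) = (\<Sum>m. \<bar>c m\<bar>) / T * a ^ 4"
    by (simp add: u_def power2_eq_square power4_eq_xxxx)
  ultimately show ?thesis by (simp add: abs_mult)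
qed

lemma c_summable_1: "summable (\<lambda>m. c m * 1 ^ m)"
  using summable_rabs_cancel[OF summable_c] by simp

lemma freq_isCont:
  assumes a: "\<bar>a\<bar> < q"
  shows "isCont freq a"
proof -
  have "\<bar>a\<bar>\<^sup>2 < q\<^sup>2" using a by (intro power_strict_mono) auto
  then have "norm (a\<^sup>2 / T) < norm (1::real)" using T q by simp
  then have "isCont C (a\<^sup>2 / T)" unfolding C_def[abs_def] by (rule isCont_powser[OF c_summable_1])
  moreover have "isCont (\<lambda>a. a\<^sup>2 / T) a" by (intro continuous_intros) (use T in auto)
  ultimately have "isCont (\<lambda>a. C (a\<^sup>2 / T)) a" by (rule isCont_o2[rotated])
  then show ?thesis unfolding freq_def[abs_def] by (intro continuous_intros)
qed

text \<open>In u = a^2 / T the frequency is 1 + T u C(u), and u C(u) has derivative C(0) = 3/4 at 0,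
  which stays positive nearby. In the variable \<open>a\<close> the derivative would vanish at
  0.\<close>

lemma freq_increasing:
  "\<exists>b>0. \<forall>x y. 0 \<le> x \<longrightarrow> x < y \<longrightarrow> y < b \<longrightarrow> freq x < freq y"
proof -
  define D where "D u = u * C u" for u
  define D' where "D' u = C u + u * (\<Sum>m. diffs c m * u ^ m)" for u
  have der: "(D has_real_derivative D' u) (at u)" if "\<bar>u\<bar> < 1" for u
  proof -
    have "(C has_real_derivative (\<Sum>m. diffs c m * u ^ m)) (at u)"
      unfolding C_def[abs_def] using that by (intro termdiffs_strong[OF c_summable_1]) auto
    then have "((\<lambda>u. u * C u) has_real_derivative (1 * C u + (\<Sum>m. diffs c m * u ^ m) * u)) (at u)"
      by (intro DERIV_mult DERIV_ident)
    then show ?thesis by (simp add: D_def[abs_def] D'_def mult.commute)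
  qed
  have "isCont (\<lambda>u. \<Sum>m. diffs c m * u ^ m) 0"
  proof (rule isCont_powser)
    show "summable (\<lambda>m. diffs c m * (1 / 2) ^ m)"
    proof (rule termdiff_converges[where K=1])
      fix x :: real assume "norm x < 1"
      then show "summable (\<lambda>m. c m * x ^ m)"
        using summable_rabs_cancel[OF c_powser_summable[of x]] by (simp add: mult.commute)
    qed simp
  qed simp
  moreover have "isCont C 0" unfolding C_def[abs_def] by (rule isCont_powser[OF c_summable_1]) simp
  ultimately have "isCont D' 0" unfolding D'_def[abs_def] by (intro continuous_intros)
  moreover have "D' 0 = 3 / 4"
  proof -
    have "C 0 = c 0" unfolding C_def using powser_zero[of c] by simp
    then show ?thesis by (simp add: D'_def c_0)
  qed
  ultimately have "(D' \<longlongrightarrow> 3 / 4) (at 0)" by (simp add: isCont_def)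
  then have "eventually (\<lambda>u. D' u > 0) (at 0)" by (rule order_tendstoD) simp
  then obtain d where d: "d > 0" "\<And>u. u \<noteq> 0 \<Longrightarrow> \<bar>u\<bar> < d \<Longrightarrow> D' u > 0"
    unfolding eventually_at by (auto simp: dist_real_def)
  have D'p: "D' u > 0" if "\<bar>u\<bar> < d" for u
    using d(2)[of u] that \<open>D' 0 = 3 / 4\<close> by (cases "u = 0") auto
  define e where "e = min d 1"
  have e: "e > 0" "e \<le> d" "e \<le> 1" using d by (auto simp: e_def)
  have Dm: "D u < D v" if "0 \<le> u" "u < v" "v < e" for u v
  proof (rule DERIV_pos_imp_increasing[OF that(2)])
    fix x assume "u \<le> x" "x \<le> v"
    then have "\<bar>x\<bar> < 1" "\<bar>x\<bar> < d" using that e by auto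
    then show "\<exists>y. (D has_real_derivative y) (at x) \<and> 0 < y" using der D'p by blast
  qed
  have fD: "freq a = 1 + T * D (a\<^sup>2 / T)" for a using T by (simp add: freq_def D_def)
  show ?thesis
  proof (intro exI[of _ "sqrt (T * e)"] conjI allI impI)
    show "0 < sqrt (T * e)" using T e by simp
    fix x y assume xy: "0 \<le> x" "x < y" "y < sqrt (T * e)"
    have "y\<^sup>2 < (sqrt (T * e))\<^sup>2" using xy by (intro power_strict_mono) auto
    then have "y\<^sup>2 / T < e" using T e by (simp add: field_simps)
    moreover have "x\<^sup>2 < y\<^sup>2" using xy by (intro power_strict_mono) auto
    then have "x\<^sup>2 / T < y\<^sup>2 / T" using T by (simp add: divide_strict_right_mono)
    ultimately have "D (x\<^sup>2 / T) < D (y\<^sup>2 / T)" using T by (intro Dm) auto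
    then show "freq x < freq y" using T by (simp add: fD)
  qed
qed

lemma freq_0 [simp]: "freq 0 = 1"
  by (simp add: freq_def)

end

section \<open>The bifurcation branch and its global continuation\<close>

lemma Hper_norm_nonneg: "0 \<le> Hper_norm s f"
  unfolding Hper_norm_def by (intro real_sqrt_ge_zero mult_nonneg_nonneg infsum_nonneg) auto

lemma minimizer_L2_le:
  assumes s: "0 < s" and f: "minimizer s \<omega> f" and \<omega>: "1 < \<omega>"
  shows "(LINT x|MI. (f x)\<^sup>2) \<le> pi * (\<omega> - 1)"
proof -
  let ?X = "LINT x|MI. (f x)\<^sup>2"
  have "oddper f" using f by (simp add: minimizer_def half_pos_def)
  then have "?X\<^sup>2 \<le> pi * ((\<omega> - 1) * ?X)"
    using weak_solution_L2_bound[OF less_imp_le[OF s] minimizer_weak_solution[OF f]] by blast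
  then have "?X * ?X \<le> (pi * (\<omega> - 1)) * ?X" by (simp add: power2_eq_square mult.assoc)
  moreover have "0 \<le> ?X" by (auto intro: Bochner_Integration.integral_nonneg)
  moreover have "0 \<le> pi * (\<omega> - 1)" using \<omega> by simp
  ultimately show ?thesis by (cases "?X = 0") (auto simp: mult_le_cancel_right)
qed

text \<open>The form of the difference is of order |t - \<nu>| by
  \<open>minimizer_form_dist\<close>, so the H^s distance is of the order of its square
  root.\<close>

lemma minimizer_continuous:
  assumes s: "0 < s" "s \<le> 1" and F: "\<And>\<nu>. minimizer s \<nu> (F \<nu>)" and \<nu>: "0 < \<nu>"
  shows "Hper_tendsto s F (F \<nu>) (at \<nu>)"
  unfolding Hper_tendsto_def
proof (rule tendsto_sandwich)
  define G where "G = (LINT x|MI. (F \<nu> x)\<^sup>2)"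
  let ?B = "\<lambda>t. sqrt (2 powr (s + 1) * ((2 * pi * t + G + 2 * pi * \<bar>t - \<nu>\<bar>) * \<bar>t - \<nu>\<bar>))"
  show "((\<lambda>t. 0) \<longlongrightarrow> 0) (at \<nu>)" by simp
  show "(?B \<longlongrightarrow> 0) (at \<nu>)"
    by (rule tendsto_eq_intros | simp)+
  show "eventually (\<lambda>t. 0 \<le> Hper_norm s (\<lambda>x. F t x - F \<nu> x)) (at \<nu>)"
    by (simp add: Hper_norm_nonneg)
  have "eventually (\<lambda>t. 0 < t) (at \<nu>)"
    using order_tendstoD(1)[OF tendsto_ident_at \<nu>] .
  then show "eventually (\<lambda>t. Hper_norm s (\<lambda>x. F t x - F \<nu> x) \<le> ?B t) (at \<nu>)"
  proof eventually_elim
    case (elim t)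
    have E: "energy_space s (F t)" "energy_space s (F \<nu>)" "oddper (F t)" "oddper (F \<nu>)"
      using F[of t] F[of \<nu>] by (auto simp: minimizer_def half_pos_def)
    have "Hper_norm s (\<lambda>x. F t x - F \<nu> x)
      \<le> sqrt (2 powr (s + 1) * form s (\<lambda>x. F t x - F \<nu> x) (\<lambda>x. F t x - F \<nu> x))"
      by (rule Hper_odd_of_energy_space(2)[OF less_imp_le[OF s(1)] energy_space_diff[OF E(1,2)] oddper_diff[OF E(3,4)]])
    also have "\<dots> \<le> ?B t"
      unfolding G_def using minimizer_form_dist[OF s F F, of t \<nu>] elim
      by (intro real_sqrt_le_mono mult_left_mono) auto
    finally show ?case .
  qed
qed

lemma (in branch) curve_weak:
  assumes "\<bar>a\<bar> < q"
  shows "weak_solution s (freq a) (curve a)" "oddper (curve a)"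
  using Hper_odd_solves_weak[OF s curve_properties(1,2)[OF assms]] by auto

lemma (in branch) curve_tendsto:
  "((\<lambda>a. Hper_norm (2 * s) (curve a)) \<longlongrightarrow> 0) (at_right 0)"
  "Hper_tendsto (2 * s) dcurve sin (at_right 0)"
proof -
  have ev: "eventually (\<lambda>a. 0 < a \<and> a < q / 2) (at_right 0)"
    using q(1) by (auto simp: eventually_at_right_field intro: exI[of _ "q / 2"])
  show "((\<lambda>a. Hper_norm (2 * s) (curve a)) \<longlongrightarrow> 0) (at_right 0)"
  proof (rule tendsto_sandwich[OF _ _ tendsto_const])
    show "eventually (\<lambda>a. Hper_norm (2 * s) (curve a) \<le> M * (\<bar>a\<bar> * (\<Sum>m. (1 / 4) ^ m))) (at_right 0)"
      using ev by eventually_elim (rule curve_norm, simp)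
    show "((\<lambda>a. M * (\<bar>a\<bar> * (\<Sum>m. (1 / 4) ^ m))) \<longlongrightarrow> 0) (at_right 0)"
      by (rule tendsto_eq_intros | simp)+
  qed (simp add: Hper_norm_nonneg)
  show "Hper_tendsto (2 * s) dcurve sin (at_right 0)"
    unfolding Hper_tendsto_def
  proof (rule tendsto_sandwich[OF _ _ tendsto_const])
    let ?B = "\<lambda>a. M * (4 * (a / q)\<^sup>2 * (\<Sum>m. real (2 * m + 1) * (1 / 4) ^ m))"
    show "eventually (\<lambda>a. Hper_norm (2 * s) (\<lambda>x. dcurve a x - sin x) \<le> ?B a) (at_right 0)"
      using ev by eventually_elim (rule dcurve_minus_sin_norm, simp)
    have "(?B \<longlongrightarrow> M * (4 * (0 / q)\<^sup>2 * (\<Sum>m. real (2 * m + 1) * (1 / 4) ^ m))) (at_right 0)"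
      using q(1) by (intro tendsto_intros) auto
    then show "(?B \<longlongrightarrow> 0) (at_right 0)" by simp
  qed (simp add: Hper_norm_nonneg)
qed

lemma (in branch) curve_derivative:
  assumes a: "\<bar>a\<bar> \<le> q / 2"
  shows "Hper_tendsto (2 * s) (\<lambda>h x. (curve (a + h) x - curve a x) / h) (dcurve a) (at 0)"
  unfolding Hper_tendsto_def
proof (rule tendsto_sandwich[OF _ _ tendsto_const])
  let ?B = "\<lambda>h. M * (\<bar>h / q\<bar> * (\<Sum>m. real (2 * m + 1) * real (2 * m + 1 - Suc 0) * (3 / 4) ^ (2 * m + 1 - 2)))"
  have "eventually (\<lambda>h. h \<noteq> 0 \<and> \<bar>h\<bar> < q / 4) (at 0)"
    unfolding eventually_at using q(1) by (intro exI[of _ "q / 4"]) (auto simp: dist_real_def)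
  then show "eventually (\<lambda>h. Hper_norm (2 * s) (\<lambda>x. (curve (a + h) x - curve a x) / h - dcurve a x) \<le> ?B h) (at 0)"
    by eventually_elim (rule curve_difference_quotient[OF a], auto)
  have "(?B \<longlongrightarrow> M * (\<bar>0 / q\<bar> * (\<Sum>m. real (2 * m + 1) * real (2 * m + 1 - Suc 0) * (3 / 4) ^ (2 * m + 1 - 2)))) (at 0)"
    using q(1) by (intro tendsto_intros) auto
  then show "(?B \<longlongrightarrow> 0) (at 0)" by simp
qed (simp add: Hper_norm_nonneg)

text \<open>Nontriviality is read off the first coefficient, which is \<open>a\<close>. The
  restriction of \<open>a0\<close> keeps all series dominated by fixed convergent ones.\<close>

lemma (in branch) curve_bifurcation:
  assumes a0: "a0 \<le> q / 2" and pos: "\<And>a. 0 < a \<Longrightarrow> a < a0 \<Longrightarrow> 0 < freq a"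
  shows "bifurcation_curve s a0 curve freq"
proof -
  have aq: "\<bar>a\<bar> \<le> q / 2" "\<bar>a\<bar> < q" if "a \<in> {0<..<a0}" for a using that a0 by auto
  have nz: "\<not> (AE x in lborel. curve a x = 0)" if a: "a \<in> {0<..<a0}" for a
  proof
    assume "AE x in lborel. curve a x = 0"
    then have "AE x in MI. curve a x = 0" unfolding AE_MI by eventually_elim simp
    moreover have "curve a \<in> borel_measurable borel"
      using curve_properties(1)[OF aq(2)[OF a]] by (auto simp: Hper_odd_iff sqint_def)
    ultimately have "scf (curve a) 1 = scf (\<lambda>x. 0) 1" by (intro scf_cong_AE) auto
    then show False using curve_properties(3)[OF aq(2)[OF a]] a by (simp add: scf_def)
  qed
  have c: "continuous_on {0<..<a0} freq"
    using freq_isCont aq(2) by (intro continuous_at_imp_continuous_on) auto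
  have "(freq \<longlongrightarrow> freq 0) (at 0)" using freq_isCont[of 0] q(1) by (simp add: isCont_def)
  then have f1: "(freq \<longlongrightarrow> 1) (at_right 0)" by (simp add: filterlim_at_split)
  have d: "\<exists>d\<phi>. (\<forall>a\<in>{0<..<a0}. d\<phi> a \<in> Hper_odd (2 * s) \<and>
      Hper_tendsto (2 * s) (\<lambda>h x. (curve (a + h) x - curve a x) / h) (d\<phi> a) (at 0)) \<and>
      Hper_tendsto (2 * s) d\<phi> sin (at_right 0)"
    using dcurve_Hper[OF aq(2)] curve_derivative[OF aq(1)] curve_tendsto(2) by blast
  show ?thesis
    unfolding bifurcation_curve_def
    using curve_properties(1,2)[OF aq(2)] pos nz c f1 d curve_tendsto(1)
    by (auto simp: Hper_tendsto_def)
qed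

section \<open>Joining the local branch to the global family\<close>

theorem proposition3p4:
  fixes s :: real
  assumes "0 < s" and "s \<le> 1"
  shows "\<exists>a0>0. \<exists>\<epsilon>>0. \<exists>(\<phi> :: real \<Rightarrow> real \<Rightarrow> real) (\<omega> :: real \<Rightarrow> real).
    bifurcation_curve s a0 \<phi> \<omega> \<and>
    (\<forall>a\<in>{0<..<a0}. local_solution s \<epsilon> a (\<phi> a) (\<omega> a) \<and>
       (\<forall>\<psi> \<nu>. local_solution s \<epsilon> a \<psi> \<nu> \<longrightarrow> \<nu> = \<omega> a \<and> (AE x in lborel. \<psi> x = \<phi> a x))) \<and>
    (\<lambda>a. Hper_norm (2 * s)
        (\<lambda>x. \<phi> a x - (a * sin x + 1 / (4 * (3 powr (2 * s) - 1)) * a ^ 3 * sin (3 * x))))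
      \<in> O[at_right 0](\<lambda>a. a ^ 5) \<and>
    (\<lambda>a. \<omega> a - (1 + 3 / 4 * a\<^sup>2)) \<in> O[at_right 0](\<lambda>a. a ^ 4) \<and>
    (1 / 4 < s \<longrightarrow>
      (\<exists>\<Phi> :: real \<Rightarrow> real \<Rightarrow> real.
         (\<forall>\<nu>>1. \<Phi> \<nu> \<in> Hper_odd s \<and> solves s \<nu> (\<Phi> \<nu>) \<and> Hper_tendsto s \<Phi> (\<Phi> \<nu>) (at \<nu>)) \<and>
         (\<forall>a\<in>{0<..<a0}. 1 < \<omega> a \<and> (AE x in lborel. \<Phi> (\<omega> a) x = \<phi> a x))))"
proof -
  have p1: "1 < (2::real) powr (2 * s)" using assms(1) by simp
  \<comment> \<open>The largest value that the locale condition permits.\<close>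
  define T where "T = (2 powr (2 * s) - 1) / (24 * 2 powr (2 * s))"
  interpret branch s T
    by standard (use assms p1 in \<open>auto simp: T_def\<close>)
  \<comment> \<open>Half the gap between the eigenvalues 1 and 2^(2s); it also serves as the radius
    of the neighbourhood in which local solutions are unique.\<close>
  define e where "e = (2 powr (2 * s) - 1) / 2"
  have e: "e > 0" "1 + 2 * e \<le> 2 powr (2 * s)" using p1 by (simp_all add: e_def field_simps)
  obtain b where b: "b > 0" "\<And>x y. 0 \<le> x \<Longrightarrow> x < y \<Longrightarrow> y < b \<Longrightarrow> freq x < freq y"
    using freq_increasing by blast
  have "(freq \<longlongrightarrow> freq 0) (at 0)" using freq_isCont[of 0] q(1) by (simp add: isCont_def)
  then have f1: "(freq \<longlongrightarrow> 1) (at_right 0)" by (simp add: filterlim_at_split)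
  have ident: "((\<lambda>a::real. a) \<longlongrightarrow> 0) (at_right 0)" by (rule tendsto_ident_at)
  have sq0: "((\<lambda>a::real. a\<^sup>2) \<longlongrightarrow> 0) (at_right 0)" using tendsto_power[OF ident, of 2] by simp
  have "((\<lambda>a. \<bar>freq a - 1\<bar>) \<longlongrightarrow> \<bar>1 - 1\<bar>) (at_right 0)" by (intro tendsto_intros f1)
  then have f2: "((\<lambda>a. \<bar>freq a - 1\<bar>) \<longlongrightarrow> 0) (at_right 0)" by simp
  \<comment> \<open>Below \<open>a1\<close> the curve stays in the neighbourhood, its frequency
    increases, and the smallness condition of the uniqueness theorem holds.\<close>
  have "eventually (\<lambda>a. a < q / 2 \<and> a\<^sup>2 < e / 4 \<and> Hper_norm (2 * s) (curve a) < e \<and> \<bar>freq a - 1\<bar> < e \<and> a < b) (at_right 0)"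
    using q(1) e(1) b(1) by (intro eventually_conj order_tendstoD(2)[OF ident] order_tendstoD(2)[OF sq0]
        order_tendstoD(2)[OF curve_tendsto(1)] order_tendstoD(2)[OF f2]) auto
  then obtain a1 where a1: "a1 > 0" and small: "\<And>a. 0 < a \<Longrightarrow> a < a1 \<Longrightarrow>
      a < q / 2 \<and> a\<^sup>2 < e / 4 \<and> Hper_norm (2 * s) (curve a) < e \<and> \<bar>freq a - 1\<bar> < e \<and> a < b"
    unfolding eventually_at_right_field by auto
  \<comment> \<open>A smaller range, with \<omega> = freq a so close to 1 that the minimizer at
    \<omega> has a first coefficient \<alpha> with \<alpha>^2 \<le> 4 pi (\<omega> - 1) < a1^2,
    within reach of the uniqueness theorem.\<close>
  have "eventually (\<lambda>a. a < a1 \<and> a < q / 2 \<and> freq a < 1 + a1\<^sup>2 / (4 * pi)) (at_right 0)"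
    using q(1) a1 by (intro eventually_conj order_tendstoD(2)[OF ident] order_tendstoD(2)[OF f1]) auto
  then obtain a2 where a2: "a2 > 0" and small2: "\<And>a. 0 < a \<Longrightarrow> a < a2 \<Longrightarrow>
      a < a1 \<and> a < q / 2 \<and> freq a < 1 + a1\<^sup>2 / (4 * pi)"
    unfolding eventually_at_right_field by auto
  define a0 where "a0 = min a2 (q / 2)"
  have a0: "a0 > 0" "a0 \<le> q / 2" "a0 \<le> a2" using a2 q(1) by (auto simp: a0_def)
  have aq: "\<bar>a\<bar> < q" if "0 < a" "a < a1" for a using small[OF that] that q(1) by linarith
  have gt1: "1 < freq a" if "0 < a" "a < a1" for a
    using b(2)[of 0 a] small[OF that] that by simp
  have uniq: "\<nu> = freq a \<and> (AE x in lborel. \<psi> x = curve a x)"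
    if a: "0 < a" "a < a1" and \<psi>: "weak_solution s \<nu> \<psi>" "oddper \<psi>" "scf \<psi> 1 = a" "\<bar>\<nu> - 1\<bar> < e" for a \<psi> \<nu>
  proof -
    note w = curve_weak[OF aq[OF a]]
    have "a\<^sup>2 \<le> e / 4" "\<bar>freq a - 1\<bar> < e" using small[OF a] by auto
    note u = weak_solution_unique[OF assms(1) e a(1) this(1) \<psi> w curve_properties(3)[OF aq[OF a]] this(2)]
    have "AE x in lborel. \<psi> x = curve a x"
      using \<psi> w u(2) by (intro oddper_AE_eq) (auto simp: weak_solution_def energy_spaceD(5))
    then show ?thesis using u(1) by simp
  qed
  have a01: "0 < a \<and> a < a1" if "a \<in> {0<..<a0}" for a
    using that small2[of a] a0 by auto
  have loc: "local_solution s e a (curve a) (freq a)" if "a \<in> {0<..<a0}" for a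
  proof -
    note a = a01[OF that]
    have aq': "\<bar>a\<bar> < q" using aq a by blast
    note w = curve_weak[OF aq']
    have "energy_space s (curve a)" using w(1) by (simp add: weak_solution_def)
    then have "sin_coeff1 (curve a) = a"
      using sin_coeff1_odd[OF w(2) energy_spaceD(5) energy_spaceD(3)] curve_properties(3)[OF aq'] by simp
    then show ?thesis
      unfolding local_solution_def using curve_properties(1,2)[OF aq'] small[of a] gt1[of a] a by auto
  qed
  have loc_uniq: "\<nu> = freq a \<and> (AE x in lborel. \<psi> x = curve a x)"
    if a: "a \<in> {0<..<a0}" and \<psi>: "local_solution s e a \<psi> \<nu>" for a \<psi> \<nu>
  proof -
    have "\<psi> \<in> Hper_odd (2 * s)" "solves s \<nu> \<psi>" "\<bar>\<nu> - 1\<bar> < e" "sin_coeff1 \<psi> = a"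
      using \<psi> by (auto simp: local_solution_def)
    note w = Hper_odd_solves_weak[OF assms(1) this(1,2)] this(3,4)
    have "energy_space s \<psi>" using w(1) by (simp add: weak_solution_def)
    then have "scf \<psi> 1 = a" using sin_coeff1_odd[OF w(2) energy_spaceD(5) energy_spaceD(3)] w(4) by simp
    then show ?thesis using uniq[of a \<nu> \<psi>] a01[OF a] w by blast
  qed
  have bif: "bifurcation_curve s a0 curve freq"
    using a0(2) gt1 a01 by (intro curve_bifurcation) force+
  have ev: "eventually (\<lambda>a. 0 < a \<and> a < q / 2) (at_right 0)"
    using q(1) by (auto simp: eventually_at_right_field intro: exI[of _ "q / 2"])
  have exp1: "(\<lambda>a. Hper_norm (2 * s)
        (\<lambda>x. curve a x - (a * sin x + 1 / (4 * (3 powr (2 * s) - 1)) * a ^ 3 * sin (3 * x))))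
      \<in> O[at_right 0](\<lambda>a. a ^ 5)"
  proof (rule bigoI)
    show "eventually (\<lambda>a. norm (Hper_norm (2 * s)
        (\<lambda>x. curve a x - (a * sin x + 1 / (4 * (3 powr (2 * s) - 1)) * a ^ 3 * sin (3 * x))))
      \<le> (M * (16 / q ^ 4 * (\<Sum>m. (1 / 4) ^ m))) * norm (a ^ 5)) (at_right 0)"
      using ev
    proof eventually_elim
      case (elim a)
      then have "\<bar>a\<bar> \<le> q / 2" by simp
      from curve_expansion_norm[OF this] show ?case
        unfolding real_norm_def abs_of_nonneg[OF Hper_norm_nonneg] power_abs
        by (simp add: mult_ac)
    qed
  qed
  have exp2: "(\<lambda>a. freq a - (1 + 3 / 4 * a\<^sup>2)) \<in> O[at_right 0](\<lambda>a. a ^ 4)"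
  proof (rule bigoI)
    show "eventually (\<lambda>a. norm (freq a - (1 + 3 / 4 * a\<^sup>2)) \<le> ((\<Sum>m. \<bar>c m\<bar>) / T) * norm (a ^ 4)) (at_right 0)"
      using ev
    proof eventually_elim
      case (elim a)
      then have "\<bar>a\<bar> \<le> q" by simp
      from freq_expansion[OF this] show ?case by simp
    qed
  qed
  \<comment> \<open>The choice is made for each frequency separately; continuity holds for any
    choice, because the distance estimates apply to arbitrary minimizers.\<close>
  define \<Phi> where "\<Phi> \<nu> = (SOME f. minimizer s \<nu> f)" for \<nu>
  have \<Phi>: "minimizer s \<nu> (\<Phi> \<nu>)" for \<nu>
    unfolding \<Phi>_def using minimizer_exists[OF assms] by (rule someI_ex)
  have \<Phi>_odd: "oddper (\<Phi> \<nu>)" "energy_space s (\<Phi> \<nu>)" for \<nu> using \<Phi>[of \<nu>] by (auto simp: minimizer_def half_pos_def)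
  note \<Phi>_weak = minimizer_weak_solution[OF \<Phi>]
  have glob: "\<Phi> \<nu> \<in> Hper_odd s \<and> solves s \<nu> (\<Phi> \<nu>) \<and> Hper_tendsto s \<Phi> (\<Phi> \<nu>) (at \<nu>)" if "\<nu> > 1" for \<nu>
    using Hper_odd_of_energy_space(1)[OF less_imp_le[OF assms(1)] \<Phi>_odd(2,1)] weak_solution_solves[OF \<Phi>_weak \<Phi>_odd(1)]
      minimizer_continuous[OF assms \<Phi>, of \<nu>] that by auto
  have ext: "1 < freq a \<and> (AE x in lborel. \<Phi> (freq a) x = curve a x)" if a: "a \<in> {0<..<a0}" for a
  proof -
    define \<omega> where "\<omega> = freq a"
    have \<omega>: "1 < \<omega>" unfolding \<omega>_def using gt1[of a] a01[OF a] by blast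
    define \<alpha> where "\<alpha> = scf (\<Phi> \<omega>) 1"
    have \<alpha>: "\<alpha> > 0" unfolding \<alpha>_def by (rule minimizer_scf_pos[OF assms \<Phi> \<omega>])
    have "\<alpha> < a1"
    proof -
      let ?X = "LINT x|MI. (\<Phi> \<omega> x)\<^sup>2"
      have X0: "0 \<le> ?X" by (auto intro: Bochner_Integration.integral_nonneg)
      have "\<alpha> \<le> 2 * sqrt ?X" using scf_le_L2[OF energy_spaceD(2)[OF \<Phi>_odd(2)], of \<omega> 1] unfolding \<alpha>_def by linarith
      then have "\<alpha>\<^sup>2 \<le> (2 * sqrt ?X)\<^sup>2" using \<alpha> by (intro power_mono) auto
      also have "\<dots> = 4 * ?X" using X0 by (simp add: power_mult_distrib)
      also have "\<dots> \<le> 4 * (pi * (\<omega> - 1))" using minimizer_L2_le[OF assms(1) \<Phi> \<omega>] by simp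
      also have "\<dots> < a1\<^sup>2"
      proof -
        have "\<omega> - 1 < a1\<^sup>2 / (4 * pi)" unfolding \<omega>_def using small2[of a] a a0 by auto
        then show ?thesis by (simp add: pos_less_divide_eq mult_ac)
      qed
      finally show ?thesis using a1 by (simp add: power_less_imp_less_base)
    qed
    then have u: "\<omega> = freq \<alpha> \<and> (AE x in lborel. \<Phi> \<omega> x = curve \<alpha> x)"
      using \<alpha> small[of a] a01[OF a] by (intro uniq \<Phi>_weak \<Phi>_odd) (auto simp: \<alpha>_def \<omega>_def)
    \<comment> \<open>Uniqueness alone yields \<omega> = freq \<alpha>; strict monotonicity of
      \<open>freq\<close> below \<open>b\<close> identifies \<alpha> with \<open>a\<close>.\<close>
    have "\<alpha> = a"
    proof (rule ccontr)
      assume "\<alpha> \<noteq> a"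
      then consider "\<alpha> < a" | "a < \<alpha>" by linarith
      then show False
        using b(2)[of \<alpha> a] b(2)[of a \<alpha>] u \<alpha> a01[OF a] small[of a] small[OF \<alpha> \<open>\<alpha> < a1\<close>] unfolding \<omega>_def
        by cases auto
    qed
    then show ?thesis using u \<omega> by (simp add: \<omega>_def)
  qed
  have branch: "\<forall>a\<in>{0<..<a0}. local_solution s e a (curve a) (freq a) \<and>
      (\<forall>\<psi> \<nu>. local_solution s e a \<psi> \<nu> \<longrightarrow> \<nu> = freq a \<and> (AE x in lborel. \<psi> x = curve a x))"
  proof (intro ballI conjI allI impI)
    fix a \<psi> \<nu> assume "a \<in> {0<..<a0}"
    then show "local_solution s e a (curve a) (freq a)" by (rule loc)
    assume "local_solution s e a \<psi> \<nu>"
    with \<open>a \<in> {0<..<a0}\<close> have "\<nu> = freq a \<and> (AE x in lborel. \<psi> x = curve a x)" by (rule loc_uniq)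
    then show "\<nu> = freq a" "AE x in lborel. \<psi> x = curve a x" by auto
  qed
  have global: "\<exists>\<Phi>. (\<forall>\<nu>>1. \<Phi> \<nu> \<in> Hper_odd s \<and> solves s \<nu> (\<Phi> \<nu>) \<and> Hper_tendsto s \<Phi> (\<Phi> \<nu>) (at \<nu>)) \<and>
      (\<forall>a\<in>{0<..<a0}. 1 < freq a \<and> (AE x in lborel. \<Phi> (freq a) x = curve a x))"
    by (rule exI[of _ \<Phi>], rule conjI, intro allI impI, erule glob, intro ballI, erule ext)
  show ?thesis
    by (rule exI[of _ a0], rule conjI[OF a0(1)], rule exI[of _ e], rule conjI[OF e(1)],
        rule exI[of _ curve], rule exI[of _ freq])
       (intro conjI bif branch exp1 exp2 impI global)
qed

end
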